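(* Let $\mathcal P$ be a finite presentation of a finitely presented group and let $K'_{\mathcal P}$ be the barycentric subdivision of the standard complex $K_{\mathcal P}$. Let $M$ be an acyclic matching in the face poset $\mathcal X(K'_{\mathcal P})$ with only one critical cell of dimension $0$. Then $\mathcal P$ is $Q^{**}$-equivalent to the Morse presentation $\mathcal Q_{K'_{\mathcal P},M}$.
   Context: $Q^{**}$-equivalence: two finite group presentations are $Q^{**}$-equivalent if one can be transformed into the other by a finite sequence of the following operations on $\langle x_1,\dots,x_n\mid r_1,\dots,r_m\rangle$: (1) replace some $r_i$ by $r_i^{-1}$; (2) replace some $r_i$ by $r_ir_j$ with $j\neq i$; (3) replace some $r_i$ by $wr_iw^{-1}$ with $w$ in the free group $F(x_1,\dots,x_n)$; (4) add a generator $x_{n+1}$ and a relator $r_{m+1}=x_{n+1}$, or the inverse of this operation; (5) replace every $r_i$ by $\phi(r_i)$ for an automorphism $\phi$ of $F(x_1,\dots,x_n)$. Standard complex: for $\mathcal P=\langle x_1,\dots,x_n\mid r_1,\dots,r_m\rangle$, $K_{\mathcal P}$ is the CW-complex with one vertex $o$, one oriented 1-cell for each generator, and one 2-cell for each relator attached along the closed edge path spelled by the relator. Its barycentric subdivision $K'_{\mathcal P}$ is a regular CW-complex of dimension 2: each loop $g$ (generator) is subdivided by its midpoint into two edges, and each 2-cell of a relator $r$ is subdivided as the cone with apex a new vertex $v_r$ over its subdivided boundary circle (a relator of length $\ell$ contributes one new vertex, $2\ell$ new edges and $2\ell$ triangles). Regular CW-complex: every characteristic map $D^k\to\overline{e^k}$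 is a homeomorphism. The face poset $\mathcal X(K)$ is the set of cells of $K$ ordered by $e\le e'$ iff $e\subseteq\overline{e'}$. A matching $M$ in $\mathcal X(K)$ is a set of pairs $(e,e')$ with $e'$ covering $e$ such that each cell is in at most one pair; it is acyclic if reversing in the Hasse diagram (edges directed from $e$ to $e'$ when $e'$ covers $e$) the edges in $M$ gives a digraph with no directed cycle. Critical cells are the cells in no pair. Rewriting rule: if a relator $r$ is a word $w_1x^{\epsilon}w_2$ with $\epsilon=\pm1$ and the generator $x$ appearing neither in $w_1$ nor in $w_2$, the equivalent expression of $x$ induced by $r$ is $(w_1^{-1}w_2^{-1})^{\epsilon}$; applying the rewriting rule to another relator means replacing every occurrence of $x$ in it by this expression (and of $x^{-1}$ by its inverse). Morse presentation $\mathcal Q_{K,M}$, for $K$ a regular 2-dimensional CW-complex and $M$ an acyclic matching in $\mathcal X(K)$ with exactly one critical 0-cell: let $M_0$ be the set of pairs of $M$ of dimensions $(0,1)$ and $M_1=\{(x_1,e_1),\dots,(x_m,e_m)\}$ the set of pairs of dimensions $(1,2)$. The 1-cells matched in $M_0$ form a spanning tree $T$ of $K^{(1)}$. $\mathcal Q_0$ is the presentation whose generators are the (oriented) 1-cells of $K$ not in $T$ and whose relators, one for each 2-cell of $K$, are the words read along the attaching maps of the 2-cells, with 1-cells of $T$ replaced by $1$. For $0\le i<m$, $\mathcal Q_{i+1}$ is obtained from $\mathcal Q_i$ by removing the relator associated with $e_{i+1}$ and the generator $x_{i+1}$, and applying the rewriting rule (the expression of $x_{i+1}$ induced by the removed relator)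 to every occurrence of $x_{i+1}$ in the other relators. Then $\mathcal Q_{K,M}:=\mathcal Q_m$ (the order of the pairs in $M_1$ does not affect the result). *)

theory Defs
  imports "HOL-Analysis.Analysis" "HOL-Algebra.Group"
begin

section \<open>Words and free groups\<close>

text \<open>The letter \<open>(x, True)\<close> stands for the generator x, and \<open>(x, False)\<close> for its inverse.\<close>

type_synonym 'a word = "('a \<times> bool) list"

definition word_inv :: "'a word \<Rightarrow> 'a word" where
  "word_inv w = rev (map (apsnd Not) w)"

fun cancel_Cons :: "'a \<times> bool \<Rightarrow> 'a word \<Rightarrow> 'a word" where
  "cancel_Cons l [] = [l]"
| "cancel_Cons l (l' # w) = (if l' = apsnd Not l then w else l # l' # w)"

definition free_reduce :: "'a word \<Rightarrow> 'a word" where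
  "free_reduce w = foldr cancel_Cons w []"

text \<open>The free group on S, each element being represented by its freely reduced word.\<close>

definition free_group :: "'a set \<Rightarrow> 'a word monoid" where
  "free_group S =
     \<lparr>carrier = {w. fst ` set w \<subseteq> S \<and> free_reduce w = w},
      mult = (\<lambda>u v. free_reduce (u @ v)),
      one = []\<rparr>"


section \<open>Finite presentations and equivalence under the moves\<close>

text \<open>
  The pair \<open>(n, rs)\<close> is a presentation with generators numbered \<open>0, ..., n - 1\<close> and with the list
  rs of relators.  Relators are arbitrary words, not necessarily freely reduced: the standard
  complex depends on the word, whereas the moves below act on the elements of the free group that
  these words represent.
\<close>

type_synonym presentation = "nat \<times> nat word list"

definition is_presentation :: "presentation \<Rightarrow> bool" where
  "is_presentation P \<longleftrightarrow> (\<forall>r\<in>set (snd P). fst ` set r \<subseteq> {..<fst P})"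

abbreviation F :: "nat \<Rightarrow> nat word monoid" where
  "F n \<equiv> free_group {..<n}"

inductive Qss_move :: "presentation \<Rightarrow> presentation \<Rightarrow> bool" where
  invert: "i < length rs \<Longrightarrow>
    Qss_move (n, rs) (n, rs[i := inv\<^bsub>F n\<^esub> (rs ! i)])"
| multiply: "i < length rs \<Longrightarrow> j < length rs \<Longrightarrow> j \<noteq> i \<Longrightarrow>
    Qss_move (n, rs) (n, rs[i := rs ! i \<otimes>\<^bsub>F n\<^esub> rs ! j])"
| conjugate: "i < length rs \<Longrightarrow> w \<in> carrier (F n) \<Longrightarrow>
    Qss_move (n, rs) (n, rs[i := w \<otimes>\<^bsub>F n\<^esub> rs ! i \<otimes>\<^bsub>F n\<^esub> inv\<^bsub>F n\<^esub> w])"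
| add_generator:
    "Qss_move (n, rs) (Suc n, rs @ [[(n, True)]])"
| remove_generator: "set rs \<subseteq> carrier (F n) \<Longrightarrow>
    Qss_move (Suc n, rs @ [[(n, True)]]) (n, rs)"
| automorphism: "\<phi> \<in> iso (F n) (F n) \<Longrightarrow>
    Qss_move (n, rs) (n, map \<phi> rs)"

definition Qss_equivalent :: "presentation \<Rightarrow> presentation \<Rightarrow> bool" where
  "Qss_equivalent P Q \<longleftrightarrow>
     Qss_move\<^sup>*\<^sup>* (apsnd (map free_reduce) P) (apsnd (map free_reduce) Q)"


section \<open>Complexes, face posets and matchings\<close>

text \<open>
  A space decomposed into open cells: \<open>cx_cells K k\<close> is the set of open k-cells.  All notions
  below are meant for regular CW-complexes of dimension at most 2.
\<close>

record 'a complex_of_cells =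
  cx_space :: "'a topology"
  cx_cells :: "nat \<Rightarrow> 'a set set"

definition all_cells :: "'a complex_of_cells \<Rightarrow> 'a set set" where
  "all_cells K = (\<Union>k. cx_cells K k)"

definition face_le :: "'a complex_of_cells \<Rightarrow> 'a set \<Rightarrow> 'a set \<Rightarrow> bool" where
  "face_le K e e' \<longleftrightarrow> e \<subseteq> cx_space K closure_of e'"

definition hasse :: "'a complex_of_cells \<Rightarrow> ('a set \<times> 'a set) set" where
  "hasse K = {(e, e'). e \<in> all_cells K \<and> e' \<in> all_cells K \<and> e \<noteq> e' \<and> face_le K e e' \<and>
     (\<forall>c\<in>all_cells K. face_le K e c \<and> face_le K c e' \<longrightarrow> c = e \<or> c = e')}"

definition is_matching :: "'a complex_of_cells \<Rightarrow> ('a set \<times> 'a set) set \<Rightarrow> bool" where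
  "is_matching K M \<longleftrightarrow> M \<subseteq> hasse K \<and>
     (\<forall>p\<in>M. \<forall>q\<in>M. {fst p, snd p} \<inter> {fst q, snd q} \<noteq> {} \<longrightarrow> p = q)"

definition is_acyclic_matching :: "'a complex_of_cells \<Rightarrow> ('a set \<times> 'a set) set \<Rightarrow> bool" where
  "is_acyclic_matching K M \<longleftrightarrow> is_matching K M \<and> acyclic ((hasse K - M) \<union> M\<inverse>)"

definition critical_cells :: "'a complex_of_cells \<Rightarrow> ('a set \<times> 'a set) set \<Rightarrow> nat \<Rightarrow> 'a set set" where
  "critical_cells K M k = {e \<in> cx_cells K k. \<forall>p\<in>M. e \<noteq> fst p \<and> e \<noteq> snd p}"


section \<open>Words read along attaching maps\<close>

text \<open>
  An orientation chooses which of the two end points of a 1-cell is its source and which its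
  target.
\<close>

definition is_orientation ::
    "'a complex_of_cells \<Rightarrow> ('a set \<Rightarrow> 'a set) \<Rightarrow> ('a set \<Rightarrow> 'a set) \<Rightarrow> bool" where
  "is_orientation K src tgt \<longleftrightarrow>
     (\<forall>x\<in>cx_cells K 1. {v \<in> cx_cells K 0. face_le K v x} = {src x, tgt x})"

definition letter_start :: "('c \<Rightarrow> 'c) \<Rightarrow> ('c \<Rightarrow> 'c) \<Rightarrow> 'c \<times> bool \<Rightarrow> 'c" where
  "letter_start src tgt l = (if snd l then src (fst l) else tgt (fst l))"

definition letter_end :: "('c \<Rightarrow> 'c) \<Rightarrow> ('c \<Rightarrow> 'c) \<Rightarrow> 'c \<times> bool \<Rightarrow> 'c" where
  "letter_end src tgt l = (if snd l then tgt (fst l) else src (fst l))"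

text \<open>
  As the complex is regular, the characteristic map \<open>\<Phi>\<close> of a 2-cell e is a homeomorphism from the
  closed disc onto the closure of e.  Its attaching map is the restriction of \<open>\<Phi>\<close> to the unit
  circle; going once around the circle from the angle \<open>\<theta> 0\<close>, the image runs through the 1-cells
  recorded by w.  The map \<open>\<Phi>\<close> and the starting point are not prescribed, so w is determined up to
  cyclic permutation and inversion.
\<close>

definition attaching_word ::
    "'a complex_of_cells \<Rightarrow> ('a set \<Rightarrow> 'a set) \<Rightarrow> ('a set \<Rightarrow> 'a set) \<Rightarrow> 'a set \<Rightarrow> 'a set word \<Rightarrow> bool"
  where
  "attaching_word K src tgt e w \<longleftrightarrow>
     (\<exists>(\<Phi> :: complex \<Rightarrow> 'a) (\<theta> :: nat \<Rightarrow> real).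
        homeomorphic_map (top_of_set (cball 0 1))
          (subtopology (cx_space K) (cx_space K closure_of e)) \<Phi> \<and>
        \<Phi> ` ball 0 1 = e \<and>
        \<theta> (length w) = \<theta> 0 + 2 * pi \<and>
        (\<forall>j<length w. \<theta> j < \<theta> (Suc j) \<and>
           fst (w ! j) \<in> cx_cells K 1 \<and>
           \<Phi> ` cis ` {\<theta> j<..<\<theta> (Suc j)} = fst (w ! j) \<and>
           {\<Phi> (cis (\<theta> j))} = letter_start src tgt (w ! j) \<and>
           {\<Phi> (cis (\<theta> (Suc j)))} = letter_end src tgt (w ! j)))"


section \<open>The Morse presentation\<close>

definition induced_expression :: "'c \<Rightarrow> 'c word \<Rightarrow> 'c word" where
  "induced_expression x r =
     (THE u. \<exists>w1 b w2. r = w1 @ [(x, b)] @ w2 \<and> x \<notin> fst ` set w1 \<and> x \<notin> fst ` set w2 \<and>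
        u = (if b then word_inv w1 @ word_inv w2 else word_inv (word_inv w1 @ word_inv w2)))"

definition rewrite_word :: "'c \<Rightarrow> 'c word \<Rightarrow> 'c word \<Rightarrow> 'c word" where
  "rewrite_word x u w =
     concat (map (\<lambda>(y, b). if y = x then (if b then u else word_inv u) else [(y, b)]) w)"

text \<open>
  During the construction generators are labelled by 1-cells and relators by 2-cells: the pair
  \<open>(X, R)\<close> has the set X of generators and the relator r with label e whenever \<open>R e = Some r\<close>.
\<close>

type_synonym 'c labelled_presentation = "'c set \<times> ('c \<rightharpoonup> 'c word)"

fun eliminate :: "'c \<times> 'c \<Rightarrow> 'c labelled_presentation \<Rightarrow> 'c labelled_presentation" where
  "eliminate (x, e) (X, R) =
     (X - {x},
      \<lambda>f. if f = e then None
          else map_option (rewrite_word x (induced_expression x (the (R e)))) (R f))"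

definition matched_01 :: "'a complex_of_cells \<Rightarrow> ('a set \<times> 'a set) set \<Rightarrow> ('a set \<times> 'a set) set" where
  "matched_01 K M = {(v, x) \<in> M. v \<in> cx_cells K 0 \<and> x \<in> cx_cells K 1}"

definition matched_12 :: "'a complex_of_cells \<Rightarrow> ('a set \<times> 'a set) set \<Rightarrow> ('a set \<times> 'a set) set" where
  "matched_12 K M = {(x, e) \<in> M. x \<in> cx_cells K 1 \<and> e \<in> cx_cells K 2}"

definition initial_presentation ::
    "'a complex_of_cells \<Rightarrow> ('a set \<times> 'a set) set \<Rightarrow> ('a set \<Rightarrow> 'a set word) \<Rightarrow>
     'a set labelled_presentation" where
  "initial_presentation K M \<omega> =
     (let T = snd ` matched_01 K M in
      (cx_cells K 1 - T,
       \<lambda>e. if e \<in> cx_cells K 2 then Some (filter (\<lambda>l. fst l \<notin> T) (\<omega> e)) else None))"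

text \<open>
  Replace the labels by numbers: \<open>\<nu>\<close> numbers the generators and the list es the relators.
\<close>

definition is_numbering :: "'c labelled_presentation \<Rightarrow> presentation \<Rightarrow> bool" where
  "is_numbering L Q \<longleftrightarrow>
     (\<exists>\<nu> es. bij_betw \<nu> (fst L) {..<fst Q} \<and> distinct es \<and> set es = dom (snd L) \<and>
        snd Q = map (\<lambda>e. map (apfst \<nu>) (the (snd L e))) es)"

text \<open>
  Q is a Morse presentation of K and M for some choice of the data that the construction leaves
  open: the orientations of the 1-cells, the words read along the attaching maps, the order in
  which the matched pairs of dimensions 1 and 2 are eliminated, and the final numbering.
\<close>

definition is_Morse_presentation ::
    "'a complex_of_cells \<Rightarrow> ('a set \<times> 'a set) set \<Rightarrow> presentation \<Rightarrow> bool" where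
  "is_Morse_presentation K M Q \<longleftrightarrow>
     (\<exists>src tgt \<omega> ps.
        is_orientation K src tgt \<and>
        (\<forall>e\<in>cx_cells K 2. attaching_word K src tgt e (\<omega> e)) \<and>
        distinct ps \<and> set ps = matched_12 K M \<and>
        is_numbering (fold eliminate ps (initial_presentation K M \<omega>)) Q)"


section \<open>The standard complex and its barycentric subdivision\<close>

text \<open>
  The points of the standard complex: the vertex o, the points at time t, \<open>0 < t < 1\<close>, of the open
  1-cell of the generator g, and the points of the open 2-cell of the i-th relator, which is
  modelled on the open unit disc.
\<close>

datatype kpoint = Vertex | Edge_Point nat real | Face_Point nat complex

definition edge_map :: "nat \<Rightarrow> real \<Rightarrow> kpoint" where
  "edge_map g t = (if 0 < t \<and> t < 1 then Edge_Point g t else Vertex)"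

text \<open>
  The closed edge path spelled by w, for \<open>0 \<le> s < 1\<close>: the letter number j is traversed at constant
  speed while \<open>j \<le> length w * s \<le> j + 1\<close>.
\<close>

definition word_loop :: "nat word \<Rightarrow> real \<Rightarrow> kpoint" where
  "word_loop w s =
     (if w = [] then Vertex
      else let p = real (length w) * s; (g, b) = w ! nat \<lfloor>p\<rfloor>
           in edge_map g (if b then frac p else 1 - frac p))"

definition face_map :: "nat word list \<Rightarrow> nat \<Rightarrow> complex \<Rightarrow> kpoint" where
  "face_map rs i z =
     (if cmod z < 1 then Face_Point i z else word_loop (rs ! i) (Arg2pi z / (2 * pi)))"

definition standard_points :: "presentation \<Rightarrow> kpoint set" where
  "standard_points P =
     {Vertex} \<union> {Edge_Point g t |g t. g < fst P \<and> 0 < t \<and> t < 1} \<union>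
     {Face_Point i z |i z. i < length (snd P) \<and> cmod z < 1}"

text \<open>The topology is the final one for the characteristic maps.\<close>

definition standard_topology :: "presentation \<Rightarrow> kpoint topology" where
  "standard_topology P = topology (\<lambda>U. U \<subseteq> standard_points P \<and>
     (\<forall>g<fst P. openin (top_of_set {0..1}) {t \<in> {0..1}. edge_map g t \<in> U}) \<and>
     (\<forall>i<length (snd P).
        openin (top_of_set (cball 0 1)) {z \<in> cball 0 1. face_map (snd P) i z \<in> U}))"

definition standard_complex :: "presentation \<Rightarrow> kpoint complex_of_cells" where
  "standard_complex P =
     \<lparr>cx_space = standard_topology P,
      cx_cells = (\<lambda>k.
        if k = 0 then {{Vertex}}
        else if k = 1 then {Edge_Point g ` {0<..<1} |g. g < fst P}
        else if k = 2 then {Face_Point i ` ball 0 1 |i. i < length (snd P)}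
        else {})\<rparr>"

definition spoke :: "nat \<Rightarrow> real \<Rightarrow> kpoint set" where
  "spoke i \<alpha> = {Face_Point i (of_real t * cis \<alpha>) |t. 0 < t \<and> t < 1}"

definition sector :: "nat \<Rightarrow> real \<Rightarrow> real \<Rightarrow> kpoint set" where
  "sector i \<alpha> \<beta> = {Face_Point i (of_real t * cis \<gamma>) |t \<gamma>. 0 < t \<and> t < 1 \<and> \<alpha> < \<gamma> \<and> \<gamma> < \<beta>}"

text \<open>
  A relator of length l spreads each of its letters over an arc of angle \<open>2 * pi / l\<close>, hence each
  half of a letter over an arc of angle \<open>pi / l\<close>.  An empty relator yields only its apex, as an
  isolated cell; no acyclic matching then has exactly one critical 0-cell.
\<close>

definition barycentric_subdivision :: "presentation \<Rightarrow> kpoint complex_of_cells" where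
  "barycentric_subdivision P =
     \<lparr>cx_space = cx_space (standard_complex P),
      cx_cells = (\<lambda>k.
        if k = 0 then
          {{Vertex}} \<union> {{Edge_Point g (1/2)} |g. g < fst P} \<union>
          {{Face_Point i 0} |i. i < length (snd P)}
        else if k = 1 then
          {Edge_Point g ` {0<..<1/2} |g. g < fst P} \<union>
          {Edge_Point g ` {1/2<..<1} |g. g < fst P} \<union>
          {spoke i (pi * real j / real (length (snd P ! i))) |i j.
             i < length (snd P) \<and> j < 2 * length (snd P ! i)}
        else if k = 2 then
          {sector i (pi * real j / real (length (snd P ! i)))
                    (pi * real (Suc j) / real (length (snd P ! i))) |i j.
             i < length (snd P) \<and> j < 2 * length (snd P ! i)}
        else {})\<rparr>"

end

theory Submission
  imports Defs "HOL-Library.Multiset"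
begin

text \<open>
  Let E be the set of the 1-cells of the subdivision, V the set of its vertices, and W the family of
  the words read along the attaching maps of its 2-cells.  For a spanning tree T of the 1-skeleton
  consider the presentation \<open>(E, W + T)\<close> with all 1-cells as generators, in which every edge of T is
  a relator of length one.  The theorem follows from three equivalences.

  \<^item> \<open>(E, W + T)\<close> is equivalent to the Morse presentation of a matching with tree T.  Both the letters
    of T and the matched 1-cells disappear by the same elementary step: a generator that occurs
    exactly once in a relator can be eliminated together with it (\<open>eliminate_generator\<close>).
    Acyclicity of the matching says that the matched 2-cells are partially ordered by "the partner of
    one is a side of the other"; therefore a matched 1-cell keeps occurring exactly once in its own
    relator, in whatever order the pairs are eliminated (\<open>fold_eliminate_equiv\<close>).

  \<^item> \<open>(E, W + T)\<close> does not depend on T (\<open>change_of_tree\<close>).  The edges of T can be replaced by the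
    tree paths to the other vertices from the root, which is the critical vertex of the matching.
    Two families of paths with the same end points are interchanged by means of auxiliary generators
    \<open>q v\<close> and of the automorphism
    \<open>e \<mapsto> q (src e) e (q (tgt e))\<inverse>\<close>, which multiplies a path by the auxiliary letters of its end
    points and so merely conjugates the closed words in W.

  \<^item> For one particular tree, \<open>(E, W + T)\<close> is equivalent to the given presentation
    (\<open>triangulation_equiv\<close>).  The tree is the star at the vertex o made of the first halves of all
    loops and of one spoke in every 2-cell.  The product of the triangles of a subdivided 2-cell is the
    word of its rim, and the spokes are then peeled off one after the other.

  The second step needs all words in W to be closed edge paths, and the third one needs them to be the
  boundaries of triangles.  This is where the topology enters: the closures of all cells are computed
  in the final topology of the standard complex (\<open>closure_half\<close>, \<open>closure_ray\<close>, \<open>closure_sec\<close>), and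
  a word read along the attaching map of a cell is a closed path that runs exactly once through each
  1-cell in its boundary (\<open>attaching_word_boundary\<close>).

  Presentations are handled with generators of any type and with multisets of unreduced words as
  relators; the passage to numbered generators and reduced words is made once, in
  \<open>pres_equiv_linked\<close>, which shows that this notion of equivalence implies the one of the theorem.
\<close>


section \<open>Words up to free reduction\<close>

definition letters :: "'a word \<Rightarrow> 'a set" where
  "letters w = fst ` set w"

lemma letters_Nil [simp]: "letters [] = {}"
  and letters_Cons [simp]: "letters (l # w) = insert (fst l) (letters w)"
  and letters_append [simp]: "letters (u @ v) = letters u \<union> letters v"
  by (auto simp: letters_def)

definition free_eq :: "'a word \<Rightarrow> 'a word \<Rightarrow> bool"  (infix "\<simeq>" 50) where
  "u \<simeq> v \<longleftrightarrow> free_reduce u = free_reduce v"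

fun reduced :: "'a word \<Rightarrow> bool" where
  "reduced (l # l' # w) \<longleftrightarrow> l' \<noteq> apsnd Not l \<and> reduced (l' # w)"
| "reduced _ \<longleftrightarrow> True"

lemma flip_flip [simp]: "apsnd Not (apsnd Not l) = l"
  by (cases l) simp

lemma reduced_ConsD: "reduced (l # w) \<Longrightarrow> reduced w"
  by (cases w) auto

lemma reduced_cancel_Cons: "reduced w \<Longrightarrow> reduced (cancel_Cons l w)"
  by (cases w) (auto dest: reduced_ConsD)

lemma reduced_foldr: "reduced w \<Longrightarrow> reduced (foldr cancel_Cons u w)"
  by (induction u) (auto intro: reduced_cancel_Cons)

lemma reduced_free_reduce: "reduced (free_reduce w)"
  by (simp add: free_reduce_def reduced_foldr)

lemma cancel_Cons_flip: "reduced w \<Longrightarrow> cancel_Cons l (cancel_Cons (apsnd Not l) w) = w"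
proof (cases w)
  case (Cons l' w')
  assume "reduced w"
  then show ?thesis
    using Cons by (cases w') auto
qed auto

lemma free_reduce_reduced: "reduced w \<Longrightarrow> free_reduce w = w"
proof (induction w)
  case (Cons l w)
  then have "free_reduce w = w" by (blast dest: reduced_ConsD)
  with Cons.prems show ?case
    by (cases w) (auto simp: free_reduce_def)
qed (simp add: free_reduce_def)

lemma free_reduce_idem [simp]: "free_reduce (free_reduce w) = free_reduce w"
  by (simp add: free_reduce_reduced reduced_free_reduce)

text \<open>
  Prepending letters with cancellation is an action on reduced words, in which a letter and its inverse
  act by inverse bijections; so a word and its reduction act in the same way.
\<close>

lemma foldr_free_reduce: "reduced r \<Longrightarrow> foldr cancel_Cons (free_reduce u) r = foldr cancel_Cons u r"
proof (induction u)
  case (Cons l u)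
  have *: "foldr cancel_Cons (cancel_Cons l w) r = cancel_Cons l (foldr cancel_Cons w r)" for w
  proof (cases w)
    case (Cons l' w')
    then show ?thesis
      using \<open>reduced r\<close> by (auto simp: cancel_Cons_flip reduced_foldr)
  qed auto
  show ?case
    using Cons * by (simp add: free_reduce_def)
qed (simp add: free_reduce_def)

lemma free_reduce_append: "free_reduce (u @ v) = foldr cancel_Cons u (free_reduce v)"
  by (simp add: free_reduce_def)

lemma free_reduce_left [simp]: "free_reduce (free_reduce u @ v) = free_reduce (u @ v)"
  by (simp add: free_reduce_append foldr_free_reduce reduced_free_reduce)

lemma free_reduce_right [simp]: "free_reduce (u @ free_reduce v) = free_reduce (u @ v)"
  by (simp add: free_reduce_append)

lemma free_reduce_mid [simp]: "free_reduce (u @ free_reduce v @ w) = free_reduce (u @ v @ w)"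
  by (metis free_reduce_left free_reduce_right)

lemma free_eq_refl [simp, intro]: "u \<simeq> u"
  and free_eq_sym: "u \<simeq> v \<Longrightarrow> v \<simeq> u"
  and free_eq_trans [trans]: "u \<simeq> v \<Longrightarrow> v \<simeq> w \<Longrightarrow> u \<simeq> w"
  and free_eq_reduce: "free_reduce u \<simeq> u"
  by (auto simp: free_eq_def)

lemma free_eq_append: "u \<simeq> u' \<Longrightarrow> v \<simeq> v' \<Longrightarrow> u @ v \<simeq> u' @ v'"
  unfolding free_eq_def by (metis free_reduce_left free_reduce_right)

lemma free_eq_context: "v \<simeq> v' \<Longrightarrow> a @ v @ b \<simeq> a @ v' @ b"
  by (intro free_eq_append) auto

lemma letters_cancel_Cons: "letters (cancel_Cons l w) \<subseteq> insert (fst l) (letters w)"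
  by (cases w) auto

lemma letters_free_reduce: "letters (free_reduce w) \<subseteq> letters w"
proof (induction w)
  case (Cons l w)
  then show ?case
    using letters_cancel_Cons[of l "free_reduce w"] by (auto simp: free_reduce_def)
qed (simp add: free_reduce_def)

lemma word_inv_Nil [simp]: "word_inv [] = []"
  and word_inv_append [simp]: "word_inv (u @ v) = word_inv v @ word_inv u"
  and word_inv_Cons: "word_inv (l # w) = word_inv w @ [apsnd Not l]"
  and word_inv_inv [simp]: "word_inv (word_inv w) = w"
  and letters_word_inv [simp]: "letters (word_inv w) = letters w"
  by (auto simp: word_inv_def rev_map o_def image_image letters_def)

lemma word_inv_letter: "word_inv [(x, b)] = [(x, \<not> b)]"
  by (simp add: word_inv_Cons)

lemma cancel_letter: "l # apsnd Not l # w \<simeq> w"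
  using cancel_Cons_flip[of "free_reduce w" l]
  by (simp add: free_eq_def free_reduce_def[of "_ # _"] reduced_free_reduce flip: free_reduce_def)

lemma cancel_word_inv: "u @ word_inv u \<simeq> []"
proof (induction u)
  case (Cons l u)
  have "(l # u) @ word_inv (l # u) = [l] @ (u @ word_inv u) @ [apsnd Not l]"
    by (simp add: word_inv_Cons)
  also have "\<dots> \<simeq> [l] @ [] @ [apsnd Not l]"
    by (intro free_eq_context Cons)
  also have "\<dots> \<simeq> []"
    using cancel_letter[of l "[]"] by simp
  finally show ?case .
qed auto

lemma cancel_word_inv': "word_inv u @ u \<simeq> []"
  using cancel_word_inv[of "word_inv u"] by simp

lemma cancel_context: "a @ u @ word_inv u @ b \<simeq> a @ b"
  using free_eq_context[OF cancel_word_inv, of a u b] by simp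

lemma cancel_context': "a @ word_inv u @ u @ b \<simeq> a @ b"
  using free_eq_context[OF cancel_word_inv', of a u b] by simp

lemma free_eq_word_inv: assumes "u \<simeq> v" shows "word_inv u \<simeq> word_inv v"
proof -
  have "word_inv u \<simeq> word_inv u @ v @ word_inv v"
    using cancel_context[of "word_inv u" v "[]"] by (simp add: free_eq_sym)
  also have "\<dots> \<simeq> word_inv u @ u @ word_inv v"
    by (intro free_eq_context free_eq_sym[OF assms])
  also have "\<dots> \<simeq> word_inv v"
    using cancel_context'[of "[]" u "word_inv v"] by simp
  finally show ?thesis .
qed


subsection \<open>Substitution\<close>

definition subst :: "('a \<Rightarrow> 'b word) \<Rightarrow> 'a word \<Rightarrow> 'b word" where
  "subst \<sigma> w = concat (map (\<lambda>(y, b). if b then \<sigma> y else word_inv (\<sigma> y)) w)"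

lemma subst_Nil [simp]: "subst \<sigma> [] = []"
  and subst_append [simp]: "subst \<sigma> (u @ v) = subst \<sigma> u @ subst \<sigma> v"
  and subst_letter: "subst \<sigma> [(x, b)] = (if b then \<sigma> x else word_inv (\<sigma> x))"
  and subst_Cons: "subst \<sigma> ((x, b) # w) = (if b then \<sigma> x else word_inv (\<sigma> x)) @ subst \<sigma> w"
  by (auto simp: subst_def)

lemma subst_word_inv [simp]: "subst \<sigma> (word_inv w) = word_inv (subst \<sigma> w)"
  by (induction w) (auto simp: subst_Cons word_inv_Cons)

lemma subst_cancel_Cons: "subst \<sigma> (cancel_Cons l w) \<simeq> subst \<sigma> (l # w)"
proof (cases w)
  case (Cons l' w')
  obtain x b where l: "l = (x, b)" by fastforce
  show ?thesis
    using cancel_context[of "[]" "\<sigma> x" "subst \<sigma> w'"] cancel_context'[of "[]" "\<sigma> x" "subst \<sigma> w'"]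
    by (auto simp: Cons l subst_Cons free_eq_sym)
qed auto

lemma subst_free_reduce: "subst \<sigma> (free_reduce w) \<simeq> subst \<sigma> w"
proof (induction w)
  case (Cons l w)
  have "subst \<sigma> (free_reduce (l # w)) \<simeq> subst \<sigma> [l] @ subst \<sigma> (free_reduce w)"
    using subst_cancel_Cons[of \<sigma> l "free_reduce w"]
    by (metis append_Cons append_Nil foldr_Cons comp_apply free_reduce_def subst_append)
  also have "\<dots> \<simeq> subst \<sigma> [l] @ subst \<sigma> w"
    by (intro free_eq_append Cons free_eq_refl)
  finally show ?case by (metis append_Cons append_Nil subst_append)
qed (auto simp: free_reduce_def)

lemma free_eq_subst: "u \<simeq> v \<Longrightarrow> subst \<sigma> u \<simeq> subst \<sigma> v"
  by (metis free_eq_def subst_free_reduce)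

lemma free_eq_subst_cong:
  "(\<And>x. x \<in> letters w \<Longrightarrow> \<sigma> x \<simeq> \<tau> x) \<Longrightarrow> subst \<sigma> w \<simeq> subst \<tau> w"
  by (induction w) (auto simp: subst_Cons intro!: free_eq_append free_eq_word_inv)

lemma subst_cong: "(\<And>x. x \<in> letters w \<Longrightarrow> \<sigma> x = \<tau> x) \<Longrightarrow> subst \<sigma> w = subst \<tau> w"
  by (induction w) (auto simp: subst_Cons)

lemma subst_subst: "subst \<tau> (subst \<sigma> w) = subst (\<lambda>x. subst \<tau> (\<sigma> x)) w"
  by (induction w) (auto simp: subst_Cons)

lemma subst_id: "(\<And>x. x \<in> letters w \<Longrightarrow> \<sigma> x = [(x, True)]) \<Longrightarrow> subst \<sigma> w = w"
  by (induction w) (auto simp: subst_Cons word_inv_letter)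

lemma letters_subst: "letters (subst \<sigma> w) = (\<Union>x\<in>letters w. letters (\<sigma> x))"
  by (induction w) (auto simp: subst_Cons split: if_splits)

lemma rename_eq_subst: "map (apfst \<nu>) w = subst (\<lambda>x. [(\<nu> x, True)]) w"
  by (induction w) (auto simp: subst_Cons word_inv_letter)

lemma rewrite_word_eq_subst: "rewrite_word x u = subst ((\<lambda>y. [(y, True)])(x := u))"
  by (rule ext) (auto simp: rewrite_word_def subst_def word_inv_letter intro!: arg_cong[of _ _ concat])


section \<open>The moves on numbered presentations\<close>

lemma carrier_F: "w \<in> carrier (F n) \<longleftrightarrow> letters w \<subseteq> {..<n} \<and> free_reduce w = w"
  and mult_F: "u \<otimes>\<^bsub>F n\<^esub> v = free_reduce (u @ v)"
  and one_F: "\<one>\<^bsub>F n\<^esub> = []"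
  by (auto simp: free_group_def letters_def)

lemma free_reduce_in_F: "letters w \<subseteq> {..<n} \<Longrightarrow> free_reduce w \<in> carrier (F n)"
  using letters_free_reduce[of w] by (auto simp: carrier_F)

lemma group_F: "group (F n)"
proof (rule groupI)
  fix u v w assume "u \<in> carrier (F n)" "v \<in> carrier (F n)" "w \<in> carrier (F n)"
  show "u \<otimes>\<^bsub>F n\<^esub> v \<otimes>\<^bsub>F n\<^esub> w = u \<otimes>\<^bsub>F n\<^esub> (v \<otimes>\<^bsub>F n\<^esub> w)"
    by (simp add: mult_F)
next
  fix u assume u: "u \<in> carrier (F n)"
  then show "\<exists>v\<in>carrier (F n). v \<otimes>\<^bsub>F n\<^esub> u = \<one>\<^bsub>F n\<^esub>"
    using cancel_word_inv'[of u]
    by (intro bexI[of _ "free_reduce (word_inv u)"])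
       (auto simp: mult_F one_F free_eq_def carrier_F free_reduce_def[of "[]"]
             dest!: subsetD[OF letters_free_reduce])
qed (auto simp: mult_F one_F carrier_F free_reduce_def[of "[]"]
          dest!: subsetD[OF letters_free_reduce])

lemma inv_F: assumes "letters w \<subseteq> {..<n}"
  shows "inv\<^bsub>F n\<^esub> (free_reduce w) = free_reduce (word_inv w)"
proof (rule group.inv_equality[OF group_F])
  show "free_reduce (word_inv w) \<otimes>\<^bsub>F n\<^esub> free_reduce w = \<one>\<^bsub>F n\<^esub>"
    using cancel_word_inv'[of w] by (simp add: mult_F one_F free_eq_def free_reduce_def[of "[]"])
qed (use assms in \<open>auto intro!: free_reduce_in_F\<close>)


lemma inv_F': "r \<in> carrier (F n) \<Longrightarrow> inv\<^bsub>F n\<^esub> r = free_reduce (word_inv r)"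
  using inv_F[of r n] by (simp add: carrier_F)

definition valid :: "presentation \<Rightarrow> bool" where
  "valid P \<longleftrightarrow> set (snd P) \<subseteq> carrier (F (fst P))"

abbreviation reach :: "presentation \<Rightarrow> presentation \<Rightarrow> bool" where
  "reach \<equiv> Qss_move\<^sup>*\<^sup>*"

text \<open>
  Every move can be undone if all relators are reduced words in the generators; for the addition of a
  generator this is the side condition of the inverse move.
\<close>

lemma Qss_move_reversible: assumes "Qss_move P Q" "valid P" shows "valid Q \<and> reach Q P"
  using assms
proof cases
  case (invert i rs n)
  interpret group "F n" by (rule group_F)
  have i: "rs ! i \<in> carrier (F n)" using assms(2) invert by (auto simp: valid_def)
  with invert assms(2) have "valid Q"
    by (auto simp: valid_def dest!: subsetD[OF set_update_subset_insert])
  moreover have "Qss_move Q P"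
    using Qss_move.invert[of i "rs[i := inv\<^bsub>F n\<^esub> rs ! i]" n] invert i by simp
  ultimately show ?thesis by auto
next
  case (multiply i rs j n)
  interpret group "F n" by (rule group_F)
  have i: "rs ! i \<in> carrier (F n)" and j: "rs ! j \<in> carrier (F n)"
    using assms(2) multiply by (auto simp: valid_def)
  with multiply assms(2) have "valid Q"
    by (auto simp: valid_def dest!: subsetD[OF set_update_subset_insert])
  define rs1 where "rs1 = rs[i := rs ! i \<otimes>\<^bsub>F n\<^esub> rs ! j]"
  define rs2 where "rs2 = rs1[j := inv\<^bsub>F n\<^esub> rs ! j]"
  have "Qss_move (n, rs1) (n, rs2)"
    using Qss_move.invert[of j rs1 n] multiply by (simp add: rs1_def rs2_def)
  moreover have "Qss_move (n, rs2) (n, rs2[i := rs ! i])"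
    using Qss_move.multiply[of i rs2 j n] multiply i j by (simp add: rs1_def rs2_def m_assoc)
  moreover have "Qss_move (n, rs2[i := rs ! i]) (n, rs2[i := rs ! i, j := rs ! j])"
    using Qss_move.invert[of j "rs2[i := rs ! i]" n] multiply i j by (simp add: rs1_def rs2_def)
  moreover have "rs2[i := rs ! i, j := rs ! j] = rs"
    using multiply by (auto simp: rs1_def rs2_def list_eq_iff_nth_eq nth_list_update)
  ultimately have "reach (n, rs1) (n, rs)"
    by (metis converse_rtranclp_into_rtranclp rtranclp.rtrancl_refl)
  with \<open>valid Q\<close> multiply show ?thesis by (simp add: rs1_def)
next
  case (conjugate i rs w n)
  interpret group "F n" by (rule group_F)
  have i: "rs ! i \<in> carrier (F n)" using assms(2) conjugate by (auto simp: valid_def)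
  with conjugate assms(2) have "valid Q"
    by (auto simp: valid_def dest!: subsetD[OF set_update_subset_insert])
  moreover have "inv\<^bsub>F n\<^esub> w \<otimes>\<^bsub>F n\<^esub> (w \<otimes>\<^bsub>F n\<^esub> rs ! i \<otimes>\<^bsub>F n\<^esub> inv\<^bsub>F n\<^esub> w) \<otimes>\<^bsub>F n\<^esub> w = rs ! i"
    using i conjugate by (simp add: m_assoc inv_solve_left')
  then have "Qss_move Q P"
    using Qss_move.conjugate[of i "rs[i := w \<otimes>\<^bsub>F n\<^esub> rs ! i \<otimes>\<^bsub>F n\<^esub> inv\<^bsub>F n\<^esub> w]" "inv\<^bsub>F n\<^esub> w" n]
      conjugate i by simp
  ultimately show ?thesis by auto
next
  case (add_generator n rs)
  then have "valid Q"
    using assms(2) by (fastforce simp: valid_def carrier_F free_reduce_def[of "[_]"] less_Suc_eq)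
  with add_generator assms(2) Qss_move.remove_generator[of rs n] show ?thesis
    by (auto simp: valid_def)
next
  case (remove_generator rs n)
  then show ?thesis
    using Qss_move.add_generator[of n rs] by (auto simp: valid_def)
next
  case (automorphism \<phi> n rs)
  interpret group "F n" by (rule group_F)
  have bij: "bij_betw \<phi> (carrier (F n)) (carrier (F n))"
    using automorphism by (simp add: iso_def)
  define \<psi> where "\<psi> = inv_into (carrier (F n)) \<phi>"
  have "\<psi> \<in> iso (F n) (F n)"
    using iso_set_sym automorphism by (simp add: \<psi>_def)
  moreover have "map \<psi> (map \<phi> rs) = rs"
    using automorphism assms(2) bij
    by (auto simp: valid_def \<psi>_def bij_betw_def intro!: map_idI)
  ultimately have "Qss_move Q P"
    using Qss_move.automorphism[of \<psi> n "map \<phi> rs"] automorphism by simp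
  moreover have "valid Q"
    using automorphism assms(2) bij by (auto simp: valid_def bij_betw_def)
  ultimately show ?thesis by auto
qed

lemma reach_sym: assumes "reach P Q" "valid P" shows "valid Q \<and> reach Q P"
  using assms
proof (induction rule: rtranclp_induct)
  case (step Q R)
  then show ?case using Qss_move_reversible[of Q R] by (auto intro: rtranclp_trans)
qed auto

lemma reach_invert:
  "r \<in> carrier (F n) \<Longrightarrow> reach (n, xs @ r # ys) (n, xs @ free_reduce (word_inv r) # ys)"
  using Qss_move.invert[of "length xs" "xs @ r # ys" n] by (simp add: inv_F' r_into_rtranclp)

lemma reach_conjugate:
  "letters w \<subseteq> {..<n} \<Longrightarrow> r \<in> carrier (F n) \<Longrightarrow>
    reach (n, xs @ r # ys) (n, xs @ free_reduce (w @ r @ word_inv w) # ys)"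
  using Qss_move.conjugate[of "length xs" "xs @ r # ys" "free_reduce w" n]
  by (simp add: inv_F mult_F free_reduce_in_F r_into_rtranclp)

lemma reach_multiply_later:
  "reach (n, xs @ r # ys @ s # zs) (n, xs @ free_reduce (r @ s) # ys @ s # zs)"
  using Qss_move.multiply[of "length xs" "xs @ r # ys @ s # zs" "length xs + Suc (length ys)" n]
  by (simp add: mult_F nth_append r_into_rtranclp)

lemma reach_multiply_earlier:
  "reach (n, xs @ s # ys @ r # zs) (n, xs @ s # ys @ free_reduce (r @ s) # zs)"
  using Qss_move.multiply[of "length xs + Suc (length ys)" "xs @ s # ys @ r # zs" "length xs" n]
  by (simp add: mult_F nth_append list_update_append r_into_rtranclp)

text \<open>
  Two relators are exchanged by the moves
  \<open>(a, b) \<rightarrow> (a b, b) \<rightarrow> (a b, b\<inverse>) \<rightarrow> (a b, b\<inverse> a b) \<rightarrow> (a b, a) \<rightarrow> (b\<inverse> a\<inverse>, a) \<rightarrow> (b\<inverse>, a) \<rightarrow> (b, a)\<close>.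
\<close>

lemma reach_swap:
  assumes a: "a \<in> carrier (F n)" and b: "b \<in> carrier (F n)"
  shows "reach (n, xs @ a # ys @ b # zs) (n, xs @ b # ys @ a # zs)"
proof -
  have ra: "free_reduce a = a" and rb: "free_reduce b = b"
    and la: "letters a \<subseteq> {..<n}" and lb: "letters b \<subseteq> {..<n}"
    using a b by (auto simp: carrier_F)
  let ?ab = "free_reduce (a @ b)" and ?b' = "free_reduce (word_inv b)"
  let ?r = "\<lambda>u v. (n, xs @ u # ys @ v # zs)"
  have ab: "?ab \<in> carrier (F n)" and b': "?b' \<in> carrier (F n)"
    by (use la lb in \<open>auto intro!: free_reduce_in_F\<close>)
  have "reach (?r a b) (?r ?ab b)" by (rule reach_multiply_later)
  also have "reach (?r ?ab b) (?r ?ab ?b')"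
    using reach_invert[OF b, of "xs @ ?ab # ys" zs] by simp
  also have "reach (?r ?ab ?b') (?r ?ab (free_reduce (?b' @ ?ab)))"
    by (rule reach_multiply_earlier)
  also have "reach (?r ?ab (free_reduce (?b' @ ?ab))) (?r ?ab a)"
  proof -
    have "b @ (word_inv b @ a @ b) @ word_inv b \<simeq> a"
      using cancel_context[of "[]" b "a @ b @ word_inv b"] cancel_context[of a b "[]"]
      by (auto intro: free_eq_trans)
    then have "free_reduce (b @ free_reduce (?b' @ ?ab) @ word_inv b) = a"
      by (simp add: free_eq_def ra flip: append_assoc) (simp add: ra)
    then show ?thesis
      using reach_conjugate[OF lb, of "free_reduce (?b' @ ?ab)" "xs @ ?ab # ys" zs] la lb
      by (simp add: free_reduce_in_F)
  qed
  also have "reach (?r ?ab a) (?r (free_reduce (word_inv ?ab)) a)"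
    using reach_invert[OF ab, of xs "ys @ a # zs"] by simp
  also have "reach (?r (free_reduce (word_inv ?ab)) a) (?r (free_reduce (free_reduce (word_inv ?ab) @ a)) a)"
    by (rule reach_multiply_later)
  also have "free_reduce (free_reduce (word_inv ?ab) @ a) = ?b'"
  proof -
    have "word_inv ?ab @ a \<simeq> word_inv (a @ b) @ a"
      by (intro free_eq_append free_eq_word_inv free_eq_reduce free_eq_refl)
    also have "\<dots> \<simeq> word_inv b"
      using cancel_context'[of "word_inv b" a "[]"] by simp
    finally show ?thesis by (simp add: free_eq_def)
  qed
  also have "reach (?r ?b' a) (?r (free_reduce (word_inv ?b')) a)"
    using reach_invert[OF b', of xs "ys @ a # zs"] by simp
  also have "free_reduce (word_inv ?b') = b"
    using free_eq_word_inv[OF free_eq_reduce[of "word_inv b"]] by (simp add: free_eq_def rb)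
  finally show ?thesis .
qed

text \<open>
  The equivalence of the theorem concerns lists of relators; by exchanging relators the order of the
  list becomes irrelevant.
\<close>

lemma reach_permute:
  "mset rs = mset rs' \<Longrightarrow> set rs \<subseteq> carrier (F n) \<Longrightarrow> reach (n, pre @ rs) (n, pre @ rs')"
proof (induction rs arbitrary: rs' pre)
  case (Cons a rs)
  then have "a \<in> set rs'" by (metis list.set_intros(1) mset_eq_setD)
  then obtain ys zs where rs': "rs' = ys @ a # zs" by (meson split_list)
  have sub: "set rs' \<subseteq> carrier (F n)" using Cons.prems by (metis mset_eq_setD)
  show ?case
  proof (cases ys)
    case Nil
    with Cons.prems rs' Cons.IH[of zs "pre @ [a]"] show ?thesis by simp
  next
    case (Cons c ys')
    have "reach (n, pre @ a # rs) (n, pre @ a # (ys' @ c # zs))"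
      using Cons.IH[of "ys' @ c # zs" "pre @ [a]"] Cons.prems rs' Cons by simp
    also have "reach \<dots> (n, pre @ c # ys' @ a # zs)"
      using sub rs' Cons by (intro reach_swap) auto
    finally show ?thesis by (simp add: rs' Cons)
  qed
qed auto

text \<open>
  A substitution with an inverse substitution is an automorphism of the free group.
\<close>

lemma Qss_move_substitution:
  assumes \<sigma>: "\<And>k. k < n \<Longrightarrow> letters (\<sigma> k) \<subseteq> {..<n} \<and> subst \<tau> (\<sigma> k) \<simeq> [(k, True)]"
    and \<tau>: "\<And>k. k < n \<Longrightarrow> letters (\<tau> k) \<subseteq> {..<n} \<and> subst \<sigma> (\<tau> k) \<simeq> [(k, True)]"
  shows "Qss_move (n, map free_reduce rs) (n, map (\<lambda>r. free_reduce (subst \<sigma> r)) rs)"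
proof -
  let ?\<phi> = "\<lambda>r. free_reduce (subst \<sigma> r)" and ?\<psi> = "\<lambda>r. free_reduce (subst \<tau> r)"
  have maps: "free_reduce (subst f r) \<in> carrier (F n)"
    if "\<And>k. k < n \<Longrightarrow> letters (f k) \<subseteq> {..<n}" "r \<in> carrier (F n)" for f r
    using that by (intro free_reduce_in_F) (fastforce simp: letters_subst carrier_F)
  have inverse: "free_reduce (subst g (free_reduce (subst f r))) = r"
    if "\<And>k. k < n \<Longrightarrow> subst g (f k) \<simeq> [(k, True)]" "r \<in> carrier (F n)"
    for f g :: "nat \<Rightarrow> nat word" and r
  proof -
    have "subst g (free_reduce (subst f r)) \<simeq> subst (\<lambda>x. subst g (f x)) r"
      using subst_free_reduce[of g "subst f r"] by (simp add: subst_subst)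
    also have "\<dots> \<simeq> subst (\<lambda>x. [(x, True)]) r"
      using that by (intro free_eq_subst_cong) (auto simp: carrier_F)
    also have "\<dots> = r" by (simp add: subst_id)
    finally show ?thesis using that by (simp add: free_eq_def carrier_F)
  qed
  have "bij_betw ?\<phi> (carrier (F n)) (carrier (F n))"
    by (rule bij_betw_byWitness[where f' = ?\<psi>]) (use assms in \<open>auto intro!: maps inverse\<close>)
  moreover have "?\<phi> \<in> hom (F n) (F n)"
    using \<sigma> subst_free_reduce[of \<sigma>] by (auto simp: hom_def mult_F free_eq_def intro!: maps)
  ultimately have "?\<phi> \<in> iso (F n) (F n)" by (simp add: iso_def)
  from Qss_move.automorphism[OF this, of "map free_reduce rs"] show ?thesis
    using subst_free_reduce[of \<sigma>] by (simp add: o_def free_eq_def)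
qed


section \<open>Presentations over arbitrary sets of generators\<close>

type_synonym 'a pres = "'a set \<times> 'a word multiset"

fun over :: "'a pres \<Rightarrow> bool" where
  "over (X, R) \<longleftrightarrow> finite X \<and> (\<forall>r\<in>#R. letters r \<subseteq> X)"

text \<open>
  The moves for a multiset of unreduced words over any finite set of generators.  Symmetry is a
  rule: the moves are reversible, and this saves the converse of each derived equivalence.
\<close>

inductive pres_equiv :: "'a pres \<Rightarrow> 'a pres \<Rightarrow> bool"  (infix "\<sim>\<^sub>Q" 50) where
  refl: "over P \<Longrightarrow> P \<sim>\<^sub>Q P"
| sym: "P \<sim>\<^sub>Q P' \<Longrightarrow> P' \<sim>\<^sub>Q P"
| trans: "P \<sim>\<^sub>Q P' \<Longrightarrow> P' \<sim>\<^sub>Q P'' \<Longrightarrow> P \<sim>\<^sub>Q P''"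
| reduce: "over (X, add_mset r R) \<Longrightarrow> letters r' \<subseteq> X \<Longrightarrow> r \<simeq> r' \<Longrightarrow>
    (X, add_mset r R) \<sim>\<^sub>Q (X, add_mset r' R)"
| invert: "over (X, add_mset r R) \<Longrightarrow> (X, add_mset r R) \<sim>\<^sub>Q (X, add_mset (word_inv r) R)"
| multiply: "over (X, add_mset r (add_mset s R)) \<Longrightarrow>
    (X, add_mset r (add_mset s R)) \<sim>\<^sub>Q (X, add_mset (r @ s) (add_mset s R))"
| conjugate: "over (X, add_mset r R) \<Longrightarrow> letters w \<subseteq> X \<Longrightarrow>
    (X, add_mset r R) \<sim>\<^sub>Q (X, add_mset (w @ r @ word_inv w) R)"
| add_generator: "over (X, R) \<Longrightarrow> x \<notin> X \<Longrightarrow> (X, R) \<sim>\<^sub>Q (insert x X, add_mset [(x, True)] R)"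
| substitute: "over (X, R) \<Longrightarrow>
    (\<And>x. x \<in> X \<Longrightarrow> letters (\<sigma> x) \<subseteq> X \<and> subst \<tau> (\<sigma> x) \<simeq> [(x, True)]) \<Longrightarrow>
    (\<And>x. x \<in> X \<Longrightarrow> letters (\<tau> x) \<subseteq> X \<and> subst \<sigma> (\<tau> x) \<simeq> [(x, True)]) \<Longrightarrow>
    (X, R) \<sim>\<^sub>Q (X, image_mset (subst \<sigma>) R)"

declare pres_equiv.trans [trans]

text \<open>
  The moves act on elements of the free group, that is, on freely reduced words.
\<close>

definition renumber :: "('a \<Rightarrow> nat) \<Rightarrow> 'a word \<Rightarrow> nat word" where
  "renumber \<nu> r = free_reduce (map (apfst \<nu>) r)"

definition realizes :: "'a pres \<Rightarrow> presentation \<Rightarrow> bool" where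
  "realizes P Q \<longleftrightarrow> (\<exists>\<nu> rs. bij_betw \<nu> (fst P) {..<fst Q} \<and> mset rs = snd P \<and>
     snd Q = map (renumber \<nu>) rs)"

lemma letters_rename: "letters (map (apfst \<nu>) r) = \<nu> ` letters r"
  by (induction r) auto

lemma renumber_in_F:
  "bij_betw \<nu> X {..<n} \<Longrightarrow> letters r \<subseteq> X \<Longrightarrow> renumber \<nu> r \<in> carrier (F n)"
  unfolding renumber_def
  by (rule free_reduce_in_F) (auto simp: letters_rename bij_betw_def)

lemma realizes_valid: "over P \<Longrightarrow> realizes P Q \<Longrightarrow> valid Q"
  by (cases P) (fastforce simp: realizes_def valid_def intro!: renumber_in_F)

text \<open>
  Two numberings differ by a permutation of the generators, which is an automorphism, and by a
  permutation of the relators.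
\<close>

lemma realizes_unique:
  assumes P: "over P" and Q: "realizes P Q" and Q': "realizes P Q'"
  shows "reach Q Q'"
proof -
  obtain X R where XR: "P = (X, R)" by fastforce
  obtain n n' where n: "fst Q = n" "fst Q' = n'" by blast
  obtain \<nu> rs where \<nu>: "bij_betw \<nu> X {..<n}" "mset rs = R" "snd Q = map (renumber \<nu>) rs"
    using Q by (auto simp: realizes_def XR n)
  obtain \<nu>' rs' where \<nu>': "bij_betw \<nu>' X {..<n'}" "mset rs' = R" "snd Q' = map (renumber \<nu>') rs'"
    using Q' by (auto simp: realizes_def XR n)
  have "n' = n"
    using bij_betw_same_card[OF \<nu>(1)] bij_betw_same_card[OF \<nu>'(1)] by simp
  have lets: "letters r \<subseteq> X" if "r \<in> set rs \<or> r \<in> set rs'" for r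
    using P XR \<nu>(2) \<nu>'(2) that by (metis over.simps set_mset_mset)
  define \<mu> \<mu>' where "\<mu> = \<nu>' \<circ> inv_into X \<nu>" and "\<mu>' = \<nu> \<circ> inv_into X \<nu>'"
  have inj: "inj_on \<nu> X" "inj_on \<nu>' X" using \<nu>(1) \<nu>'(1) by (auto simp: bij_betw_def)
  have \<mu>: "\<mu> k < n" "\<mu>' k < n" "\<mu>' (\<mu> k) = k" "\<mu> (\<mu>' k) = k" if "k < n" for k
  proof -
    have "k \<in> \<nu> ` X" "k \<in> \<nu>' ` X" using \<nu>(1) \<nu>'(1) that \<open>n' = n\<close> by (auto simp: bij_betw_def)
    then obtain x x' where x: "x \<in> X" "k = \<nu> x" and x': "x' \<in> X" "k = \<nu>' x'" by blast
    have *: "\<nu> y < n" "\<nu>' y < n" if "y \<in> X" for y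
      using \<nu>(1) \<nu>'(1) that \<open>n' = n\<close> by (auto simp: bij_betw_def)
    show "\<mu> k < n" unfolding x(2) using x(1) * inj by (simp add: \<mu>_def)
    show "\<mu>' k < n" unfolding x'(2) using x'(1) * inj by (simp add: \<mu>'_def)
    show "\<mu>' (\<mu> k) = k" using x inj by (simp add: \<mu>_def \<mu>'_def)
    show "\<mu> (\<mu>' k) = k" using x' inj by (simp add: \<mu>_def \<mu>'_def)
  qed
  have "Qss_move (n, map free_reduce (map (map (apfst \<nu>)) rs))
      (n, map (\<lambda>r. free_reduce (subst (\<lambda>k. [(\<mu> k, True)]) r)) (map (map (apfst \<nu>)) rs))"
    by (rule Qss_move_substitution[where \<tau> = "\<lambda>k. [(\<mu>' k, True)]"])
      (auto simp: \<mu> subst_letter)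
  also have "map free_reduce (map (map (apfst \<nu>)) rs) = snd Q"
    by (simp add: \<nu> renumber_def o_def)
  also have "map (\<lambda>r. free_reduce (subst (\<lambda>k. [(\<mu> k, True)]) r)) (map (map (apfst \<nu>)) rs)
      = map (renumber \<nu>') rs"
  proof -
    have "map (apfst \<mu> \<circ> apfst \<nu>) r = map (apfst \<nu>') r" if "r \<in> set rs" for r
      using lets[of r] that inj by (auto simp: \<mu>_def letters_def image_subset_iff)
    then have "free_reduce (map (apfst \<mu>) (map (apfst \<nu>) r)) = renumber \<nu>' r"
      if "r \<in> set rs" for r using that by (simp add: renumber_def del: map_eq_conv)
    then show ?thesis
      by (auto simp: list_eq_iff_nth_eq[of "map _ _"] simp flip: rename_eq_subst simp del: map_map)
  qed
  finally have "reach Q (n, map (renumber \<nu>') rs)"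
    using n by (metis prod.collapse r_into_rtranclp)
  also have "reach \<dots> Q'"
  proof -
    have "mset (map (renumber \<nu>') rs) = mset (map (renumber \<nu>') rs')"
      using \<nu> \<nu>' by simp
    moreover have "set (map (renumber \<nu>') rs) \<subseteq> carrier (F n)"
      using renumber_in_F[OF \<nu>'(1)] lets \<open>n' = n\<close> by auto
    ultimately show ?thesis
      using reach_permute[of _ _ n "[]"] \<nu>' n \<open>n' = n\<close> by (metis append_Nil prod.collapse)
  qed
  finally show ?thesis .
qed

definition linked :: "'a pres \<Rightarrow> 'a pres \<Rightarrow> bool" where
  "linked P P' \<longleftrightarrow> over P \<and> over P' \<and>
     (\<forall>Q Q'. realizes P Q \<longrightarrow> realizes P' Q' \<longrightarrow> reach Q Q')"

text \<open>
  By uniqueness up to the moves, one suitable pair of numberings is enough.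
\<close>

lemma linkedI:
  assumes "over P" "over P'" "realizes P Q" "realizes P' Q'" "reach Q Q'"
  shows "linked P P'"
  unfolding linked_def using assms by (blast intro: rtranclp_trans realizes_unique)

lemma realizes_exists: "over P \<Longrightarrow> \<exists>Q. realizes P Q"
proof (cases P)
  case (Pair X R)
  assume "over P"
  then obtain \<nu> where "bij_betw \<nu> X {..<card X}"
    using Pair ex_bij_betw_finite_nat[of X] by (auto simp: lessThan_atLeast0)
  moreover obtain rs where "mset rs = R" by (metis ex_mset)
  ultimately show ?thesis
    by (intro exI[of _ "(card X, map (renumber \<nu>) rs)"]) (auto simp: realizes_def Pair)
qed

text \<open>
  A move that affects only some relators can be carried out with these at the front of the list.
\<close>

lemma linked_local:
  assumes P: "over (X, mset as + R)" and P': "over (X, mset bs + R)"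
    and step: "\<And>n \<nu> rs. bij_betw \<nu> X {..<n} \<Longrightarrow>
      reach (n, map (renumber \<nu>) (as @ rs)) (n, map (renumber \<nu>) (bs @ rs))"
  shows "linked (X, mset as + R) (X, mset bs + R)"
proof -
  obtain \<nu> where \<nu>: "bij_betw \<nu> X {..<card X}"
    using P ex_bij_betw_finite_nat[of X] by (auto simp: lessThan_atLeast0)
  obtain rs where rs: "mset rs = R" by (metis ex_mset)
  have "realizes (X, mset cs + R) (card X, map (renumber \<nu>) (cs @ rs))" for cs
    unfolding realizes_def using \<nu> rs by (intro exI[of _ \<nu>] exI[of _ "cs @ rs"]) simp
  then show ?thesis using linkedI[OF P P'] step[OF \<nu>] by blast
qed

lemma renumber_cong: "r \<simeq> r' \<Longrightarrow> renumber \<nu> r = renumber \<nu> r'"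
  using free_eq_subst unfolding renumber_def rename_eq_subst by (auto simp: free_eq_def)

lemma rename_word_inv: "map (apfst \<nu>) (word_inv r) = word_inv (map (apfst \<nu>) r)"
  unfolding rename_eq_subst by simp

lemma renumber_word_inv: "renumber \<nu> (word_inv r) = free_reduce (word_inv (renumber \<nu> r))"
  unfolding renumber_def rename_word_inv
  using free_eq_word_inv[OF free_eq_reduce, of "map (apfst \<nu>) r"] by (simp add: free_eq_def)

lemma renumber_append: "renumber \<nu> (r @ s) = free_reduce (renumber \<nu> r @ renumber \<nu> s)"
  by (simp add: renumber_def)

lemma pres_equiv_linked: "P \<sim>\<^sub>Q P' \<Longrightarrow> linked P P'"
proof (induction rule: pres_equiv.induct)
  case (refl P)
  then show ?case by (auto simp: linked_def intro: realizes_unique)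
next
  case (sym P P')
  then show ?case unfolding linked_def using realizes_valid reach_sym by blast
next
  case (trans P P' P'')
  then have "over P'" by (simp add: linked_def)
  then obtain Q where "realizes P' Q" using realizes_exists by blast
  with trans show ?case unfolding linked_def by (meson rtranclp_trans)
next
  case (reduce X r R r')
  have "linked (X, mset [r] + R) (X, mset [r'] + R)"
    by (rule linked_local) (use reduce renumber_cong[OF reduce(3)] in auto)
  then show ?case by simp
next
  case (invert X r R)
  have "linked (X, mset [r] + R) (X, mset [word_inv r] + R)"
  proof (rule linked_local)
    fix n :: nat and \<nu> rs assume *: "bij_betw \<nu> X {..<n}"
    then show "reach (n, map (renumber \<nu>) ([r] @ rs)) (n, map (renumber \<nu>) ([word_inv r] @ rs))"
      using invert renumber_in_F[OF *] reach_invert[of "renumber \<nu> r" n "[]" "map (renumber \<nu>) rs"]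
      by (simp add: renumber_word_inv)
  qed (use invert in auto)
  then show ?case by simp
next
  case (multiply X r s R)
  have "linked (X, mset [r, s] + R) (X, mset [r @ s, s] + R)"
  proof (rule linked_local)
    fix n :: nat and \<nu> rs
    show "reach (n, map (renumber \<nu>) ([r, s] @ rs)) (n, map (renumber \<nu>) ([r @ s, s] @ rs))"
      using reach_multiply_later[of n "[]" "renumber \<nu> r" "[]" "renumber \<nu> s" "map (renumber \<nu>) rs"]
      by (simp add: renumber_append)
  qed (use multiply in auto)
  then show ?case by simp
next
  case (conjugate X r R w)
  have "linked (X, mset [r] + R) (X, mset [w @ r @ word_inv w] + R)"
  proof (rule linked_local)
    fix n :: nat and \<nu> rs assume *: "bij_betw \<nu> X {..<n}"
    have "letters (map (apfst \<nu>) w) \<subseteq> {..<n}"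
      using conjugate * by (auto simp: letters_rename bij_betw_def)
    from reach_conjugate[OF this, of "renumber \<nu> r" "[]" "map (renumber \<nu>) rs"]
    show "reach (n, map (renumber \<nu>) ([r] @ rs)) (n, map (renumber \<nu>) ([w @ r @ word_inv w] @ rs))"
      using conjugate renumber_in_F[OF *] by (simp add: renumber_def rename_word_inv)
  qed (use conjugate in auto)
  then show ?case by simp
next
  case (add_generator X R x)
  obtain \<nu> where \<nu>: "bij_betw \<nu> X {..<card X}"
    using add_generator ex_bij_betw_finite_nat[of X] by (auto simp: lessThan_atLeast0)
  obtain rs where rs: "mset rs = R" by (metis ex_mset)
  define \<nu>' where "\<nu>' = \<nu>(x := card X)"
  have \<nu>': "bij_betw \<nu>' (insert x X) {..<Suc (card X)}"
  proof -
    have "bij_betw \<nu>' X {..<card X}"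
      using \<nu> add_generator by (subst bij_betw_cong[of _ _ \<nu>]) (auto simp: \<nu>'_def)
    then show ?thesis
      using add_generator notIn_Un_bij_betw[of x X \<nu>' "{..<card X}"]
      by (auto simp: \<nu>'_def lessThan_Suc)
  qed
  have same: "map (renumber \<nu>') rs = map (renumber \<nu>) rs"
    using add_generator rs
    by (fastforce simp: renumber_def \<nu>'_def letters_def intro!: arg_cong[of _ _ free_reduce])
  show ?case
  proof (rule linkedI)
    show "realizes (X, R) (card X, map (renumber \<nu>) rs)"
      using \<nu> rs by (auto simp: realizes_def)
    show "realizes (insert x X, add_mset [(x, True)] R)
        (Suc (card X), map (renumber \<nu>) rs @ [[(card X, True)]])"
      unfolding realizes_def using \<nu>' rs same
      by (intro exI[of _ \<nu>'] exI[of _ "rs @ [[(x, True)]]"])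
        (simp add: renumber_def \<nu>'_def free_reduce_def)
    show "reach (card X, map (renumber \<nu>) rs) (Suc (card X), map (renumber \<nu>) rs @ [[(card X, True)]])"
      by (intro r_into_rtranclp Qss_move.add_generator)
  qed (use add_generator in auto)
next
  case (substitute X R \<sigma> \<tau>)
  obtain \<nu> where \<nu>: "bij_betw \<nu> X {..<card X}"
    using substitute ex_bij_betw_finite_nat[of X] by (auto simp: lessThan_atLeast0)
  obtain rs where rs: "mset rs = R" by (metis ex_mset)
  let ?i = "inv_into X \<nu>" and ?n = "card X"
  have i: "?i k \<in> X" "\<nu> (?i k) = k" if "k < ?n" for k
    using \<nu> that by (auto simp: bij_betw_def f_inv_into_f inv_into_into)
  have i': "?i (\<nu> x) = x" if "x \<in> X" for x
    using \<nu> that by (simp add: bij_betw_def)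
  define \<sigma>' \<tau>' where "\<sigma>' = (\<lambda>k. map (apfst \<nu>) (\<sigma> (?i k)))" and "\<tau>' = (\<lambda>k. map (apfst \<nu>) (\<tau> (?i k)))"
  have transport: "subst (\<lambda>k. map (apfst \<nu>) (f (?i k))) (map (apfst \<nu>) r) = map (apfst \<nu>) (subst f r)"
    if "letters r \<subseteq> X" for f r
    unfolding rename_eq_subst subst_subst
    using that by (intro subst_cong) (auto simp: subst_letter i' rename_eq_subst)
  have renamed: "map (apfst \<nu>) (subst f (g (?i k))) \<simeq> [(k, True)]"
    if "subst f (g (?i k)) \<simeq> [(?i k, True)]" "k < ?n" for f g k
    using free_eq_subst[OF that(1), of "\<lambda>x. [(\<nu> x, True)]"] that(2)
    by (simp add: rename_eq_subst subst_letter i)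
  have lt: "\<nu> x < ?n" if "x \<in> X" for x using \<nu> that by (auto simp: bij_betw_def)
  have "Qss_move (?n, map free_reduce (map (map (apfst \<nu>)) rs))
      (?n, map (\<lambda>r. free_reduce (subst \<sigma>' r)) (map (map (apfst \<nu>)) rs))"
  proof (rule Qss_move_substitution[where \<tau> = \<tau>'])
    fix k assume k: "k < ?n"
    show "letters (\<sigma>' k) \<subseteq> {..<?n} \<and> subst \<tau>' (\<sigma>' k) \<simeq> [(k, True)]"
      using substitute(2)[OF i(1)[OF k]] k renamed[of \<tau> \<sigma> k] transport[of "\<sigma> (?i k)" \<tau>]
      by (auto simp: \<sigma>'_def \<tau>'_def letters_rename lt)
    show "letters (\<tau>' k) \<subseteq> {..<?n} \<and> subst \<sigma>' (\<tau>' k) \<simeq> [(k, True)]"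
      using substitute(3)[OF i(1)[OF k]] k renamed[of \<sigma> \<tau> k] transport[of "\<tau> (?i k)" \<sigma>]
      by (auto simp: \<sigma>'_def \<tau>'_def letters_rename lt)
  qed
  moreover have "map (\<lambda>r. free_reduce (subst \<sigma>' r)) (map (map (apfst \<nu>)) rs) = map (renumber \<nu>) (map (subst \<sigma>) rs)"
    using substitute(1) rs transport[of _ \<sigma>] by (auto simp: \<sigma>'_def renumber_def)
  ultimately have *: "reach (?n, map (renumber \<nu>) rs) (?n, map (renumber \<nu>) (map (subst \<sigma>) rs))"
    by (metis (no_types, lifting) map_map map_eq_conv o_apply r_into_rtranclp renumber_def)
  show ?case
  proof (rule linkedI[OF _ _ _ _ *])
    show "realizes (X, R) (?n, map (renumber \<nu>) rs)"
      using \<nu> rs by (auto simp: realizes_def)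
    show "realizes (X, image_mset (subst \<sigma>) R) (?n, map (renumber \<nu>) (map (subst \<sigma>) rs))"
      unfolding realizes_def using \<nu> rs
      by (intro exI[of _ \<nu>] exI[of _ "map (subst \<sigma>) rs"]) (auto simp: mset_map)
    show "over (X, image_mset (subst \<sigma>) R)"
      using substitute by (fastforce simp: letters_subst)
  qed (use substitute in auto)
qed


section \<open>Replacing relators modulo the others\<close>

lemma pres_equiv_over: "P \<sim>\<^sub>Q P' \<Longrightarrow> over P \<and> over P'"
  using pres_equiv_linked unfolding linked_def by blast

text \<open>
  Equality in the group with relators S, as the equivalence generated by free reduction and by
  deletion of a relator from the middle of a word.
\<close>

inductive rel_eq :: "'a set \<Rightarrow> 'a word set \<Rightarrow> 'a word \<Rightarrow> 'a word \<Rightarrow> bool" for X S where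
  free: "u \<simeq> v \<Longrightarrow> letters u \<subseteq> X \<Longrightarrow> letters v \<subseteq> X \<Longrightarrow> rel_eq X S u v"
| relator: "s \<in> S \<Longrightarrow> letters (a @ s @ b) \<subseteq> X \<Longrightarrow> rel_eq X S (a @ s @ b) (a @ b)"
| sym: "rel_eq X S u v \<Longrightarrow> rel_eq X S v u"
| trans: "rel_eq X S u v \<Longrightarrow> rel_eq X S v w \<Longrightarrow> rel_eq X S u w"

declare rel_eq.trans [trans]

lemma rel_eq_letters: "rel_eq X S u v \<Longrightarrow> letters u \<subseteq> X \<and> letters v \<subseteq> X"
  by (induction rule: rel_eq.induct) auto

lemma rel_eq_context:
  "rel_eq X S u v \<Longrightarrow> letters a \<subseteq> X \<Longrightarrow> letters b \<subseteq> X \<Longrightarrow> rel_eq X S (a @ u @ b) (a @ v @ b)"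
proof (induction rule: rel_eq.induct)
  case (free u v)
  then show ?case by (intro rel_eq.free free_eq_context) auto
next
  case (relator s a' b')
  then show ?case using rel_eq.relator[of s S "a @ a'" "b' @ b" X] by simp
qed (blast intro: rel_eq.sym rel_eq.trans)+

lemma rel_eq_append: "rel_eq X S u u' \<Longrightarrow> rel_eq X S v v' \<Longrightarrow> rel_eq X S (u @ v) (u' @ v')"
  using rel_eq_context[of X S u u' "[]" v] rel_eq_context[of X S v v' u' "[]"]
  by (auto dest: rel_eq_letters intro: rel_eq.trans)

lemma rel_eq_word_inv: assumes "rel_eq X S u v" shows "rel_eq X S (word_inv u) (word_inv v)"
proof -
  note uv = rel_eq_letters[OF assms]
  have "rel_eq X S (word_inv u) (word_inv u @ v @ word_inv v)"
    using uv cancel_context[of "word_inv u" v "[]"] by (intro rel_eq.free) (auto simp: free_eq_sym)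
  also have "rel_eq X S \<dots> (word_inv u @ u @ word_inv v)"
    using uv by (intro rel_eq_context rel_eq.sym[OF assms]) auto
  also have "rel_eq X S \<dots> (word_inv v)"
    using uv cancel_context'[of "[]" u "word_inv v"] by (intro rel_eq.free) auto
  finally show ?thesis .
qed

lemma rel_eq_subst:
  assumes "\<And>x. x \<in> letters w \<Longrightarrow> rel_eq X S [(x, True)] (\<sigma> x)"
  shows "rel_eq X S w (subst \<sigma> w)"
  using assms
proof (induction w)
  case Nil
  show ?case by (auto intro: rel_eq.free)
next
  case (Cons l w)
  obtain x b where l: "l = (x, b)" by fastforce
  have x: "rel_eq X S [(x, True)] (\<sigma> x)" using Cons.prems l by simp
  from rel_eq_word_inv[OF this] x have "rel_eq X S [l] (subst \<sigma> [l])"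
    by (simp add: l subst_letter word_inv_letter)
  with Cons have "rel_eq X S ([l] @ w) (subst \<sigma> [l] @ subst \<sigma> w)"
    by (intro rel_eq_append) auto
  then show ?case by (metis append_Cons append_Nil subst_append)
qed

text \<open>
  A relator may be changed modulo the other ones: if s is another relator, then a b times the
  conjugate of s by the inverse of b is a s b in the free group.
\<close>

lemma replace_relator:
  assumes "rel_eq X (set_mset R) r r'" "over (X, R)"
  shows "(X, add_mset r R) \<sim>\<^sub>Q (X, add_mset r' R)"
  using assms
proof (induction rule: rel_eq.induct)
  case (free u v)
  then show ?case by (intro pres_equiv.reduce) auto
next
  case (relator s a b)
  then obtain R0 where R: "R = add_mset s R0" by (metis multi_member_split)
  let ?s = "word_inv b @ s @ b"
  have over: "letters a \<subseteq> X" "letters b \<subseteq> X" "letters s \<subseteq> X" "over (X, R0)"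
    using relator R by auto
  have "(X, add_mset (a @ b) (add_mset s R0)) \<sim>\<^sub>Q (X, add_mset (a @ b) (add_mset ?s R0))"
    using pres_equiv.conjugate[of X s "add_mset (a @ b) R0" "word_inv b"] over
    by (simp add: add_mset_commute)
  also have "\<dots> \<sim>\<^sub>Q (X, add_mset ((a @ b) @ ?s) (add_mset ?s R0))"
    using over by (intro pres_equiv.multiply) auto
  also have "\<dots> \<sim>\<^sub>Q (X, add_mset (a @ s @ b) (add_mset ?s R0))"
    using over cancel_context[of a b "s @ b"] by (intro pres_equiv.reduce) auto
  also have "\<dots> \<sim>\<^sub>Q (X, add_mset (a @ s @ b) (add_mset (b @ ?s @ word_inv b) R0))"
    using pres_equiv.conjugate[of X ?s "add_mset (a @ s @ b) R0" b] over
    by (simp add: add_mset_commute)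
  also have "\<dots> \<sim>\<^sub>Q (X, add_mset (a @ s @ b) (add_mset s R0))"
  proof -
    have "b @ ?s @ word_inv b \<simeq> s"
      using cancel_context[of "[]" b "s @ b @ word_inv b"] cancel_context[of s b "[]"]
      by (auto intro: free_eq_trans)
    then show ?thesis
      using pres_equiv.reduce[of X "b @ ?s @ word_inv b" "add_mset (a @ s @ b) R0" s] over
      by (simp add: add_mset_commute)
  qed
  finally show ?case using R by (simp add: pres_equiv.sym)
next
  case (sym u v)
  then show ?case by (blast intro: pres_equiv.sym)
next
  case (trans u v w)
  then show ?case by (blast intro: pres_equiv.trans)
qed

text \<open>
  The relators are replaced one at a time, so that N and the part that is already replaced
  remain available as other relators.
\<close>

lemma replace_all:
  assumes "over (X, image_mset f M + N)"
    and "\<And>a N'. a \<in># M \<Longrightarrow> N \<subseteq># N' \<Longrightarrow> over (X, add_mset (f a) N') \<Longrightarrow>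
      (X, add_mset (f a) N') \<sim>\<^sub>Q (X, add_mset (g a) N')"
  shows "(X, image_mset f M + N) \<sim>\<^sub>Q (X, image_mset g M + N)"
  using assms
proof (induction M arbitrary: N)
  case empty
  then show ?case by (auto intro: pres_equiv.refl)
next
  case (add a M)
  have "(X, add_mset (f a) (image_mset f M + N)) \<sim>\<^sub>Q (X, add_mset (g a) (image_mset f M + N))"
    using add.prems by (intro add.prems(2)) auto
  also have "(X, add_mset (g a) (image_mset f M + N)) = (X, image_mset f M + add_mset (g a) N)"
    by simp
  also have "\<dots> \<sim>\<^sub>Q (X, image_mset g M + add_mset (g a) N)"
  proof (rule add.IH)
    show "over (X, image_mset f M + add_mset (g a) N)"
      using pres_equiv_over[OF calculation] by simp
    fix b N' assume "b \<in># M" "add_mset (g a) N \<subseteq># N'" "over (X, add_mset (f b) N')"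
    then show "(X, add_mset (f b) N') \<sim>\<^sub>Q (X, add_mset (g b) N')"
      by (intro add.prems(2)) (auto dest: mset_subset_eq_insertD subset_mset.less_imp_le)
  qed
  finally show ?case by simp
qed

lemma replace_all_rel_eq:
  assumes "over (X, image_mset f M + N)"
    and "\<And>a. a \<in># M \<Longrightarrow> rel_eq X (set_mset N) (f a) (g a)"
  shows "(X, image_mset f M + N) \<sim>\<^sub>Q (X, image_mset g M + N)"
proof (rule replace_all[OF assms(1)])
  fix a N' assume *: "a \<in># M" "N \<subseteq># N'" "over (X, add_mset (f a) N')"
  have "rel_eq X T u v" if "rel_eq X S u v" "S \<subseteq> T" for u v S T
    using that(1)
  proof (induction rule: rel_eq.induct)
    case (relator s a b)
    then show ?case using that(2) by (intro rel_eq.relator) auto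
  qed (blast intro: rel_eq.free rel_eq.sym rel_eq.trans)+
  with * assms(2) have "rel_eq X (set_mset N') (f a) (g a)"
    by (meson set_mset_mono)
  with * show "(X, add_mset (f a) N') \<sim>\<^sub>Q (X, add_mset (g a) N')"
    by (intro replace_relator) auto
qed

text \<open>
  Whether two words represent conjugate elements or one is conjugate to the inverse of the other.  The
  boundary of a 2-cell is determined only up to this relation.
\<close>

definition akin :: "'a set \<Rightarrow> 'a word \<Rightarrow> 'a word \<Rightarrow> bool" where
  "akin X u v \<longleftrightarrow> letters v \<subseteq> X \<and> (\<exists>w. letters w \<subseteq> X \<and>
     (w @ u @ word_inv w \<simeq> v \<or> w @ word_inv u @ word_inv w \<simeq> v))"

lemma replace_akin:
  assumes "akin X u v" "over (X, add_mset u R)"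
  shows "(X, add_mset u R) \<sim>\<^sub>Q (X, add_mset v R)"
proof -
  obtain w where w: "letters w \<subseteq> X" "w @ u @ word_inv w \<simeq> v \<or> w @ word_inv u @ word_inv w \<simeq> v"
    and v: "letters v \<subseteq> X"
    using assms by (auto simp: akin_def)
  have *: "(X, add_mset u' R) \<sim>\<^sub>Q (X, add_mset v R)"
    if "w @ u' @ word_inv w \<simeq> v" "letters u' \<subseteq> X" for u'
  proof -
    have "(X, add_mset u' R) \<sim>\<^sub>Q (X, add_mset (w @ u' @ word_inv w) R)"
      using that assms w by (intro pres_equiv.conjugate) auto
    also have "\<dots> \<sim>\<^sub>Q (X, add_mset v R)"
      using that assms w v by (intro pres_equiv.reduce) auto
    finally show ?thesis .
  qed
  from w(2) show ?thesis
  proof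
    assume "w @ word_inv u @ word_inv w \<simeq> v"
    then have "(X, add_mset (word_inv u) R) \<sim>\<^sub>Q (X, add_mset v R)"
      using assms by (intro *) auto
    with pres_equiv.invert[OF assms(2)] show ?thesis by (rule pres_equiv.trans)
  qed (use assms * in auto)
qed

lemma replace_all_akin:
  assumes "over (X, image_mset f M + N)" and "\<And>a. a \<in># M \<Longrightarrow> akin X (f a) (g a)"
  shows "(X, image_mset f M + N) \<sim>\<^sub>Q (X, image_mset g M + N)"
  by (rule replace_all[OF assms(1)]) (use assms(2) in \<open>blast intro: replace_akin\<close>)


section \<open>Eliminating generators\<close>

abbreviation letter_relators :: "'a set \<Rightarrow> 'a word multiset" where
  "letter_relators T \<equiv> image_mset (\<lambda>t. [(t, True)]) (mset_set T)"

text \<open>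
  The expression of x induced by the relator w1 x w2 or w1 (inverse of x) w2.
\<close>

definition solve_for :: "'a word \<Rightarrow> bool \<Rightarrow> 'a word \<Rightarrow> 'a word" where
  "solve_for w1 b w2 =
     (if b then word_inv w1 @ word_inv w2 else word_inv (word_inv w1 @ word_inv w2))"

text \<open>
  Modulo the relator, x equals the expression u that it induces, which thus may be substituted in all
  other relators.  Up to conjugation and inversion the relator itself is x times the inverse of u, and the
  automorphism that maps x to x u and fixes the other generators turns it into x.
\<close>

lemma eliminate_generator:
  assumes over: "over (X, add_mset (w1 @ [(x, b)] @ w2) R)"
    and x: "x \<notin> letters w1" "x \<notin> letters w2"
  shows "(X, add_mset (w1 @ [(x, b)] @ w2) R) \<sim>\<^sub>Q
    (X - {x}, image_mset (rewrite_word x (solve_for w1 b w2)) R)"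
proof -
  define r where "r = w1 @ [(x, b)] @ w2"
  define u where "u = solve_for w1 b w2"
  define \<sigma> where "\<sigma> = (\<lambda>y. [(y, True)])(x := u)"
  have X: "x \<in> X" "letters w1 \<subseteq> X" "letters w2 \<subseteq> X" "finite X"
    and R: "\<And>s. s \<in># R \<Longrightarrow> letters s \<subseteq> X"
    using over by auto
  have u: "letters u \<subseteq> X - {x}" using X x by (auto simp: u_def solve_for_def)
  have rewr: "rewrite_word x u = subst \<sigma>" by (simp add: rewrite_word_eq_subst \<sigma>_def)
  let ?R = "image_mset (subst \<sigma>) R"
  have R': "letters s \<subseteq> X - {x}" if "s \<in># ?R" for s
  proof -
    obtain s' where "s' \<in># R" "s = subst \<sigma> s'" using \<open>s \<in># ?R\<close> by auto
    then show ?thesis using R[of s'] u by (force simp: letters_subst \<sigma>_def split: if_splits)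
  qed
  then have overR: "over (X, ?R)" using X(4) by auto
  have "[(x, b)] \<simeq> word_inv w1 @ r @ word_inv w2"
    using cancel_context'[of "[]" w1 "[(x, b)] @ w2 @ word_inv w2"] cancel_context[of "[(x, b)]" w2 "[]"]
    by (simp add: r_def free_eq_def)
  then have "rel_eq X {r} [(x, b)] (word_inv w1 @ r @ word_inv w2)"
    using X by (intro rel_eq.free) (auto simp: r_def)
  also have "rel_eq X {r} \<dots> (word_inv w1 @ word_inv w2)"
    using X by (intro rel_eq.relator) (auto simp: r_def)
  finally have solved: "rel_eq X {r} [(x, b)] (word_inv w1 @ word_inv w2)" .
  have x_u: "rel_eq X {r} [(x, True)] u"
    using solved rel_eq_word_inv[OF solved]
    by (cases b) (auto simp: u_def solve_for_def word_inv_letter)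
  have "(X, image_mset (\<lambda>s. s) R + {#r#}) \<sim>\<^sub>Q (X, ?R + {#r#})"
  proof (rule replace_all_rel_eq)
    fix s assume "s \<in># R"
    then have "letters s \<subseteq> X" by (rule R)
    have "rel_eq X {r} [(y, True)] (\<sigma> y)" if "y \<in> letters s" for y
    proof (cases "y = x")
      case False
      then show ?thesis
        using that \<open>letters s \<subseteq> X\<close> by (intro rel_eq.free) (auto simp: \<sigma>_def)
    qed (use x_u in \<open>simp add: \<sigma>_def\<close>)
    then show "rel_eq X (set_mset {#r#}) s (subst \<sigma> s)"
      by (intro rel_eq_subst) simp
  qed (use over r_def in auto)
  then have "(X, add_mset r R) \<sim>\<^sub>Q (X, add_mset r ?R)" by simp
  also have "\<dots> \<sim>\<^sub>Q (X, add_mset ([(x, True)] @ word_inv u) ?R)"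
  proof (rule replace_akin)
    show "akin X r ([(x, True)] @ word_inv u)"
    proof (cases b)
      case True
      then have "word_inv w1 @ r @ word_inv (word_inv w1) \<simeq> [(x, True)] @ word_inv u"
        using cancel_context'[of "[]" w1 "[(x, True)] @ w2 @ w1"] by (simp add: r_def u_def solve_for_def)
      then show ?thesis unfolding akin_def using X u by (intro conjI exI[of _ "word_inv w1"]) auto
    next
      case False
      then have "w2 @ word_inv r @ word_inv w2 \<simeq> [(x, True)] @ word_inv u"
        using cancel_context[of "[]" w2 "[(x, True)] @ word_inv w1 @ word_inv w2"]
        by (simp add: r_def u_def solve_for_def word_inv_Cons)
      then show ?thesis unfolding akin_def using X u by (intro conjI exI[of _ w2]) auto
    qed
    show "over (X, add_mset r ?R)" using X overR by (simp add: r_def)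
  qed
  also have "\<dots> \<sim>\<^sub>Q (X, add_mset ([(x, True)] @ u @ word_inv u) ?R)"
  proof -
    \<comment> \<open>The automorphism x \<open>\<mapsto>\<close> x u and its inverse.\<close>
    define \<alpha> \<beta> where "\<alpha> = (\<lambda>y. [(y, True)])(x := [(x, True)] @ u)"
      and "\<beta> = (\<lambda>y. [(y, True)])(x := [(x, True)] @ word_inv u)"
    have fixed: "subst \<alpha> s = s" "subst \<beta> s = s" if "letters s \<subseteq> X - {x}" for s
      using that by (auto simp: \<alpha>_def \<beta>_def intro!: subst_id)
    have "(X, add_mset ([(x, True)] @ word_inv u) ?R) \<sim>\<^sub>Q
      (X, image_mset (subst \<alpha>) (add_mset ([(x, True)] @ word_inv u) ?R))"
    proof (rule pres_equiv.substitute[where \<tau> = \<beta>])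
      show "over (X, add_mset ([(x, True)] @ word_inv u) ?R)" using X overR u by auto
      fix y assume "y \<in> X"
      have at_x: "\<alpha> x = (x, True) # u" "\<beta> x = (x, True) # word_inv u"
        and away: "y \<noteq> x \<Longrightarrow> \<alpha> y = [(y, True)]" "y \<noteq> x \<Longrightarrow> \<beta> y = [(y, True)]"
        by (auto simp: \<alpha>_def \<beta>_def)
      show "letters (\<alpha> y) \<subseteq> X \<and> subst \<beta> (\<alpha> y) \<simeq> [(y, True)]"
        "letters (\<beta> y) \<subseteq> X \<and> subst \<alpha> (\<beta> y) \<simeq> [(y, True)]"
        using u X \<open>y \<in> X\<close> cancel_context[of "[(x, True)]" u "[]"] cancel_context'[of "[(x, True)]" u "[]"]
        by (cases "y = x"; auto simp: fixed subst_Cons at_x away)+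
    qed
    moreover have "image_mset (subst \<alpha>) ?R = ?R"
      using R' fixed by (intro multiset.map_ident_strong) blast
    moreover have "subst \<alpha> ([(x, True)] @ word_inv u) = [(x, True)] @ u @ word_inv u"
      using u by (simp add: fixed subst_Cons) (simp add: \<alpha>_def)
    ultimately show ?thesis by simp
  qed
  also have "\<dots> \<sim>\<^sub>Q (X, add_mset [(x, True)] ?R)"
  proof (rule pres_equiv.reduce)
    show "over (X, add_mset ([(x, True)] @ u @ word_inv u) ?R)" using X overR u by auto
    show "[(x, True)] @ u @ word_inv u \<simeq> [(x, True)]" using cancel_context[of "[(x, True)]" u "[]"] by simp
  qed (use X in auto)
  also have "\<dots> \<sim>\<^sub>Q (X - {x}, ?R)"
    using pres_equiv.add_generator[of "X - {x}" ?R x] X R'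
    by (simp add: insert_absorb pres_equiv.sym)
  finally show ?thesis by (simp add: r_def u_def rewr[unfolded u_def])
qed

text \<open>
  The case in which x occurs in no other relator, so that these do not change.
\<close>

lemma eliminate_pendant:
  assumes "over (X, R)" "x \<notin> X" "letters w1 \<subseteq> X" "letters w2 \<subseteq> X"
  shows "(insert x X, add_mset (w1 @ [(x, b)] @ w2) R) \<sim>\<^sub>Q (X, R)"
proof -
  have "image_mset (rewrite_word x (solve_for w1 b w2)) R = R"
  proof (rule multiset.map_ident_strong)
    fix s assume "s \<in># R"
    with assms have "x \<notin> letters s" by auto
    then show "rewrite_word x (solve_for w1 b w2) s = s"
      unfolding rewrite_word_eq_subst by (intro subst_id) auto
  qed
  with eliminate_generator[of "insert x X" w1 x b w2 R] assms show ?thesis by fastforce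
qed

lemma rewrite_word_Nil: "rewrite_word x [] w = filter (\<lambda>l. fst l \<noteq> x) w"
  by (induction w) (auto simp: rewrite_word_def)

lemma letters_filter [simp]: "letters (filter (\<lambda>l. fst l \<notin> T) w) = letters w - T"
  by (auto simp: letters_def)

text \<open>
  The relator t of length one induces the empty expression, and rewriting deletes the letter t.
\<close>

lemma eliminate_letters:
  assumes "finite T" "over (X, letter_relators T + R)"
  shows "(X, letter_relators T + R) \<sim>\<^sub>Q (X - T, image_mset (filter (\<lambda>l. fst l \<notin> T)) R)"
  using assms
proof (induction T arbitrary: X R rule: finite_induct)
  case empty
  then show ?case by (auto intro: pres_equiv.refl)
next
  case (insert t T)
  let ?f = "filter (\<lambda>l. fst l \<noteq> t) :: 'a word \<Rightarrow> 'a word"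
  have f: "image_mset ?f (letter_relators T) = letter_relators T"
    using insert.hyps by (intro multiset.map_ident_strong) auto
  have "(X, add_mset [(t, True)] (letter_relators T + R)) \<sim>\<^sub>Q
      (X - {t}, image_mset ?f (letter_relators T + R))"
    using eliminate_generator[of X "[]" t True "[]" "letter_relators T + R"] insert
    by (simp add: solve_for_def rewrite_word_Nil[abs_def])
  also have "\<dots> = (X - {t}, letter_relators T + image_mset ?f R)"
    using f by simp
  also have "\<dots> \<sim>\<^sub>Q (X - {t} - T, image_mset (filter (\<lambda>l. fst l \<notin> T)) (image_mset ?f R))"
    using pres_equiv_over[OF calculation] f by (intro insert.IH) simp
  also have "X - {t} - T = X - insert t T" by blast
  finally show ?case
    using insert.hyps by (simp add: multiset.map_comp o_def conj_commute)
qed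

lemma add_generators:
  assumes "finite A" "over (X, R)" "A \<inter> X = {}"
  shows "(X, R) \<sim>\<^sub>Q (X \<union> A, letter_relators A + R)"
  using assms
proof (induction A rule: finite_induct)
  case empty
  then show ?case by (auto intro: pres_equiv.refl)
next
  case (insert a A)
  then have *: "(X, R) \<sim>\<^sub>Q (X \<union> A, letter_relators A + R)" by auto
  also have "\<dots> \<sim>\<^sub>Q (insert a (X \<union> A), add_mset [(a, True)] (letter_relators A + R))"
    using insert pres_equiv_over[OF *] by (intro pres_equiv.add_generator) auto
  finally show ?case using insert.hyps by simp
qed


section \<open>Relators that are paths from a base vertex\<close>

fun walk :: "('a \<Rightarrow> 'a) \<Rightarrow> ('a \<Rightarrow> 'a) \<Rightarrow> 'a \<Rightarrow> 'a word \<Rightarrow> 'a \<Rightarrow> bool" where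
  "walk src tgt u [] v \<longleftrightarrow> u = v"
| "walk src tgt u (l # w) v \<longleftrightarrow>
     letter_start src tgt l = u \<and> walk src tgt (letter_end src tgt l) w v"

lemma walk_append:
  "walk src tgt u (w1 @ w2) v \<longleftrightarrow> (\<exists>m. walk src tgt u w1 m \<and> walk src tgt m w2 v)"
  by (induction w1 arbitrary: u) auto

text \<open>
  The substitution that multiplies every path from u to v by q u on the left and by the inverse of q v
  on the right.
\<close>

definition gauge :: "('a \<Rightarrow> 'a) \<Rightarrow> ('a \<Rightarrow> 'a) \<Rightarrow> ('a \<Rightarrow> 'a word) \<Rightarrow> 'a \<Rightarrow> 'a word" where
  "gauge src tgt q e = q (src e) @ [(e, True)] @ word_inv (q (tgt e))"

text \<open>
  The contributions of the interior vertices of a path cancel.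
\<close>

lemma subst_gauge_walk:
  assumes "walk src tgt u w v" "letters w \<subseteq> E" "\<And>e. e \<in> E \<Longrightarrow> \<gamma> e = gauge src tgt q e"
  shows "subst \<gamma> w \<simeq> q u @ w @ word_inv (q v)"
  using assms
proof (induction w arbitrary: u)
  case Nil
  then show ?case using cancel_word_inv[of "q v"] by (simp add: free_eq_sym)
next
  case (Cons l w)
  obtain e b where l: "l = (e, b)" by fastforce
  let ?m = "letter_end src tgt l"
  have "subst \<gamma> (l # w) \<simeq> subst \<gamma> [l] @ q ?m @ w @ word_inv (q v)"
    using Cons free_eq_append[OF free_eq_refl, of "subst \<gamma> w" "q ?m @ w @ word_inv (q v)" "subst \<gamma> [l]"]
    by (metis append_Cons append_Nil letters_Cons insert_subset subst_append walk.simps(2))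
  also have "subst \<gamma> [l] = q u @ [l] @ word_inv (q ?m)"
    using Cons.prems
    by (auto simp: l subst_letter gauge_def letter_start_def letter_end_def word_inv_letter word_inv_Cons)
  also have "(q u @ [l] @ word_inv (q ?m)) @ q ?m @ w @ word_inv (q v) \<simeq> q u @ (l # w) @ word_inv (q v)"
    using cancel_context'[of "q u @ [l]" "q ?m" "w @ word_inv (q v)"] by simp
  finally show ?case .
qed

text \<open>
  The relators h v are replaced by h' v with the help of new generators q v, for which the vertices v
  themselves serve as names.  Up to conjugation and inversion, the relators that belong to a vertex v
  undergo the changes
  
    \<open>(q v, h v) \<rightarrow> (q v h' v, h v) \<rightarrow> (q v h' v (q v)\<inverse>, h v (q v)\<inverse>) \<rightarrow> (h' v, h v (q v)\<inverse>) \<rightarrow> (h' v, q v)\<close>.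
  
  The first and the last step are the automorphisms that multiply each q v on the right by h' v and by
  h v; the second one is the gauge transformation by q, which only conjugates the closed words in W.
\<close>

theorem change_of_paths:
  assumes E: "finite E" and V: "finite V" and disjoint: "E \<inter> V = {}" and v0: "v0 \<in> V"
    and W: "\<And>w. w \<in># W \<Longrightarrow> letters w \<subseteq> E \<and> (\<exists>u\<in>V. walk src tgt u w u)"
    and ends: "\<And>e. e \<in> E \<Longrightarrow> src e \<in> V \<and> tgt e \<in> V"
    and h: "\<And>v. v \<in> V - {v0} \<Longrightarrow> letters (h v) \<subseteq> E \<and> walk src tgt v0 (h v) v"
    and h': "\<And>v. v \<in> V - {v0} \<Longrightarrow> letters (h' v) \<subseteq> E \<and> walk src tgt v0 (h' v) v"
  shows "(E, image_mset h (mset_set (V - {v0})) + W) \<sim>\<^sub>Q (E, image_mset h' (mset_set (V - {v0})) + W)"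
proof -
  define U where "U = V - {v0}"
  define M where "M = mset_set U"
  define X where "X = E \<union> U"
  \<comment> \<open>The root has no auxiliary generator, so that paths start with an empty factor.\<close>
  define q where "q v = (if v = v0 then [] else [(v, True)])" for v
  have M: "v \<in># M \<longleftrightarrow> v \<in> U" for v using V by (simp add: M_def U_def)
  have U: "finite U" "U \<inter> E = {}" "\<And>v. v \<in> U \<Longrightarrow> v \<in> V \<and> v \<noteq> v0" "\<And>v. v \<in> U \<Longrightarrow> v \<notin> E"
    using V disjoint by (auto simp: U_def)
  have X: "finite X" using E U by (simp add: X_def)
  have lq: "letters (q v) \<subseteq> X" if "v \<in> V" for v using that by (auto simp: q_def X_def U_def)
  have lh: "letters (h v) \<subseteq> E" "letters (h' v) \<subseteq> E" "walk src tgt v0 (h v) v" "walk src tgt v0 (h' v) v"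
    if "v \<in> U" for v using h h' that by (auto simp: U_def)
  have lift: "letters w \<subseteq> X" if "letters w \<subseteq> E" for w using that by (auto simp: X_def)

  \<comment> \<open>The automorphisms that multiply auxiliary generators on the right, with their inverses.\<close>
  define \<alpha> where "\<alpha> k x = (if x \<in> U then [(x, True)] @ k x else [(x, True)])" for k x
  define \<alpha>' where "\<alpha>' k x = (if x \<in> U then [(x, True)] @ word_inv (k x) else [(x, True)])" for k x
  have \<alpha>_id: "subst (\<alpha> k) w = w" "subst (\<alpha>' k) w = w" if "letters w \<subseteq> E" for k w
  proof -
    have "letters w \<inter> U = {}" using that U by blast
    then show "subst (\<alpha> k) w = w" "subst (\<alpha>' k) w = w"
      by (auto simp: \<alpha>_def \<alpha>'_def disjoint_iff intro!: subst_id)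
  qed
  have shift: "(X, R) \<sim>\<^sub>Q (X, image_mset (subst (\<alpha> k)) R)"
    if "over (X, R)" "\<And>v. v \<in> U \<Longrightarrow> letters (k v) \<subseteq> E" for k R
  proof (rule pres_equiv.substitute[where \<tau> = "\<alpha>' k"])
    fix x assume "x \<in> X"
    then show "letters (\<alpha> k x) \<subseteq> X \<and> subst (\<alpha>' k) (\<alpha> k x) \<simeq> [(x, True)]"
      "letters (\<alpha>' k x) \<subseteq> X \<and> subst (\<alpha> k) (\<alpha>' k x) \<simeq> [(x, True)]"
      using that(2)[of x] cancel_context[of "[(x, True)]" "k x" "[]"]
        cancel_context'[of "[(x, True)]" "k x" "[]"]
      by (auto simp: \<alpha>_id lift subst_Cons \<alpha>_def[of k x] \<alpha>'_def[of k x])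
  qed fact

  \<comment> \<open>The gauge transformation by q; the one by the inverses of q is its inverse.\<close>
  define \<gamma> where "\<gamma> p x = (if x \<in> E then gauge src tgt p x else [(x, True)])" for p x
  have \<gamma>: "subst (\<gamma> p) w \<simeq> p u @ w @ word_inv (p v)" if "letters w \<subseteq> E" "walk src tgt u w v" for p w u v
    using that by (intro subst_gauge_walk[where E = E]) (auto simp: \<gamma>_def)
  have \<gamma>_q: "subst (\<gamma> p) (q v) = q v" if "v \<in> V" for p v
    using that U disjoint by (intro subst_id) (auto simp: \<gamma>_def q_def split: if_splits)
  have gauged: "(X, R) \<sim>\<^sub>Q (X, image_mset (subst (\<gamma> q)) R)" if "over (X, R)" for R
  proof (rule pres_equiv.substitute[where \<tau> = "\<gamma> (\<lambda>v. word_inv (q v))"])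
    fix x assume x: "x \<in> X"
    have lr: "letters (\<gamma> q x) \<subseteq> X" "letters (\<gamma> (\<lambda>v. word_inv (q v)) x) \<subseteq> X"
      using x ends[of x] lq by (auto simp: \<gamma>_def gauge_def X_def)
    have "subst (\<gamma> (\<lambda>v. word_inv (q v))) (\<gamma> q x) \<simeq> [(x, True)] \<and>
        subst (\<gamma> q) (\<gamma> (\<lambda>v. word_inv (q v)) x) \<simeq> [(x, True)]"
    proof (cases "x \<in> E")
      case True
      have "q (src x) @ word_inv (q (src x)) @ [(x, True)] @ q (tgt x) @ word_inv (q (tgt x)) \<simeq> [(x, True)]"
        "word_inv (q (src x)) @ q (src x) @ [(x, True)] @ word_inv (q (tgt x)) @ q (tgt x) \<simeq> [(x, True)]"
        using cancel_context[of "[]" "q (src x)"] cancel_context[of "[(x, True)]" "q (tgt x)" "[]"]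
          cancel_context'[of "[]" "q (src x)"] cancel_context'[of "[(x, True)]" "q (tgt x)" "[]"]
        by (auto intro: free_eq_trans)
      moreover have "\<gamma> p x = p (src x) @ [(x, True)] @ word_inv (p (tgt x))" for p
        using True by (simp add: \<gamma>_def gauge_def)
      ultimately show ?thesis
        using ends[OF True] by (simp add: \<gamma>_q subst_Cons)
    qed (use x in \<open>auto simp: \<gamma>_def subst_letter\<close>)
    with lr show "letters (\<gamma> q x) \<subseteq> X \<and> subst (\<gamma> (\<lambda>v. word_inv (q v))) (\<gamma> q x) \<simeq> [(x, True)]"
      "letters (\<gamma> (\<lambda>v. word_inv (q v)) x) \<subseteq> X \<and>
        subst (\<gamma> q) (\<gamma> (\<lambda>v. word_inv (q v)) x) \<simeq> [(x, True)]" by auto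
  qed fact

  have overE: "over (E, image_mset h M + W)" using E W lh(1) by (simp add: ball_Un M)
  then have "(E, image_mset h M + W) \<sim>\<^sub>Q (X, letter_relators U + (image_mset h M + W))"
    unfolding X_def using U by (intro add_generators) auto
  also have "\<dots> \<sim>\<^sub>Q (X, image_mset (subst (\<alpha> h')) (letter_relators U + (image_mset h M + W)))"
    using pres_equiv_over[OF calculation] lh by (intro shift) auto
  also have "image_mset (subst (\<alpha> h')) (letter_relators U + (image_mset h M + W)) =
      image_mset (\<lambda>v. [(v, True)] @ h' v) M + image_mset h M + W"
  proof -
    have "image_mset (subst (\<alpha> h')) (image_mset h M + W) = image_mset h M + W"
      using lh W by (intro multiset.map_ident_strong) (auto simp: M \<alpha>_id)
    moreover have "image_mset (subst (\<alpha> h')) (letter_relators U) = image_mset (\<lambda>v. [(v, True)] @ h' v) M"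
      using M by (auto simp: multiset.map_comp M_def \<alpha>_def subst_letter intro!: image_mset_cong)
    ultimately show ?thesis by simp
  qed
  also have "(X, image_mset (\<lambda>v. [(v, True)] @ h' v) M + image_mset h M + W) \<sim>\<^sub>Q
      (X, image_mset (subst (\<gamma> q)) (image_mset (\<lambda>v. [(v, True)] @ h' v) M + image_mset h M + W))"
    using pres_equiv_over[OF calculation] by (intro gauged) auto
  also have "\<dots> = (X, image_mset (\<lambda>v. subst (\<gamma> q) ([(v, True)] @ h' v)) M +
      (image_mset (\<lambda>v. subst (\<gamma> q) (h v)) M + image_mset (subst (\<gamma> q)) W))"
    by (simp add: multiset.map_comp o_def)
  also have "\<dots> \<sim>\<^sub>Q (X, image_mset h' M +
      (image_mset (\<lambda>v. subst (\<gamma> q) (h v)) M + image_mset (subst (\<gamma> q)) W))"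
  proof (rule replace_all_akin)
    show "over (X, image_mset (\<lambda>v. subst (\<gamma> q) ([(v, True)] @ h' v)) M +
        (image_mset (\<lambda>v. subst (\<gamma> q) (h v)) M + image_mset (subst (\<gamma> q)) W))"
      using pres_equiv_over[OF calculation] by simp
    fix v assume "v \<in># M"
    then have v: "v \<in> U" by (simp add: M)
    have "subst (\<gamma> q) ([(v, True)] @ h' v) \<simeq> q v @ h' v @ word_inv (q v)"
      using \<gamma>[OF lh(2) lh(4), OF v v, of q] U(3,4)[OF v]
      by (simp add: subst_Cons \<gamma>_def[of q v] q_def[of v0] q_def[of v] free_eq_append[OF free_eq_refl, of _ _ "[_]", simplified])
    then have "word_inv (q v) @ subst (\<gamma> q) ([(v, True)] @ h' v) @ q v \<simeq>
        word_inv (q v) @ (q v @ h' v @ word_inv (q v)) @ q v"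
      by (rule free_eq_context)
    also have "\<dots> \<simeq> h' v"
      using cancel_context'[of "[]" "q v" "h' v @ word_inv (q v) @ q v"] cancel_context'[of "h' v" "q v" "[]"]
      by (auto intro: free_eq_trans)
    finally show "akin X (subst (\<gamma> q) ([(v, True)] @ h' v)) (h' v)"
      unfolding akin_def using lq U(3)[OF v] lh(2)[OF v] lift
      by (intro conjI exI[of _ "word_inv (q v)"]) auto
  qed
  also have "\<dots> = (X, image_mset (\<lambda>v. subst (\<gamma> q) (h v)) M + (image_mset h' M + image_mset (subst (\<gamma> q)) W))"
    by (simp add: ac_simps)
  also have "\<dots> \<sim>\<^sub>Q (X, image_mset (\<lambda>v. h v @ [(v, False)]) M + (image_mset h' M + image_mset (subst (\<gamma> q)) W))"
  proof (rule replace_all_akin)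
    show "over (X, image_mset (\<lambda>v. subst (\<gamma> q) (h v)) M + (image_mset h' M + image_mset (subst (\<gamma> q)) W))"
      using pres_equiv_over[OF calculation] by simp
    fix v assume "v \<in># M"
    then have v: "v \<in> U" by (simp add: M)
    show "akin X (subst (\<gamma> q) (h v)) (h v @ [(v, False)])"
      unfolding akin_def using \<gamma>[OF lh(1) lh(3), OF v v, of q] lh(1)[OF v] U(3)[OF v] v lift
      by (intro conjI exI[of _ "[]"]) (auto simp: q_def word_inv_letter X_def)
  qed
  also have "\<dots> = (X, image_mset (subst (\<gamma> q)) W + (image_mset (\<lambda>v. h v @ [(v, False)]) M + image_mset h' M))"
    by (simp add: ac_simps)
  also have "\<dots> \<sim>\<^sub>Q (X, image_mset (\<lambda>w. w) W + (image_mset (\<lambda>v. h v @ [(v, False)]) M + image_mset h' M))"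
  proof (rule replace_all_akin)
    show "over (X, image_mset (subst (\<gamma> q)) W + (image_mset (\<lambda>v. h v @ [(v, False)]) M + image_mset h' M))"
      using pres_equiv_over[OF calculation] by simp
    fix w assume "w \<in># W"
    then obtain u where u: "u \<in> V" "letters w \<subseteq> E" "walk src tgt u w u" using W by blast
    have "word_inv (q u) @ subst (\<gamma> q) w @ q u \<simeq> word_inv (q u) @ (q u @ w @ word_inv (q u)) @ q u"
      by (intro free_eq_context \<gamma> u)
    also have "\<dots> \<simeq> w"
      using cancel_context'[of "[]" "q u" "w @ word_inv (q u) @ q u"] cancel_context'[of "w" "q u" "[]"]
      by (auto intro: free_eq_trans)
    finally show "akin X (subst (\<gamma> q) w) w"
      unfolding akin_def using lq u lift by (intro conjI exI[of _ "word_inv (q u)"]) auto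
  qed
  also have "\<dots> = (X, image_mset (\<lambda>v. h v @ [(v, False)]) M + image_mset h' M + W)"
    by (simp add: ac_simps)
  also have "\<dots> \<sim>\<^sub>Q (X, image_mset (subst (\<alpha> h)) (image_mset (\<lambda>v. h v @ [(v, False)]) M + image_mset h' M + W))"
    using pres_equiv_over[OF calculation] lh by (intro shift) auto
  also have "\<dots> = (X, image_mset (\<lambda>v. h v @ word_inv ([(v, True)] @ h v)) M + (image_mset h' M + W))"
  proof -
    have "image_mset (subst (\<alpha> h)) (image_mset h' M + W) = image_mset h' M + W"
      using lh W by (intro multiset.map_ident_strong) (auto simp: M \<alpha>_id)
    moreover have "image_mset (subst (\<alpha> h)) (image_mset (\<lambda>v. h v @ [(v, False)]) M) =
        image_mset (\<lambda>v. h v @ word_inv ([(v, True)] @ h v)) M"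
      using M lh by (auto simp: multiset.map_comp \<alpha>_id subst_letter intro!: image_mset_cong)
        (auto simp: \<alpha>_def)
    ultimately show ?thesis by simp
  qed
  also have "\<dots> \<sim>\<^sub>Q (X, image_mset (\<lambda>v. [(v, True)]) M + (image_mset h' M + W))"
  proof (rule replace_all_akin)
    show "over (X, image_mset (\<lambda>v. h v @ word_inv ([(v, True)] @ h v)) M + (image_mset h' M + W))"
      using pres_equiv_over[OF calculation] by simp
    fix v assume "v \<in># M"
    then have v: "v \<in> U" by (simp add: M)
    have "word_inv (h v @ word_inv ([(v, True)] @ h v)) \<simeq> [(v, True)]"
      using cancel_context[of "[(v, True)]" "h v" "[]"] by simp
    then show "akin X (h v @ word_inv ([(v, True)] @ h v)) [(v, True)]"
      unfolding akin_def using v by (intro conjI exI[of _ "[]"]) (auto simp: X_def)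
  qed
  also have "\<dots> \<sim>\<^sub>Q (E, image_mset h' M + W)"
  proof -
    have "over (E, image_mset h' M + W)" using E W lh(2) by (simp add: ball_Un M)
    with U have "(E, image_mset h' M + W) \<sim>\<^sub>Q (X, letter_relators U + (image_mset h' M + W))"
      unfolding X_def by (intro add_generators) auto
    then show ?thesis by (simp add: M_def pres_equiv.sym)
  qed
  finally show ?thesis by (simp add: M_def U_def)
qed


section \<open>Spanning trees\<close>

text \<open>
  The tree is given by the letter l v, for every vertex v other than the root, that runs along an edge
  from the parent of v to v.
\<close>

locale rooted_tree =
  fixes src tgt :: "'a \<Rightarrow> 'a" and E V :: "'a set" and v0 :: 'a and l :: "'a \<Rightarrow> 'a \<times> bool"
  assumes finite_V: "finite V"
    and root: "v0 \<in> V"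
    and edge: "v \<in> V - {v0} \<Longrightarrow> fst (l v) \<in> E"
    and start: "v \<in> V - {v0} \<Longrightarrow> letter_start src tgt (l v) \<in> V"
    and end_: "v \<in> V - {v0} \<Longrightarrow> letter_end src tgt (l v) = v"
    and acyclic: "acyclic {(letter_start src tgt (l v), v) |v. v \<in> V - {v0}}"
    and inj: "inj_on (\<lambda>v. fst (l v)) (V - {v0})"
begin

abbreviation "parent v \<equiv> letter_start src tgt (l v)"

definition edges :: "'a set" where "edges = (\<lambda>v. fst (l v)) ` (V - {v0})"

lemma wf_parent: "wf {(parent v, v) |v. v \<in> V - {v0}}"
proof (rule finite_acyclic_wf[OF _ acyclic])
  have "{(parent v, v) |v. v \<in> V - {v0}} = (\<lambda>v. (parent v, v)) ` (V - {v0})" by blast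
  then show "finite {(parent v, v) |v. v \<in> V - {v0}}" using finite_V by simp
qed

definition path :: "'a \<Rightarrow> 'a word" where
  "path = wfrec {(parent v, v) |v. v \<in> V - {v0}}
     (\<lambda>f v. if v \<in> V - {v0} then f (parent v) @ [l v] else [])"

lemma path_simps:
  "path v = (if v \<in> V - {v0} then path (parent v) @ [l v] else [])"
  unfolding path_def by (subst wfrec[OF wf_parent]) (auto simp: cut_def)

lemma path_walk: "v \<in> V \<Longrightarrow> letters (path v) \<subseteq> E \<and> walk src tgt v0 (path v) v"
proof (induction v rule: wf_induct_rule[OF wf_parent])
  case (1 v)
  show ?case
  proof (cases "v = v0")
    case True
    then show ?thesis by (simp add: path_simps[of v0])
  next
    case False
    with 1 start[of v] have "letters (path (parent v)) \<subseteq> E \<and> walk src tgt v0 (path (parent v)) (parent v)"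
      by blast
    with False 1 edge[of v] end_[of v] show ?thesis by (auto simp: path_simps[of v] walk_append)
  qed
qed

text \<open>
  The path to v is l v preceded by the path to the parent of v; if the latter is already a relator, then
  l v may be replaced by the path to v.  The vertices are treated by increasing length of
  their paths.
\<close>

theorem edges_to_paths:
  assumes "over (E, R)"
  shows "(E, letter_relators edges + R) \<sim>\<^sub>Q (E, image_mset path (mset_set (V - {v0})) + R)"
proof -
  define U where "U = V - {v0}"
  have U: "finite U" using finite_V by (simp add: U_def)
  have lE: "fst (l v) \<in> E" if "v \<in> U" for v using edge that by (simp add: U_def)
  have over: "over (E, image_mset (\<lambda>v. [l v]) (mset_set U) + R)" using assms lE U by auto
  have "(E, image_mset (\<lambda>v. [l v]) (mset_set U) + R) \<sim>\<^sub>Q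
      (E, image_mset (\<lambda>v. [l v]) (mset_set (U - A)) + (image_mset path (mset_set A) + R))"
    if "finite A" "A \<subseteq> U" "\<And>v. v \<in> A \<Longrightarrow> parent v \<in> insert v0 A" for A
    using that
  \<comment> \<open>A consists of the vertices whose edges are already replaced by paths; it is closed under parents.\<close>
  proof (induction A rule: finite_ranking_induct[where f = "\<lambda>v. length (path v)"])
    case empty
    from pres_equiv.refl[OF over] show ?case by simp
  next
    case (insert v A)
    show ?case
    proof (cases "v \<in> A")
      case True
      then show ?thesis using insert by (simp add: insert_absorb)
    next
      case False
      have v: "v \<in> V - {v0}" using insert by (simp add: U_def)
      have "parent w \<noteq> v" if "w \<in> A" for w
      proof
        assume "parent w = v"
        moreover have "w \<in> V - {v0}" using insert.prems that by (auto simp: U_def)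
        ultimately have "path w = path v @ [l w]" using path_simps[of w] by simp
        with insert.hyps(2)[OF that] show False by simp
      qed
      then have closed: "parent w \<in> insert v0 A" if "w \<in> A" for w
        using insert that by blast
      have "path v = path (parent v) @ [l v]" using path_simps[of v] v by simp
      then have "parent v \<noteq> v" by (metis append_self_conv not_Cons_self2)
      then have pv: "parent v \<in> insert v0 A" using insert by blast
      let ?N = "image_mset (\<lambda>v. [l v]) (mset_set (U - insert v A)) + (image_mset path (mset_set A) + R)"
      have split: "mset_set (U - A) = add_mset v (mset_set (U - insert v A))"
        using v False U by (metis Diff_iff Diff_insert U_def finite_Diff mset_set.remove)
      have "(E, image_mset (\<lambda>v. [l v]) (mset_set U) + R) \<sim>\<^sub>Q (E, add_mset [l v] ?N)"
        using insert closed by (simp add: split)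
      also have "\<dots> \<sim>\<^sub>Q (E, add_mset (path v) ?N)"
      proof (rule replace_relator)
        show "over (E, ?N)" using pres_equiv_over[OF calculation] by simp
        have lv: "letters [l v] \<subseteq> E" using edge[OF v] by simp
        show "rel_eq E (set_mset ?N) [l v] (path v)"
        proof (cases "parent v = v0")
          case True
          then have "path v = [l v]" using v path_simps[of v0] by (simp add: path_simps[of v])
          with lv show ?thesis by (auto intro: rel_eq.free)
        next
          case False
          then have "path (parent v) \<in># ?N" using pv insert(1) by simp
          then show ?thesis
            using rel_eq.relator[of "path (parent v)" "set_mset ?N" "[]" "[l v]" E] lv v
              path_walk[OF start[OF v]] by (simp add: path_simps[of v] rel_eq.sym)
        qed
      qed
      finally show ?thesis using False insert(1) by simp
    qed
  qed
  from this[OF U subset_refl] start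
  have to_paths: "(E, image_mset (\<lambda>v. [l v]) (mset_set U) + R) \<sim>\<^sub>Q
      (E, image_mset path (mset_set U) + R)"
    by (simp add: U_def)
  have "(E, image_mset (\<lambda>v. [l v]) (mset_set U) + R) \<sim>\<^sub>Q
      (E, image_mset (\<lambda>v. [(fst (l v), True)]) (mset_set U) + R)"
  proof (rule replace_all_akin)
    show "over (E, image_mset (\<lambda>v. [l v]) (mset_set U) + R)" by (rule over)
    fix v assume "v \<in># mset_set U"
    then have "fst (l v) \<in> E" using U lE by simp
    then show "akin E [l v] [(fst (l v), True)]"
      unfolding akin_def
      by (cases "l v"; cases "snd (l v)"; intro conjI exI[of _ "[]"]) (auto simp: word_inv_letter)
  qed
  also have "image_mset (\<lambda>v. [(fst (l v), True)]) (mset_set U) = letter_relators edges"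
    using inj by (simp add: edges_def U_def multiset.map_comp o_def flip: image_mset_mset_set)
  finally show ?thesis
    using pres_equiv.trans[OF pres_equiv.sym to_paths] unfolding U_def by blast
qed

end

theorem change_of_tree:
  assumes T: "rooted_tree src tgt E V v0 l" and T': "rooted_tree src tgt E V v0 l'"
    and E: "finite E" and disjoint: "E \<inter> V = {}"
    and W: "\<And>w. w \<in># W \<Longrightarrow> letters w \<subseteq> E \<and> (\<exists>u\<in>V. walk src tgt u w u)"
    and ends: "\<And>e. e \<in> E \<Longrightarrow> src e \<in> V \<and> tgt e \<in> V"
  shows "(E, letter_relators (rooted_tree.edges V v0 l) + W) \<sim>\<^sub>Q
    (E, letter_relators (rooted_tree.edges V v0 l') + W)"
proof -
  interpret T: rooted_tree src tgt E V v0 l by fact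
  interpret T': rooted_tree src tgt E V v0 l' by fact
  have over: "over (E, W)" using E W by auto
  note T.edges_to_paths[OF over]
  also have "(E, image_mset T.path (mset_set (V - {v0})) + W) \<sim>\<^sub>Q
      (E, image_mset T'.path (mset_set (V - {v0})) + W)"
    using T.path_walk T'.path_walk W ends
    by (intro change_of_paths[OF E T.finite_V disjoint T.root]) auto
  also note pres_equiv.sym[OF T'.edges_to_paths[OF over]]
  finally show ?thesis .
qed


section \<open>Eliminating the matched pairs in any order\<close>

definition occ :: "'a \<Rightarrow> 'a word \<Rightarrow> nat" where
  "occ x w = length (filter (\<lambda>l. fst l = x) w)"

lemma occ_simps [simp]:
  "occ x [] = 0" "occ x (l # w) = (if fst l = x then Suc (occ x w) else occ x w)"
  "occ x (u @ v) = occ x u + occ x v"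
  by (auto simp: occ_def)

lemma occ_word_inv [simp]: "occ x (word_inv w) = occ x w"
  by (induction w) (auto simp: word_inv_Cons)

lemma occ_0_iff: "occ x w = 0 \<longleftrightarrow> x \<notin> letters w"
  by (induction w) auto

lemma occ_rewrite_word:
  "y \<noteq> x \<Longrightarrow> occ y (rewrite_word x u w) = occ y w + occ x w * occ y u"
  by (induction w) (auto simp: rewrite_word_def)

lemma letters_rewrite_word:
  "letters (rewrite_word x u w) \<subseteq> (letters w - {x}) \<union> (if x \<in> letters w then letters u else {})"
  by (auto simp: rewrite_word_eq_subst letters_subst split: if_splits)

lemma occ_1E:
  assumes "occ x r = 1"
  obtains w1 b w2 where "r = w1 @ [(x, b)] @ w2" "x \<notin> letters w1" "x \<notin> letters w2"
proof -
  have "x \<in> letters r" using assms by (metis occ_0_iff zero_neq_one)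
  then obtain b where "(x, b) \<in> set r" by (auto simp: letters_def)
  then obtain w1 w2 where r: "r = w1 @ (x, b) # w2" by (meson split_list)
  with assms have "occ x w1 = 0" "occ x w2 = 0" by auto
  with r show ?thesis using that by (simp add: occ_0_iff)
qed

lemma unique_letter_split:
  assumes "w1 @ [(x, b)] @ w2 = w1' @ [(x, b')] @ w2'" "x \<notin> letters w1" "x \<notin> letters w1'"
  shows "w1 = w1' \<and> b = b' \<and> w2 = w2'"
proof -
  have *: "takeWhile (\<lambda>l. fst l \<noteq> x) (w @ [(x, c)] @ w') = w" if "x \<notin> letters w" for w c w'
    using that by (induction w) auto
  have "w1 = w1'" using *[OF assms(2), of b w2] *[OF assms(3), of b' w2'] assms(1) by metis
  then show ?thesis using assms(1) by simp
qed

text \<open>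
  The decomposition of a word around its only letter x is unique.
\<close>

lemma induced_expression_eq:
  assumes "x \<notin> letters w1" "x \<notin> letters w2"
  shows "induced_expression x (w1 @ [(x, b)] @ w2) = solve_for w1 b w2"
  unfolding induced_expression_def letters_def[symmetric]
proof (rule the_equality)
  show "\<exists>w1' b' w2'. w1 @ [(x, b)] @ w2 = w1' @ [(x, b')] @ w2' \<and> x \<notin> letters w1' \<and> x \<notin> letters w2' \<and>
      solve_for w1 b w2 = (if b' then word_inv w1' @ word_inv w2' else word_inv (word_inv w1' @ word_inv w2'))"
    using assms unfolding solve_for_def by blast
  fix u assume "\<exists>w1' b' w2'. w1 @ [(x, b)] @ w2 = w1' @ [(x, b')] @ w2' \<and> x \<notin> letters w1' \<and> x \<notin> letters w2' \<and>
      u = (if b' then word_inv w1' @ word_inv w2' else word_inv (word_inv w1' @ word_inv w2'))"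
  then show "u = solve_for w1 b w2"
    using unique_letter_split[of w1 x b w2] assms(1) unfolding solve_for_def by blast
qed

definition of_labelled :: "'c labelled_presentation \<Rightarrow> 'c pres" where
  "of_labelled L = (fst L, image_mset (\<lambda>e. the (snd L e)) (mset_set (dom (snd L))))"

text \<open>
  The invariant that allows the pairs in S to be eliminated in any order; D is meant to be a strict
  order, which excludes that the generators of two pairs occur in each other's relators.
\<close>

definition eliminable :: "('c \<times> 'c) set \<Rightarrow> ('c \<times> 'c) set \<Rightarrow> ('c \<rightharpoonup> 'c word) \<Rightarrow> bool" where
  "eliminable D S R \<longleftrightarrow> (\<forall>(x, e)\<in>S. e \<in> dom R \<and> occ x (the (R e)) = 1 \<and>
     (\<forall>(x', e')\<in>S. e' \<noteq> e \<longrightarrow> x' \<in> letters (the (R e)) \<longrightarrow> (e, e') \<in> D))"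

lemma eliminate_equiv:
  assumes over: "over (of_labelled (X, R))" and fin: "finite (dom R)"
    and e: "e \<in> dom R" and x: "occ x (the (R e)) = 1"
  shows "of_labelled (X, R) \<sim>\<^sub>Q of_labelled (eliminate (x, e) (X, R))"
proof -
  obtain w1 b w2 where r: "the (R e) = w1 @ [(x, b)] @ w2" "x \<notin> letters w1" "x \<notin> letters w2"
    using occ_1E[OF x] .
  define u where "u = solve_for w1 b w2"
  have u: "induced_expression x (the (R e)) = u"
    unfolding r u_def by (rule induced_expression_eq) fact+
  let ?S = "image_mset (\<lambda>f. the (R f)) (mset_set (dom R - {e}))"
  have split: "of_labelled (X, R) = (X, add_mset (the (R e)) ?S)"
    using mset_set.remove[OF fin e] by (simp add: of_labelled_def)
  have "(X, add_mset (the (R e)) ?S) \<sim>\<^sub>Q (X - {x}, image_mset (rewrite_word x u) ?S)"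
    unfolding r u_def using over r split by (intro eliminate_generator) auto
  also have "\<dots> = of_labelled (eliminate (x, e) (X, R))"
  proof -
    have "dom (snd (eliminate (x, e) (X, R))) = dom R - {e}" by (auto split: if_splits)
    moreover have "image_mset (rewrite_word x u) ?S =
        image_mset (\<lambda>f. the (snd (eliminate (x, e) (X, R)) f)) (mset_set (dom R - {e}))"
      using fin by (auto simp: multiset.map_comp u intro!: image_mset_cong) 
    ultimately show ?thesis by (simp add: of_labelled_def)
  qed
  finally show ?thesis by (simp add: split)
qed

text \<open>
  When x is replaced in the relator of e' by letters of the relator of e, then e' is smaller than e.
  A letter x' that this brings into the relator of e' belongs to an e'' above e, hence above e', so the
  relator of e' does not gain a second occurrence of its own x'.
\<close>

lemma eliminable_eliminate:
  assumes el: "eliminable D (insert (x, e) S) R" and "trans D" and irrefl: "\<And>a. (a, a) \<notin> D"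
    and distinct: "\<And>x' e'. (x', e') \<in> S \<Longrightarrow> x' \<noteq> x \<and> e' \<noteq> e"
  shows "eliminable D S (snd (eliminate (x, e) (X, R)))"
proof -
  have xe: "e \<in> dom R" "occ x (the (R e)) = 1" using el by (auto simp: eliminable_def)
  obtain w1 b w2 where r: "the (R e) = w1 @ [(x, b)] @ w2" "x \<notin> letters w1" "x \<notin> letters w2"
    using occ_1E[OF xe(2)] .
  define u where "u = induced_expression x (the (R e))"
  have u: "u = solve_for w1 b w2"
    unfolding u_def r by (rule induced_expression_eq) fact+
  have occ_u: "occ y u = occ y (the (R e))" if "y \<noteq> x" for y
    using that by (simp add: u r(1) solve_for_def)
  have letters_u: "letters u \<subseteq> letters (the (R e))"
    by (auto simp: u r(1) solve_for_def)
  have new: "the (snd (eliminate (x, e) (X, R)) f) = rewrite_word x u (the (R f))"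
    "f \<in> dom (snd (eliminate (x, e) (X, R)))" if "f \<in> dom R" "f \<noteq> e" for f
    using that by (auto simp: u_def)
  have D_e: "(e', e) \<in> D" if "(x', e') \<in> S" "x \<in> letters (the (R e'))" for x' e'
    using el that distinct[OF that(1)] by (fastforce simp: eliminable_def)
  have D_S: "(e', e'') \<in> D" if "(x', e') \<in> insert (x, e) S" "(x'', e'') \<in> S" "e'' \<noteq> e'" "x'' \<in> letters (the (R e'))"
    for x' e' x'' e'' using el that by (fastforce simp: eliminable_def)
  show ?thesis
    unfolding eliminable_def
  proof (safe, goal_cases)
    case (1 x' e')
    have "e' \<in> dom R" using el 1 by (auto simp: eliminable_def)
    then show ?case using new(2)[of e'] distinct[OF 1] by blast
  next
    case (2 x' e')
    have e': "e' \<in> dom R" "occ x' (the (R e')) = 1" using el 2 by (auto simp: eliminable_def)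
    have "occ x (the (R e')) = 0 \<or> occ x' u = 0"
    proof (rule ccontr)
      assume "\<not> ?thesis"
      then have "x \<in> letters (the (R e'))" "x' \<in> letters (the (R e))"
        using occ_u[of x'] distinct[OF 2] by (auto simp: occ_0_iff)
      then have "(e', e) \<in> D" "(e, e') \<in> D"
        using D_e[OF 2] D_S[of x e x' e'] 2 distinct[OF 2] by auto
      then show False using \<open>trans D\<close> irrefl by (meson transD)
    qed
    then show ?case using new(1)[of e'] e' distinct[OF 2] by (simp add: occ_rewrite_word)
  next
    case (3 x' e' x'' e'')
    have e': "e' \<in> dom R" using el 3 by (auto simp: eliminable_def)
    have "x'' \<in> letters (the (R e')) \<or> x \<in> letters (the (R e')) \<and> x'' \<in> letters (the (R e))"
      using 3 new(1)[OF e'] distinct[OF 3(1)] letters_rewrite_word[of x u "the (R e')"] letters_u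
      by (auto split: if_splits)
    then show ?case
      using D_S[of x' e' x'' e''] D_S[of x e x'' e''] D_e[of x' e'] 3 distinct[of x'' e''] \<open>trans D\<close>
      by (metis insertCI transD)
  qed
qed

theorem fold_eliminate_equiv:
  assumes "over (of_labelled L)" "finite (dom (snd L))" "eliminable D (set ps) (snd L)"
    and "trans D" "\<And>a. (a, a) \<notin> D" "distinct (map fst ps)" "distinct (map snd ps)"
  shows "of_labelled L \<sim>\<^sub>Q of_labelled (fold eliminate ps L)"
  using assms
proof (induction ps arbitrary: L)
  case Nil
  then show ?case by (auto intro: pres_equiv.refl)
next
  case (Cons p ps)
  obtain x e where p: "p = (x, e)" by fastforce
  obtain X R where L: "L = (X, R)" by fastforce
  let ?L = "eliminate p L"
  have step: "of_labelled L \<sim>\<^sub>Q of_labelled ?L"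
    unfolding p L using Cons.prems L p by (intro eliminate_equiv) (auto simp: eliminable_def)
  also have "\<dots> \<sim>\<^sub>Q of_labelled (fold eliminate ps ?L)"
  proof (rule Cons.IH)
    show "over (of_labelled ?L)" using pres_equiv_over[OF step] by blast
    show "finite (dom (snd ?L))"
      using Cons.prems(2) by (rule rev_finite_subset) (auto simp: p L split: if_splits)
    show "eliminable D (set ps) (snd ?L)"
      unfolding p L using Cons.prems p L by (intro eliminable_eliminate) force+
  qed (use Cons.prems in auto)
  finally show ?case by simp
qed


section \<open>Stars and triangles\<close>

text \<open>
  The end points of an edge are different, so a comparison of v with the source or the target decides
  the direction of the letter.
\<close>

definition leaving :: "('a \<Rightarrow> 'a) \<Rightarrow> 'a \<Rightarrow> 'a \<Rightarrow> 'a \<times> bool" where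
  "leaving src x v = (x, src x = v)"

definition arriving :: "('a \<Rightarrow> 'a) \<Rightarrow> 'a \<Rightarrow> 'a \<Rightarrow> 'a \<times> bool" where
  "arriving tgt x v = (x, tgt x = v)"

lemma fst_leaving [simp]: "fst (leaving src x v) = x"
  and fst_arriving [simp]: "fst (arriving tgt x v) = x"
  by (auto simp: leaving_def arriving_def)

lemma leaving_ends:
  assumes "{src x, tgt x} = {u, v}" "u \<noteq> v"
  shows "letter_start src tgt (leaving src x u) = u" "letter_end src tgt (leaving src x u) = v"
  using assms by (auto simp: leaving_def letter_start_def letter_end_def doubleton_eq_iff)

lemma arriving_ends:
  assumes "{src x, tgt x} = {u, v}" "u \<noteq> v"
  shows "letter_start src tgt (arriving tgt x v) = u" "letter_end src tgt (arriving tgt x v) = v"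
  using assms by (auto simp: arriving_def letter_start_def letter_end_def doubleton_eq_iff)

lemma flip_ends [simp]:
  "letter_start src tgt (apsnd Not l) = letter_end src tgt l"
  "letter_end src tgt (apsnd Not l) = letter_start src tgt l"
  by (cases l; simp add: letter_start_def letter_end_def)+

text \<open>
  A star with centre ctr is a tree for every choice of the root v0.  If v0 is not the centre, then the
  letter of the centre runs along the edge from v0, which is the edge of the vertex v0 of the star.
\<close>

lemma star_tree:
  assumes V: "finite V" "ctr \<in> V" "v0 \<in> V"
    and f: "\<And>v. v \<in> V - {ctr} \<Longrightarrow> f v \<in> E \<and> {src (f v), tgt (f v)} = {ctr, v}"
    and inj: "inj_on f (V - {ctr})"
  obtains l where "rooted_tree src tgt E V v0 l" "rooted_tree.edges V v0 l = f ` (V - {ctr})"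
proof -
  define l where "l v = (if v = ctr then arriving tgt (f v0) ctr else arriving tgt (f v) v)" for v
  have l_c: "letter_start src tgt (l ctr) = v0" "letter_end src tgt (l ctr) = ctr" "fst (l ctr) = f v0" if "v0 \<noteq> ctr"
    using f[of v0] that V arriving_ends[of src "f v0" tgt v0 ctr] by (auto simp: l_def insert_commute)
  have l_v: "letter_start src tgt (l v) = ctr" "letter_end src tgt (l v) = v" "fst (l v) = f v"
    if "v \<in> V" "v \<noteq> ctr" for v
    using f[of v] that arriving_ends[of src "f v" tgt ctr v] by (auto simp: l_def)
  have edges: "(\<lambda>v. fst (l v)) ` (V - {v0}) = f ` (V - {ctr})"
  proof (cases "v0 = ctr")
    case True
    then show ?thesis using l_v by (intro image_cong) auto
  next
    case False
    have "(\<lambda>v. fst (l v)) ` (V - {v0}) = insert (fst (l ctr)) ((\<lambda>v. fst (l v)) ` (V - {v0, ctr}))"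
      using False V by blast
    also have "(\<lambda>v. fst (l v)) ` (V - {v0, ctr}) = f ` (V - {v0, ctr})"
      using l_v by (intro image_cong) auto
    also have "insert (fst (l ctr)) (f ` (V - {v0, ctr})) = f ` (V - {ctr})"
      using False V l_c(3) by auto
    finally show ?thesis .
  qed
  have tree: "rooted_tree src tgt E V v0 l"
  proof
    \<comment> \<open>The levels are the root, the centre if it is not the root, and the other vertices.\<close>
    show "acyclic {(letter_start src tgt (l v), v) |v. v \<in> V - {v0}}"
    proof (rule wf_acyclic, rule wf_subset[OF wf_measure])
      show "{(letter_start src tgt (l v), v) |v. v \<in> V - {v0}}
          \<subseteq> Wellfounded.measure (\<lambda>v. if v = v0 then 0 else if v = ctr then 1 else 2)"
      proof (rule subsetI)
        fix p assume "p \<in> {(letter_start src tgt (l v), v) |v. v \<in> V - {v0}}"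
        then obtain v where "p = (letter_start src tgt (l v), v)" "v \<in> V" "v \<noteq> v0" by blast
        then show "p \<in> Wellfounded.measure (\<lambda>v. if v = v0 then 0 else if v = ctr then 1 else 2)"
          using l_c(1) l_v(1)[of v] by (cases "v = ctr") auto
      qed
    qed
    show "inj_on (\<lambda>v. fst (l v)) (V - {v0})"
    proof (rule eq_card_imp_inj_on)
      have "card (V - {v0}) = card (V - {ctr})" using V by simp
      then show "card ((\<lambda>v. fst (l v)) ` (V - {v0})) = card (V - {v0})"
        unfolding edges using inj by (simp add: card_image)
    qed (use V in simp)
    fix v assume v: "v \<in> V - {v0}"
    then show "fst (l v) \<in> E" using l_c(3) l_v(3)[of v] f[of v] f[of v0] V by (cases "v = ctr") auto
    show "letter_start src tgt (l v) \<in> V" using v l_c(1) l_v(1)[of v] V by (cases "v = ctr") auto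
    show "letter_end src tgt (l v) = v" using v l_c(2) l_v(2)[of v] by (cases "v = ctr") auto
  qed (use V in auto)
  show ?thesis
    using that[OF tree] edges by (simp add: rooted_tree.edges_def[OF tree])
qed

lemma akin_rotate: "letters (u @ v) \<subseteq> X \<Longrightarrow> akin X (u @ v) (v @ u)"
  unfolding akin_def using cancel_context[of "v @ u" v "[]"]
  by (intro conjI exI[of _ v]) auto

lemma akin_rotate_inv:
  assumes "letters (u @ v) \<subseteq> X" shows "akin X (word_inv (u @ v)) (v @ u)"
proof -
  have "akin X (u @ v) (v @ u)" using assms by (rule akin_rotate)
  then show ?thesis by (auto simp: akin_def simp del: word_inv_append)
qed

text \<open>
  A closed path that uses each side of a triangle once is the boundary of the triangle, up to the
  starting point and the direction.
\<close>

lemma triangle_walk: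
  assumes walk: "walk src tgt v w v" and dist: "distinct (map fst w)"
    and lets: "letters w = {fst a, fst b, fst c}" and abc: "fst a \<noteq> fst b" "fst b \<noteq> fst c" "fst a \<noteq> fst c"
    and ends: "letter_end src tgt a = letter_start src tgt b" "letter_end src tgt b = letter_start src tgt c"
      "letter_end src tgt c = letter_start src tgt a"
    and pqr: "letter_start src tgt a \<noteq> letter_start src tgt b" "letter_start src tgt b \<noteq> letter_start src tgt c"
      "letter_start src tgt a \<noteq> letter_start src tgt c"
    and X: "letters [a, b, c] \<subseteq> X"
  shows "akin X w [a, b, c]"
proof -
  have "length w = card (letters w)"
    using distinct_card[OF dist] by (simp add: letters_def)
  also have "\<dots> = 3" using abc by (simp add: lets)
  finally obtain l1 l2 l3 where w: "w = [l1, l2, l3]" by (auto simp: numeral_3_eq_3 length_Suc_conv)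
  have flip: "l = m \<or> l = apsnd Not m" if "fst l = fst m" for l m :: "'a \<times> bool"
    using that by (cases l; cases m) auto
  have fl: "apsnd Not l \<noteq> l" "fst (apsnd Not l) = fst l" for l :: "'a \<times> bool"
    by (cases l; auto)+
  have "\<forall>l\<in>{l1, l2, l3}. fst l \<in> {fst a, fst b, fst c}" using lets w by auto
  then have opts: "\<forall>l\<in>{l1, l2, l3}. l \<in> {a, apsnd Not a, b, apsnd Not b, c, apsnd Not c}"
    using flip by blast
  let ?a = "apsnd Not a" and ?b = "apsnd Not b" and ?c = "apsnd Not c"
  have joints: "letter_end src tgt l1 = letter_start src tgt l2" "letter_end src tgt l2 = letter_start src tgt l3"
    "letter_end src tgt l3 = letter_start src tgt l1"
    using walk unfolding w by auto
  have dists: "fst l1 \<noteq> fst l2" "fst l2 \<noteq> fst l3" "fst l1 \<noteq> fst l3"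
    using dist unfolding w by auto
  have l1: "l1 \<in> {a, ?a, b, ?b, c, ?c}" and l2: "l2 \<in> {a, ?a, b, ?b, c, ?c}" and l3: "l3 \<in> {a, ?a, b, ?b, c, ?c}"
    using opts by auto
  have "w \<in> {[a, b, c], [b, c, a], [c, a, b], [?c, ?b, ?a], [?b, ?a, ?c], [?a, ?c, ?b]}"
    unfolding w using l1 l2 l3 joints dists
    by (elim insertE emptyE; simp add: fl abc abc[symmetric] ends pqr pqr[symmetric])
  then show ?thesis
    using akin_rotate[of "[]" "[a, b, c]" X] akin_rotate[of "[b, c]" "[a]" X] akin_rotate[of "[c]" "[a, b]" X]
      akin_rotate_inv[of "[]" "[a, b, c]" X] akin_rotate_inv[of "[c]" "[a, b]" X] akin_rotate_inv[of "[b, c]" "[a]" X] X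
    by (auto simp: word_inv_Cons)
qed


section \<open>Collapsing a cone\<close>

text \<open>
  The triangles of a cone over a circle are \<open>sp j, s j, (sp (j + 1))\<inverse>\<close>, with the spokes \<open>sp j\<close> directed
  away from the apex and with the letters \<open>s j\<close> of the rim.  If one triangle is missing, then the last
  spoke occurs in one relator only.
\<close>

lemma peel_spokes:
  assumes over: "over (X, R)" and new: "inj_on (\<lambda>j. fst (sp j)) {..k}" "\<And>j. j \<le> k \<Longrightarrow> fst (sp j) \<notin> X"
    and s: "\<And>j. j < k \<Longrightarrow> fst (s j) \<in> X"
  shows "(X \<union> (\<lambda>j. fst (sp j)) ` {..k}, image_mset (\<lambda>j. [sp j, s j, apsnd Not (sp (Suc j))]) (mset_set {..<k}) +
      add_mset [(fst (sp 0), True)] R) \<sim>\<^sub>Q (X, R)"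
  using new s
proof (induction k)
  case 0
  then show ?case
    using eliminate_pendant[OF over, of "fst (sp 0)" "[]" "[]" True] by simp
next
  case (Suc k)
  let ?Y = "X \<union> (\<lambda>j. fst (sp j)) ` {..k}"
  let ?S = "image_mset (\<lambda>j. [sp j, s j, apsnd Not (sp (Suc j))]) (mset_set {..<k}) + add_mset [(fst (sp 0), True)] R"
  have IH: "(?Y, ?S) \<sim>\<^sub>Q (X, R)"
    using Suc.prems by (intro Suc.IH) (auto intro: inj_on_subset)
  have fresh: "fst (sp (Suc k)) \<notin> ?Y" using Suc.prems(1,2) by (auto dest: inj_onD)
  have "(insert (fst (sp (Suc k))) ?Y, add_mset ([sp k, s k] @ [(fst (sp (Suc k)), \<not> snd (sp (Suc k)))] @ []) ?S) \<sim>\<^sub>Q (?Y, ?S)"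
    using fresh pres_equiv_over[OF IH] Suc.prems(3)[of k] by (intro eliminate_pendant) auto
  also note IH
  also have "insert (fst (sp (Suc k))) ?Y = X \<union> (\<lambda>j. fst (sp j)) ` {..Suc k}" by (auto simp: atMost_Suc)
  also have "add_mset ([sp k, s k] @ [(fst (sp (Suc k)), \<not> snd (sp (Suc k)))] @ []) ?S =
      image_mset (\<lambda>j. [sp j, s j, apsnd Not (sp (Suc j))]) (mset_set {..<Suc k}) + add_mset [(fst (sp 0), True)] R"
    by (cases "sp (Suc k)") (simp add: lessThan_Suc)
  finally show ?case .
qed

text \<open>
  Modulo the triangles before the last one, \<open>sp k\<close> equals \<open>sp 0\<close> followed by the first k letters of
  the rim.  This turns the last triangle into a conjugate of the word of the rim, which is free of spokes,
  and the remaining triangles can be peeled off.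
\<close>

lemma collapse_cone:
  assumes over: "over (X, R)" and L: "0 < L" and cyclic: "sp L = sp 0"
    and new: "inj_on (\<lambda>j. fst (sp j)) {..<L}" "\<And>j. j < L \<Longrightarrow> fst (sp j) \<notin> X"
    and s: "\<And>j. j < L \<Longrightarrow> fst (s j) \<in> X"
  shows "(X \<union> (\<lambda>j. fst (sp j)) ` {..<L}, image_mset (\<lambda>j. [sp j, s j, apsnd Not (sp (Suc j))]) (mset_set {..<L}) +
      add_mset [(fst (sp 0), True)] R) \<sim>\<^sub>Q (X, add_mset (map s [0..<L]) R)"
proof -
  obtain k where k: "L = Suc k" using L by (cases L) auto
  let ?Y = "X \<union> (\<lambda>j. fst (sp j)) ` {..<L}"
  let ?t = "\<lambda>j. [sp j, s j, apsnd Not (sp (Suc j))]"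
  let ?N = "image_mset ?t (mset_set {..<k}) + add_mset [(fst (sp 0), True)] R"
  have Y: "fst (sp j) \<in> ?Y" "fst (s j) \<in> ?Y" if "j < L" for j using that s by auto
  have Y': "fst (sp (Suc j)) \<in> ?Y" if "j < L" for j
    using that cyclic L Y(1)[of 0] Y(1)[of "Suc j"] by (cases "Suc j = L") auto
  have flip: "fst (apsnd Not l) = fst l" for l :: "'a \<times> bool" by (cases l) auto
  have path: "rel_eq ?Y (set_mset ?N) [sp j] ([sp 0] @ map s [0..<j])" if "j \<le> k" for j
    using that
  proof (induction j)
    case 0
    then show ?case using Y[of 0] L by (auto intro: rel_eq.free)
  next
    case (Suc j)
    then have j: "j < L" "Suc j < L" using k by auto
    have "rel_eq ?Y (set_mset ?N) [sp (Suc j)] (?t j @ [sp (Suc j)])"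
      using rel_eq.relator[of "?t j" "set_mset ?N" "[]" "[sp (Suc j)]" ?Y] Suc.prems Y[OF j(1)] Y(1)[OF j(2)]
      by (auto simp: flip intro!: rel_eq.sym)
    also have "rel_eq ?Y (set_mset ?N) \<dots> ([sp j, s j])"
      using cancel_context'[of "[sp j, s j]" "[sp (Suc j)]" "[]"] Y[OF j(1)] Y(1)[OF j(2)]
      by (intro rel_eq.free) (auto simp: flip word_inv_Cons)
    also have "rel_eq ?Y (set_mset ?N) ([] @ [sp j] @ [s j]) ([] @ ([sp 0] @ map s [0..<j]) @ [s j])"
      using Suc Y[OF j(1)] by (intro rel_eq_context) auto
    then have "rel_eq ?Y (set_mset ?N) [sp j, s j] ([sp 0] @ map s [0..<Suc j])" by simp
    finally show ?case .
  qed
  let ?rim = "map s [0..<L]"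
  have overY: "over (?Y, ?N)"
    using over L Y Y' k s by (fastforce simp: flip)
  have "(?Y, image_mset ?t (mset_set {..<L}) + add_mset [(fst (sp 0), True)] R) = (?Y, add_mset (?t k) ?N)"
    by (simp add: k lessThan_Suc)
  also have "\<dots> \<sim>\<^sub>Q (?Y, add_mset ([sp 0] @ ?rim @ [apsnd Not (sp 0)]) ?N)"
  proof (rule replace_relator[OF _ overY])
    have "rel_eq ?Y (set_mset ?N) ([] @ [sp k] @ [s k, apsnd Not (sp L)]) ([] @ ([sp 0] @ map s [0..<k]) @ [s k, apsnd Not (sp L)])"
      using Y[of k] Y'[of k] k by (intro rel_eq_context path) (auto simp: flip)
    then show "rel_eq ?Y (set_mset ?N) (?t k) ([sp 0] @ ?rim @ [apsnd Not (sp 0)])"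
      by (simp add: k cyclic[unfolded k])
  qed
  also have "\<dots> \<sim>\<^sub>Q (?Y, add_mset ?rim ?N)"
  proof (rule replace_akin)
    show "over (?Y, add_mset ([sp 0] @ ?rim @ [apsnd Not (sp 0)]) ?N)"
      using pres_equiv_over[OF calculation] by blast
    have rim: "letters ?rim \<subseteq> X" using s by (auto simp: letters_def)
    have "word_inv [sp 0] @ ([sp 0] @ ?rim @ [apsnd Not (sp 0)]) @ word_inv (word_inv [sp 0]) \<simeq> ?rim"
      using cancel_context'[of "[]" "[sp 0]" "?rim @ word_inv [sp 0] @ [sp 0]"] cancel_context'[of ?rim "[sp 0]" "[]"]
      by (simp add: word_inv_Cons free_eq_def)
    then show "akin ?Y ([sp 0] @ ?rim @ [apsnd Not (sp 0)]) ?rim"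
      unfolding akin_def using rim Y[of 0] L by (intro conjI exI[of _ "word_inv [sp 0]"]) auto
  qed
  also have "\<dots> = (X \<union> (\<lambda>j. fst (sp j)) ` {..k}, image_mset ?t (mset_set {..<k}) + add_mset [(fst (sp 0), True)] (add_mset ?rim R))"
    by (simp add: k lessThan_Suc_atMost)
  also have "\<dots> \<sim>\<^sub>Q (X, add_mset ?rim R)"
  proof (rule peel_spokes)
    have "letters ?rim \<subseteq> X" using s by (auto simp: letters_def)
    with over show "over (X, add_mset ?rim R)" by simp
  qed (use new s k in \<open>auto simp: lessThan_Suc_atMost\<close>)
  finally show ?thesis .
qed


section \<open>The topology of the standard complex\<close>

locale standard =
  fixes n :: nat and rs :: "nat word list"
  assumes pres: "is_presentation (n, rs)"
begin

abbreviation \<tau> :: "kpoint topology" where "\<tau> \<equiv> standard_topology (n, rs)"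
abbreviation cl :: "kpoint set \<Rightarrow> kpoint set" where "cl S \<equiv> Abstract_Topology.closure_of \<tau> S"
abbreviation \<phi> :: "nat \<Rightarrow> complex \<Rightarrow> kpoint" where "\<phi> \<equiv> face_map rs"

lemma relator_letter:
  assumes "i < length rs" "k < length (rs ! i)" shows "fst (rs ! i ! k) < n"
proof -
  have "\<forall>r\<in>set rs. \<forall>l\<in>set r. fst l < n"
    using pres by (auto simp: is_presentation_def image_subset_iff)
  with assms show ?thesis by (meson nth_mem)
qed

lemma edge_map_ends [simp]: "edge_map g 0 = Vertex" "edge_map g 1 = Vertex"
  by (auto simp: edge_map_def)

text \<open>
  The defining condition is closed under intersections and unions, so it is the predicate of open sets.
\<close>

lemma openin_standard:
  "openin \<tau> U \<longleftrightarrow> U \<subseteq> standard_points (n, rs) \<and>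
     (\<forall>g<n. openin (top_of_set {0..1}) {t \<in> {0..1}. edge_map g t \<in> U}) \<and>
     (\<forall>i<length rs. openin (top_of_set (cball 0 1)) {z \<in> cball 0 1. \<phi> i z \<in> U})"
proof -
  let ?L = "\<lambda>U. U \<subseteq> standard_points (n, rs) \<and>
     (\<forall>g<fst (n, rs). openin (top_of_set {0..1}) {t \<in> {0..1}. edge_map g t \<in> U}) \<and>
     (\<forall>i<length (snd (n, rs)). openin (top_of_set (cball 0 1)) {z \<in> cball 0 1. face_map (snd (n, rs)) i z \<in> U})"
  have inter: "{x \<in> A. f x \<in> S \<inter> T} = {x \<in> A. f x \<in> S} \<inter> {x \<in> A. f x \<in> T}"
    and union: "{x \<in> A. f x \<in> \<Union>\<K>} = (\<Union>K\<in>\<K>. {x \<in> A. f x \<in> K})"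
    for A :: "'a set" and f :: "'a \<Rightarrow> 'b" and S T \<K>
    by auto
  have "istopology ?L"
    unfolding istopology_def inter union by (blast intro: openin_Int openin_Union)
  then show ?thesis
    unfolding standard_topology_def by (simp add: topology_inverse')
qed

lemma edge_map_in: "g < n \<Longrightarrow> edge_map g t \<in> standard_points (n, rs)"
  by (auto simp: edge_map_def standard_points_def)

lemma Arg2pi_cis: "0 \<le> a \<Longrightarrow> a < 2 * pi \<Longrightarrow> Arg2pi (cis a) = a"
  by (rule Arg2pi_unique[of 1]) (auto simp: cis_conv_exp)

text \<open>The letter number k is read while the angle runs from \<open>2 pi k / l\<close> to \<open>2 pi (k + 1) / l\<close>.\<close>

lemma face_map_arc:
  assumes k: "k < length (rs ! i)" and p: "real k \<le> p" "p \<le> real k + 1"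
  shows "\<phi> i (cis (2 * pi * p / length (rs ! i))) =
    edge_map (fst (rs ! i ! k)) (if snd (rs ! i ! k) then p - k else 1 - (p - k))"
proof -
  let ?w = "rs ! i" and ?l = "real (length (rs ! i))"
  obtain g b where gb: "?w ! k = (g, b)" by fastforce
  have l: "?l > 0" using k by auto
  have loop: "\<phi> i (cis a) = (let p = a / (2 * pi) * ?l; (g, b) = ?w ! nat \<lfloor>p\<rfloor> in edge_map g (if b then frac p else 1 - frac p))"
    if "0 \<le> a" "a < 2 * pi" for a
    using that l by (auto simp: face_map_def word_loop_def Arg2pi_cis mult.commute)
  consider "p < k + 1" | "p = k + 1" "k + 1 < length ?w" | "p = k + 1" "k + 1 = length ?w"
    using p k by linarith
  then show ?thesis
  proof cases
    case 1
    have "p < ?l" using 1 k by linarith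
    then have "2 * pi * p / ?l < 2 * pi" using l by (simp add: divide_less_eq)
    moreover have "\<lfloor>p\<rfloor> = int k" using 1 p by linarith
    ultimately show ?thesis
      using loop[of "2 * pi * p / ?l"] p l by (simp add: gb frac_def)
  next
    case 2
    have "2 * pi * p / ?l < 2 * pi" using l 2 by (simp add: divide_less_eq)
    moreover have "\<lfloor>p\<rfloor> = int (k + 1)" using 2 by linarith
    ultimately have "\<phi> i (cis (2 * pi * p / ?l)) = Vertex"
      using loop[of "2 * pi * p / ?l"] p l 2
      by (cases "?w ! nat (1 + int k)") (simp add: frac_def Let_def)
    then show ?thesis using 2 by (simp add: gb)
  next
    case 3
    then have "p = ?l" by linarith
    then have "2 * pi * p / ?l = 2 * pi" using l by simp
    moreover have "\<phi> i 1 = Vertex"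
      using loop[of 0] by (cases "?w ! 0") (simp add: Let_def)
    ultimately show ?thesis using 3 by (simp add: gb)
  qed
qed

lemma circle_arc:
  assumes "cmod z = 1" "w \<noteq> []"
  obtains k p where "k < length w" "real k \<le> p" "p \<le> real k + 1" "z = cis (2 * pi * p / length w)"
proof -
  define p where "p = Arg2pi z / (2 * pi) * length w"
  have a: "0 \<le> Arg2pi z" "Arg2pi z < 2 * pi" "z = cis (Arg2pi z)"
    using Arg2pi[of z] assms by (auto simp: is_Arg_def cis_conv_exp)
  have l: "real (length w) > 0" using assms by simp
  have p: "0 \<le> p" "p < length w"
    using a l by (auto simp: p_def divide_less_eq)
  show ?thesis
  proof (rule that[of "nat \<lfloor>p\<rfloor>" p])
    show "nat \<lfloor>p\<rfloor> < length w" using p by linarith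
    show "z = cis (2 * pi * p / length w)" using a l by (simp add: p_def)
  qed (use p in linarith)+
qed

lemma face_map_circle:
  assumes "cmod z = 1"
  shows "\<phi> i z = Vertex \<or> (\<exists>k<length (rs ! i). \<exists>t. \<phi> i z = edge_map (fst (rs ! i ! k)) t)"
proof (cases "rs ! i = []")
  case True
  then show ?thesis using assms by (simp add: face_map_def word_loop_def)
next
  case False
  obtain k p where "k < length (rs ! i)" "real k \<le> p" "p \<le> real k + 1" "z = cis (2 * pi * p / length (rs ! i))"
    using circle_arc[OF assms False] .
  with face_map_arc[of k i p] show ?thesis by blast
qed

lemma face_map_in: "i < length rs \<Longrightarrow> z \<in> cball 0 1 \<Longrightarrow> \<phi> i z \<in> standard_points (n, rs)"
proof (cases "cmod z < 1")
  case True
  then show "i < length rs \<Longrightarrow> ?thesis" by (auto simp: face_map_def standard_points_def)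
next
  case False
  assume "z \<in> cball 0 1" "i < length rs"
  moreover have "Vertex \<in> standard_points (n, rs)" by (simp add: standard_points_def)
  moreover have "cmod z = 1" using False \<open>z \<in> cball 0 1\<close> by simp
  ultimately show ?thesis
    using face_map_circle[of z i] relator_letter[of i] edge_map_in by metis
qed

lemma topspace_standard: "topspace \<tau> = standard_points (n, rs)"
proof
  have "{t \<in> {0..1}. edge_map g t \<in> standard_points (n, rs)} = {0..1}" if "g < n" for g
    using edge_map_in[OF that] by auto
  moreover have "{z \<in> cball 0 1. \<phi> i z \<in> standard_points (n, rs)} = cball 0 1" if "i < length rs" for i
    using face_map_in[OF that] by auto
  ultimately have "openin \<tau> (standard_points (n, rs))" by (simp add: openin_standard)
  then show "standard_points (n, rs) \<subseteq> topspace \<tau>" by (rule openin_subset)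
  show "topspace \<tau> \<subseteq> standard_points (n, rs)"
    using openin_topspace[of \<tau>] unfolding openin_standard by blast
qed

lemma continuous_edge_map: "g < n \<Longrightarrow> continuous_map (top_of_set {0..1}) \<tau> (edge_map g)"
  unfolding continuous_map_def
  by (auto simp: topspace_standard edge_map_in) (simp add: openin_standard)

lemma continuous_face_map: "i < length rs \<Longrightarrow> continuous_map (top_of_set (cball 0 1)) \<tau> (\<phi> i)"
  unfolding continuous_map_def topspace_standard
  using face_map_in openin_standard by auto

lemma closedin_standardI:
  assumes "C \<subseteq> standard_points (n, rs)"
    and "\<And>g. g < n \<Longrightarrow> closed {t \<in> {0..1}. edge_map g t \<in> C}"
    and "\<And>i. i < length rs \<Longrightarrow> closed {z \<in> cball 0 1. \<phi> i z \<in> C}"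
  shows "closedin \<tau> C"
proof -
  have edge: "{t \<in> {0..1}. edge_map g t \<in> standard_points (n, rs) - C} = {0..1} - {t \<in> {0..1}. edge_map g t \<in> C}"
    if "g < n" for g using edge_map_in[OF that] by auto
  have face: "{z \<in> cball 0 1. \<phi> i z \<in> standard_points (n, rs) - C} = cball 0 1 - {z \<in> cball 0 1. \<phi> i z \<in> C}"
    if "i < length rs" for i using face_map_in[OF that] by auto
  have diff: "openin (top_of_set A) (A - D)" if "closed D" for A D :: "'b :: topological_space set"
    using that openin_open_Int[of "- D" A] by (simp add: Diff_eq open_Compl)
  have "openin \<tau> (standard_points (n, rs) - C)"
    unfolding openin_standard
  proof (intro conjI allI impI)
    fix g assume "g < n"
    then show "openin (top_of_set {0..1}) {t \<in> {0..1}. edge_map g t \<in> standard_points (n, rs) - C}"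
      unfolding edge[OF \<open>g < n\<close>] by (intro diff assms(2))
  next
    fix i assume "i < length rs"
    then show "openin (top_of_set (cball 0 1)) {z \<in> cball 0 1. \<phi> i z \<in> standard_points (n, rs) - C}"
      unfolding face[OF \<open>i < length rs\<close>] by (intro diff assms(3))
  qed blast
  with assms(1) show ?thesis by (simp add: closedin_def topspace_standard)
qed

text \<open>
  On the boundary circle of a face, closedness is inherited from the edges: the circle is the union of
  finitely many compact arcs, each of which is mapped onto an edge at constant speed.
\<close>

lemma closed_circle_preimage:
  assumes C: "\<And>g. g < n \<Longrightarrow> closed {t \<in> {0..1}. edge_map g t \<in> C}" and i: "i < length rs"
  shows "closed {z. cmod z = 1 \<and> \<phi> i z \<in> C}"
proof (cases "rs ! i = []")
  case True
  then have "{z. cmod z = 1 \<and> \<phi> i z \<in> C} = (if Vertex \<in> C then sphere 0 1 else {})"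
    by (auto simp: face_map_def word_loop_def)
  then show ?thesis by simp
next
  case False
  let ?l = "length (rs ! i)"
  define time where "time k p = (if snd (rs ! i ! k) then p - real k else 1 - (p - real k))" for k p
  define D where "D k = {p \<in> {real k..real k + 1}. edge_map (fst (rs ! i ! k)) (time k p) \<in> C}" for k
  have "compact (D k)" if "k < ?l" for k
  proof -
    let ?T = "{t \<in> {0..1}. edge_map (fst (rs ! i ! k)) t \<in> C}"
    have "D k = {real k..real k + 1} \<inter> time k -` ?T"
      by (auto simp: D_def time_def)
    moreover have "continuous_on UNIV (time k)"
      unfolding time_def by (cases "snd (rs ! i ! k)") (auto intro!: continuous_intros)
    then have "closed (time k -` ?T)"
      using C[OF relator_letter[OF i that]] by (intro closed_vimage)
    ultimately show ?thesis by (simp add: compact_Int_closed)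
  qed
  moreover have "continuous_on A (\<lambda>p. cis (2 * pi * p / ?l))" for A
    by (intro continuous_intros) (use False in auto)
  ultimately have "compact ((\<lambda>p. cis (2 * pi * p / ?l)) ` D k)" if "k < ?l" for k
    using that by (blast intro: compact_continuous_image)
  then have "closed (\<Union>k<?l. (\<lambda>p. cis (2 * pi * p / ?l)) ` D k)"
    by (intro closed_UN) (auto intro: compact_imp_closed)
  also have "(\<Union>k<?l. (\<lambda>p. cis (2 * pi * p / ?l)) ` D k) = {z. cmod z = 1 \<and> \<phi> i z \<in> C}"
  proof (intro equalityI subsetI)
    fix z assume "z \<in> (\<Union>k<?l. (\<lambda>p. cis (2 * pi * p / ?l)) ` D k)"
    then obtain k p where "k < ?l" "p \<in> D k" "z = cis (2 * pi * p / ?l)" by blast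
    with face_map_arc[of k i p] show "z \<in> {z. cmod z = 1 \<and> \<phi> i z \<in> C}"
      by (simp add: D_def time_def)
  next
    fix z assume z: "z \<in> {z. cmod z = 1 \<and> \<phi> i z \<in> C}"
    obtain k p where "k < ?l" "real k \<le> p" "p \<le> real k + 1" "z = cis (2 * pi * p / ?l)"
      using circle_arc[of z "rs ! i"] z False by blast
    with face_map_arc[of k i p] z show "z \<in> (\<Union>k<?l. (\<lambda>p. cis (2 * pi * p / ?l)) ` D k)"
      by (auto simp: D_def time_def intro!: bexI[of _ k])
  qed
  finally show ?thesis .
qed

text \<open>
  Edge maps identify points only at the ends of the unit interval, which are all mapped to the vertex.
\<close>

lemma closed_edge_preimage:
  assumes "closed B" "B \<subseteq> {0..1}"
  shows "closed {t \<in> {0..1}. edge_map g' t \<in> edge_map g ` B}"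
proof -
  have eq: "edge_map g' t = edge_map g s \<longleftrightarrow> g' = g \<and> t = s \<or> t \<in> {0, 1} \<and> s \<in> {0, 1}"
    if "t \<in> {0..1}" "s \<in> {0..1}" for s t :: real
    using that unfolding edge_map_def by (cases "0 < t \<and> t < 1"; cases "0 < s \<and> s < 1") auto
  have "{t \<in> {0..1}. edge_map g' t \<in> edge_map g ` B} = {t \<in> {0..1}. \<exists>s\<in>B. edge_map g' t = edge_map g s}"
    by blast
  also have "\<dots> = {t \<in> {0..1}. \<exists>s\<in>B. g' = g \<and> t = s \<or> t \<in> {0, 1} \<and> s \<in> {0, 1}}"
    using eq assms(2) by (meson subset_iff)
  also have "\<dots> = (if g' = g then B else {}) \<union> (if 0 \<in> B \<or> 1 \<in> B then {0, 1} else {})"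
    using assms(2) by (cases "g' = g") auto
  finally have "{t \<in> {0..1}. edge_map g' t \<in> edge_map g ` B} =
    (if g' = g then B else {}) \<union> (if 0 \<in> B \<or> 1 \<in> B then {0, 1} else {})" .
  then show ?thesis using assms(1) by simp
qed

lemma closedin_edge_piece:
  assumes "g < n" "closed B" "B \<subseteq> {0..1}"
  shows "closedin \<tau> (edge_map g ` B)"
proof (rule closedin_standardI)
  fix i assume i: "i < length rs"
  have "{z \<in> cball 0 1. \<phi> i z \<in> edge_map g ` B} = {z. cmod z = 1 \<and> \<phi> i z \<in> edge_map g ` B}"
    by (auto simp: face_map_def edge_map_def split: if_splits)
  with closed_circle_preimage[OF closed_edge_preimage i] assms
  show "closed {z \<in> cball 0 1. \<phi> i z \<in> edge_map g ` B}" by simp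
next
  show "edge_map g ` B \<subseteq> standard_points (n, rs)" using edge_map_in[OF assms(1)] by blast
  show "closed {t \<in> {0..1}. edge_map g' t \<in> edge_map g ` B}" for g'
    by (rule closed_edge_preimage[OF assms(2,3)])
qed

text \<open>
  If the part of A on the rim is mapped into a closed piece of an edge, then the preimage of the set in
  the disc of its own face is A together with a part of the circle, and the preimage in any other disc
  is contained in the circle.
\<close>

lemma closedin_face_piece:
  assumes i: "i < length rs" and A: "compact A" "A \<subseteq> cball 0 1"
    and g: "g < n" and B: "closed B" "B \<subseteq> {0..1}"
    and rim: "\<phi> i ` (A \<inter> sphere 0 1) \<subseteq> edge_map g ` B"
  shows "closedin \<tau> (\<phi> i ` A \<union> edge_map g ` B)"
proof (rule closedin_standardI)
  let ?C = "\<phi> i ` A \<union> edge_map g ` B"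
  show "?C \<subseteq> standard_points (n, rs)" using face_map_in[OF i] edge_map_in[OF g] A(2) by blast
  have "edge_map g' t \<in> ?C \<longleftrightarrow> edge_map g' t \<in> edge_map g ` B" for g' t
  proof -
    have "edge_map g' t \<in> edge_map g ` B" if "z \<in> A" "edge_map g' t = \<phi> i z" for z
    proof (cases "cmod z < 1")
      case True
      then show ?thesis using that by (simp add: face_map_def edge_map_def split: if_splits)
    next
      case False
      then have "z \<in> A \<inter> sphere 0 1" using that A by (auto simp: dest: subsetD)
      then show ?thesis using that rim by auto
    qed
    then show ?thesis by auto
  qed
  then show closed: "closed {t \<in> {0..1}. edge_map g' t \<in> ?C}" if "g' < n" for g'
    using closed_edge_preimage[OF B, of g'] by simp
  fix j assume j: "j < length rs"
  have "{z \<in> cball 0 1. \<phi> j z \<in> ?C} = (if j = i then A else {}) \<union> {z. cmod z = 1 \<and> \<phi> j z \<in> ?C}"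
  proof (intro equalityI subsetI)
    fix z assume z: "z \<in> {z \<in> cball 0 1. \<phi> j z \<in> ?C}"
    show "z \<in> (if j = i then A else {}) \<union> {z. cmod z = 1 \<and> \<phi> j z \<in> ?C}"
    proof (cases "cmod z < 1")
      case True
      then have fp: "\<phi> j z = Face_Point j z" by (simp add: face_map_def)
      then have "\<phi> j z \<in> \<phi> i ` A" using z by (auto simp: edge_map_def split: if_splits)
      then obtain z' where z': "z' \<in> A" "\<phi> i z' = Face_Point j z" using fp by auto
      have "cmod z' < 1"
      proof (rule ccontr)
        assume "\<not> cmod z' < 1"
        then have "z' \<in> A \<inter> sphere 0 1" using z' A by (auto dest: subsetD)
        then have "Face_Point j z \<in> edge_map g ` B" using rim z' by force
        then show False by (auto simp: edge_map_def split: if_splits)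
      qed
      then show ?thesis using z' by (simp add: face_map_def)
    qed (use z in auto)
  qed (use A in \<open>auto split: if_splits\<close>)
  then show "closed {z \<in> cball 0 1. \<phi> j z \<in> ?C}"
    using closed_circle_preimage[OF closed j] A by (simp add: closed_Un compact_imp_closed)
qed

lemma closure_edge_piece:
  assumes "g < n" "a < b" "0 \<le> a" "b \<le> 1"
  shows "cl (edge_map g ` {a<..<b}) = edge_map g ` {a..b}"
proof
  show "cl (edge_map g ` {a<..<b}) \<subseteq> edge_map g ` {a..b}"
    using assms by (intro closure_of_minimal closedin_edge_piece) auto
  have "{0..1} \<inter> {a<..<b} = {a<..<b}" "{0..1} \<inter> {a..b} = {a..b}" using assms by auto
  then have "top_of_set {0..1} closure_of {a<..<b} = {a..b}"
    using assms(2) by (simp add: closure_of_subtopology)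
  then show "edge_map g ` {a..b} \<subseteq> cl (edge_map g ` {a<..<b})"
    using continuous_map_image_closure_subset[OF continuous_edge_map[OF assms(1)]] by metis
qed

definition polar :: "real \<times> real \<Rightarrow> complex" where
  "polar = (\<lambda>(t, \<gamma>). of_real t * cis \<gamma>)"

lemma continuous_polar: "continuous_on A polar"
  unfolding polar_def case_prod_unfold by (intro continuous_intros)

lemma norm_polar: "0 \<le> t \<Longrightarrow> cmod (polar (t, \<gamma>)) = t"
  by (simp add: polar_def norm_mult)

text \<open>
  The closed piece is the image of a compact set in which the open piece is dense.  The
  open pieces are the sectors, with an open interval I, and the spokes, with a singleton I.
\<close>

lemma closure_face_piece:
  assumes i: "i < length rs" and I: "closure I = {a..b}"
    and g: "g < n" and B: "closed B" "B \<subseteq> {0..1}"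
    and rim: "\<phi> i ` cis ` {a..b} = edge_map g ` B"
  shows "cl (\<phi> i ` polar ` ({0<..<1} \<times> I)) = \<phi> i ` polar ` ({0..1} \<times> {a..b})"
proof
  let ?A = "polar ` ({0..1} \<times> {a..b})" and ?S = "polar ` ({0<..<1} \<times> I)"
  have rim': "\<phi> i ` (?A \<inter> sphere 0 1) = edge_map g ` B"
  proof -
    have "?A \<inter> sphere 0 1 = polar ` ({1} \<times> {a..b})" by (force simp: norm_polar)
    also have "\<dots> = cis ` {a..b}" by (force simp: polar_def)
    finally have "?A \<inter> sphere 0 1 = cis ` {a..b}" .
    with rim show ?thesis by simp
  qed
  have A: "compact ?A" "?A \<subseteq> cball 0 1"
    by (intro compact_continuous_image continuous_polar compact_Times compact_Icc) (auto simp: norm_polar)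
  have "closedin \<tau> (\<phi> i ` ?A \<union> edge_map g ` B)"
    using rim' by (intro closedin_face_piece[OF i A g B]) simp
  moreover have "\<phi> i ` ?A \<union> edge_map g ` B = \<phi> i ` ?A" using rim' by blast
  ultimately have "closedin \<tau> (\<phi> i ` ?A)" by simp
  moreover have SA: "?S \<subseteq> ?A" using closure_subset[of I] I by (intro image_mono Sigma_mono greaterThanLessThan_subseteq_atLeastAtMost_iff[THEN iffD2]) auto
  ultimately show "cl (\<phi> i ` ?S) \<subseteq> \<phi> i ` ?A"
    by (intro closure_of_minimal image_mono[OF SA])
  have "?A = polar ` closure ({0<..<1} \<times> I)" by (simp add: closure_Times I)
  also have "\<dots> \<subseteq> closure ?S"
    by (intro image_closure_subset continuous_polar closure_subset closed_closure)
  finally have "?A \<subseteq> top_of_set (cball 0 1) closure_of ?S"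
    using A(2) Int_absorb1[OF subset_trans[OF SA A(2)]] by (simp add: closure_of_subtopology)
  then show "\<phi> i ` ?A \<subseteq> cl (\<phi> i ` ?S)"
    using continuous_map_image_closure_subset[OF continuous_face_map[OF i], of ?S] by blast
qed

end


section \<open>The cells of the barycentric subdivision\<close>

context standard
begin

abbreviation K :: "kpoint complex_of_cells" where "K \<equiv> barycentric_subdivision (n, rs)"
abbreviation len :: "nat \<Rightarrow> nat" where "len i \<equiv> length (rs ! i)"
abbreviation angle :: "nat \<Rightarrow> nat \<Rightarrow> real" where "angle i j \<equiv> pi * real j / real (len i)"

definition mid :: "nat \<Rightarrow> kpoint set" where "mid g = {Edge_Point g (1/2)}"
definition apex :: "nat \<Rightarrow> kpoint set" where "apex i = {Face_Point i 0}"
definition half1 :: "nat \<Rightarrow> kpoint set" where "half1 g = Edge_Point g ` {0<..<1/2}"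
definition half2 :: "nat \<Rightarrow> kpoint set" where "half2 g = Edge_Point g ` {1/2<..<1}"
definition ray :: "nat \<Rightarrow> nat \<Rightarrow> kpoint set" where
  "ray i j = spoke i (angle i j)"
definition sec :: "nat \<Rightarrow> nat \<Rightarrow> kpoint set" where
  "sec i j = sector i (angle i j) (angle i (Suc j))"
text \<open>
  The j-th subdivision point of the boundary of face i is the image of the vertex o for even j and the
  midpoint of a loop for odd j.  The j-th side runs from the j-th to the next corner: a letter is read
  forwards or backwards, and the first half of a loop that is read backwards comes second.
\<close>

definition corner :: "nat \<Rightarrow> nat \<Rightarrow> kpoint set" where
  "corner i j = (if even j then {Vertex} else mid (fst (rs ! i ! (j div 2))))"
definition side :: "nat \<Rightarrow> nat \<Rightarrow> kpoint set" where
  "side i j = (let (g, b) = rs ! i ! (j div 2) in if even j = b then half1 g else half2 g)"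

lemma cells_0: "cx_cells K 0 = {{Vertex}} \<union> mid ` {..<n} \<union> apex ` {..<length rs}"
  by (auto simp: barycentric_subdivision_def mid_def apex_def)

lemma cells_1: "cx_cells K 1 = half1 ` {..<n} \<union> half2 ` {..<n} \<union>
    (\<Union>i<length rs. ray i ` {..<2 * len i})"
  by (auto simp: barycentric_subdivision_def half1_def half2_def ray_def)

lemma cells_2: "cx_cells K 2 = (\<Union>i<length rs. sec i ` {..<2 * len i})"
  by (auto simp: barycentric_subdivision_def sec_def)

lemma cells_other: "k > 2 \<Longrightarrow> cx_cells K k = {}"
  by (auto simp: barycentric_subdivision_def)

lemma all_cells: "all_cells K = cx_cells K 0 \<union> cx_cells K 1 \<union> cx_cells K 2"
proof -
  have "c \<in> cx_cells K 0 \<union> cx_cells K 1 \<union> cx_cells K 2" if "c \<in> cx_cells K k" for k c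
  proof -
    consider "k = 0" | "k = 1" | "k = 2" | "k > 2" by linarith
    then show ?thesis using that cells_other[of k] by cases auto
  qed
  then show ?thesis unfolding all_cells_def by blast
qed

lemma space_K: "cx_space K = \<tau>"
  by (simp add: barycentric_subdivision_def standard_complex_def)

lemma finite_cells: "finite (cx_cells K 0)" "finite (cx_cells K 1)" "finite (cx_cells K 2)"
  unfolding cells_0 cells_1 cells_2 by auto

lemma cell_cases:
  assumes "c \<in> all_cells K"
  obtains "c = {Vertex}" | g where "g < n" "c = mid g" | i where "i < length rs" "c = apex i"
  | g where "g < n" "c = half1 g" | g where "g < n" "c = half2 g"
  | i j where "i < length rs" "j < 2 * len i" "c = ray i j"
  | i j where "i < length rs" "j < 2 * len i" "c = sec i j"
  using assms unfolding all_cells cells_0 cells_1 cells_2 by blast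

lemma polar_inject:
  assumes "of_real t * cis a = of_real t' * cis a'" "0 < t" "0 < t'" "0 \<le> a" "a < 2 * pi" "0 \<le> a'" "a' < 2 * pi"
  shows "a = a'"
  using assms Arg2pi_unique[of t a "of_real t * cis a"] Arg2pi_unique[of t' a' "of_real t * cis a"]
  by (simp add: cis_conv_exp)

lemma angle_less: "j < 2 * len i \<Longrightarrow> angle i j < 2 * pi"
  using of_nat_less_iff[of j "2 * len i", where 'a = real] by (cases "len i = 0") (auto simp: divide_less_eq)

lemma angle_Suc_le: "j < 2 * len i \<Longrightarrow> angle i (Suc j) \<le> 2 * pi"
  using of_nat_le_iff[of "Suc j" "2 * len i", where 'a = real] by (cases "len i = 0") (auto simp: divide_le_eq simp del: of_nat_Suc)

lemma angle_less_iff: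
  "0 < len i \<Longrightarrow> angle i j < angle i j' \<longleftrightarrow> j < j'"
  by (simp add: divide_less_cancel)

lemma ray_points: "p \<in> ray i j \<longleftrightarrow>
    (\<exists>t>0. t < 1 \<and> p = Face_Point i (of_real t * cis (angle i j)))"
  by (auto simp: ray_def spoke_def)

lemma sec_points: "p \<in> sec i j \<longleftrightarrow> (\<exists>t>0. t < 1 \<and> (\<exists>a. angle i j < a \<and>
    a < angle i (Suc j) \<and> p = Face_Point i (of_real t * cis a)))"
  unfolding sec_def sector_def mem_Collect_eq by blast

lemma ray_disjoint:
  assumes "p \<in> ray i j" "p \<in> ray i' j'" "j < 2 * len i" "j' < 2 * len i'"
  shows "i = i' \<and> j = j'"
proof -
  obtain t where t: "0 < t" "p = Face_Point i (of_real t * cis (angle i j))"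
    using assms by (auto simp: ray_points)
  obtain t' where t': "0 < t'" "p = Face_Point i' (of_real t' * cis (angle i' j'))"
    using assms by (auto simp: ray_points)
  have i: "i' = i" using t t' by simp
  then have "angle i j = angle i j'"
    using t t' assms angle_less[of j i] angle_less[of j' i] by (intro polar_inject[of t _ t']) auto
  moreover have "len i > 0" using assms by auto
  ultimately show ?thesis using i by simp
qed

lemma sec_angle:
  assumes "p \<in> sec i j" "j < 2 * len i"
  obtains t a where "0 < t" "0 \<le> a" "a < 2 * pi" "angle i j < a"
    "a < angle i (Suc j)" "p = Face_Point i (of_real t * cis a)"
proof -
  obtain t a where *: "0 < t" "angle i j < a"
    "a < angle i (Suc j)" "p = Face_Point i (of_real t * cis a)"
    using assms(1) unfolding sec_points by blast
  have "0 \<le> angle i j" by simp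
  with * angle_Suc_le[OF assms(2)] have "0 \<le> a" "a < 2 * pi" by linarith+
  with * show ?thesis using that by blast
qed

lemma ray_sec_disjoint:
  assumes "p \<in> ray i j" "p \<in> sec i' j'" "j < 2 * len i" "j' < 2 * len i'"
  shows False
proof -
  obtain t where t: "0 < t" "p = Face_Point i (of_real t * cis (angle i j))"
    using assms by (auto simp: ray_points)
  obtain t' a where t': "0 < t'" "0 \<le> a" "a < 2 * pi" "angle i' j' < a"
    "a < angle i' (Suc j')" "p = Face_Point i' (of_real t' * cis a)"
    using sec_angle[OF assms(2,4)] .
  have i: "i' = i" using t t' by simp
  then have "angle i j = a"
    using t t' assms angle_less[of j i] by (intro polar_inject[of t _ t']) auto
  moreover have "len i > 0" using assms by auto
  ultimately have "j' < j" "j < Suc j'" using t' i angle_less_iff[of i] by (metis)+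
  then show False by simp
qed

lemma sec_disjoint:
  assumes "p \<in> sec i j" "p \<in> sec i' j'" "j < 2 * len i" "j' < 2 * len i'"
  shows "i = i' \<and> j = j'"
proof -
  obtain t a where t: "0 < t" "0 \<le> a" "a < 2 * pi" "angle i j < a"
    "a < angle i (Suc j)" "p = Face_Point i (of_real t * cis a)"
    using sec_angle[OF assms(1,3)] .
  obtain t' a' where t': "0 < t'" "0 \<le> a'" "a' < 2 * pi" "angle i' j' < a'"
    "a' < angle i' (Suc j')" "p = Face_Point i' (of_real t' * cis a')"
    using sec_angle[OF assms(2,4)] .
  have i: "i' = i" using t t' by simp
  then have "a = a'" using t t' by (intro polar_inject[of t _ t']) auto
  moreover have "len i > 0" using assms by auto
  ultimately have "j < Suc j'" "j' < Suc j" using t t' i angle_less_iff[of i] by (metis less_trans)+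
  then show ?thesis using i by simp
qed

text \<open>
  Cells of different shapes are told apart by the constructor of their points and by the distance from
  the centre of the loop or face, and cells of the same face by the angle of their points.
\<close>

lemma cells_disjoint:
  assumes "c \<in> all_cells K" "c' \<in> all_cells K" "p \<in> c" "p \<in> c'"
  shows "c = c'"
proof -
  have shape: "p \<in> ray i j \<Longrightarrow> \<exists>z. z \<noteq> 0 \<and> p = Face_Point i z"
    "p \<in> sec i j \<Longrightarrow> \<exists>z. z \<noteq> 0 \<and> p = Face_Point i z"
    "p \<in> half1 g \<Longrightarrow> \<exists>t<1/2. p = Edge_Point g t" "p \<in> half2 g \<Longrightarrow> \<exists>t>1/2. p = Edge_Point g t"
    "p \<in> mid g \<Longrightarrow> p = Edge_Point g (1/2)" "p \<in> apex i \<Longrightarrow> p = Face_Point i 0" for i j g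
    by (auto simp: ray_points sec_points half1_def half2_def mid_def apex_def)
  show ?thesis
    using assms(1)
  proof (cases rule: cell_cases)
    case 1
    show ?thesis using assms(2) by (cases rule: cell_cases) (use 1 assms(3,4) in \<open>auto dest!: shape\<close>)
  next
    case (2 g)
    show ?thesis using assms(2) by (cases rule: cell_cases) (use 2 assms(3,4) in \<open>auto dest!: shape\<close>)
  next
    case (3 i)
    show ?thesis using assms(2) by (cases rule: cell_cases) (use 3 assms(3,4) in \<open>auto dest!: shape\<close>)
  next
    case (4 g)
    show ?thesis using assms(2) by (cases rule: cell_cases) (use 4 assms(3,4) in \<open>auto dest!: shape\<close>)
  next
    case (5 g)
    show ?thesis using assms(2) by (cases rule: cell_cases) (use 5 assms(3,4) in \<open>auto dest!: shape\<close>)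
  next
    case (6 i j)
    show ?thesis using assms(2)
    proof (cases rule: cell_cases)
      case (6 i' j')
      then show ?thesis using \<open>c = ray i j\<close> \<open>j < 2 * len i\<close> ray_disjoint[of p i j i' j'] assms by auto
    next
      case (7 i' j')
      then show ?thesis using \<open>c = ray i j\<close> \<open>j < 2 * len i\<close> ray_sec_disjoint[of p i j i' j'] assms by auto
    qed (use 6 assms(3,4) in \<open>auto dest!: shape\<close>)
  next
    case (7 i j)
    show ?thesis using assms(2)
    proof (cases rule: cell_cases)
      case (6 i' j')
      then show ?thesis using \<open>c = sec i j\<close> \<open>j < 2 * len i\<close> ray_sec_disjoint[of p i' j' i j] assms by auto
    next
      case (7 i' j')
      then show ?thesis using \<open>c = sec i j\<close> \<open>j < 2 * len i\<close> sec_disjoint[of p i j i' j'] assms by auto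
    qed (use 7 assms(3,4) in \<open>auto dest!: shape\<close>)
  qed
qed

lemma ray_point: "Face_Point i (of_real (1/2) * cis (angle i j)) \<in> ray i j"
  unfolding ray_points by (intro exI[of _ "1/2"]) auto

lemma sec_point:
  assumes "0 < len i"
  shows "Face_Point i (of_real (1/2) * cis (pi * (real j + 1/2) / real (len i))) \<in> sec i j"
  unfolding sec_points using assms
  by (intro exI[of _ "1/2"] conjI exI[of _ "pi * (real j + 1/2) / real (len i)"])
    (auto intro!: divide_strict_right_mono)

lemma cell_nonempty: assumes "c \<in> all_cells K" shows "c \<noteq> {}"
  using assms
proof (cases rule: cell_cases)
  case (4 g)
  then have "Edge_Point g (1/4) \<in> c" unfolding half1_def by (auto intro!: imageI)
  then show ?thesis by blast
next
  case (5 g)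
  then have "Edge_Point g (3/4) \<in> c" unfolding half2_def by (auto intro!: imageI)
  then show ?thesis by blast
next
  case (6 i j)
  then show ?thesis using ray_point by blast
next
  case (7 i j)
  then show ?thesis using sec_point[of i j] by fastforce
qed (auto simp: mid_def apex_def)

text \<open>
  This distinguishes 1-cells from vertices, and it will ensure that a 1-cell in the boundary of a face
  is not missed by the arcs of an attaching word, which cover all but finitely many points.
\<close>

lemma infinite_1_cell: assumes "c \<in> cx_cells K 1" shows "infinite c"
proof -
  have "infinite (ray i j)" for i j
  proof -
    have "ray i j = (\<lambda>t. Face_Point i (of_real t * cis (angle i j))) ` {0<..<1}"
      by (auto simp: ray_points image_iff) 
    moreover have "inj_on (\<lambda>t. Face_Point i (of_real t * cis (angle i j))) {0<..<1}"
      by (auto simp: inj_on_def)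
    ultimately show ?thesis by (simp add: finite_image_iff infinite_Ioo)
  qed
  moreover have "infinite (half1 g)" "infinite (half2 g)" for g
    by (auto simp: half1_def half2_def finite_image_iff inj_on_def infinite_Ioo)
  ultimately show ?thesis using assms unfolding cells_1 by auto
qed


subsection \<open>Closures\<close>

lemma closure_point:
  assumes "p \<in> {Vertex} \<union> (\<lambda>g. Edge_Point g (1/2)) ` {..<n} \<union> (\<lambda>i. Face_Point i 0) ` {..<length rs}"
  shows "cl {p} = {p}"
proof (rule closure_of_closedin, rule closedin_standardI)
  have finite: "finite {t \<in> {0..1}. edge_map g t \<in> {p}} \<or> p = Vertex" for g
  proof (cases p)
    case (Edge_Point g' t')
    then have "{t \<in> {0..1}. edge_map g t \<in> {p}} \<subseteq> {t'}"
      by (auto simp: edge_map_def split: if_splits)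
    then show ?thesis using finite_subset by blast
  next
    case (Face_Point i z)
    then have "{t \<in> {0..1}. edge_map g t \<in> {p}} = {}"
      by (auto simp: edge_map_def split: if_splits)
    then show ?thesis by (metis finite.emptyI)
  qed auto
  have "{t \<in> {0..1}. edge_map g t \<in> {Vertex}} = {0, 1}" for g
    by (auto simp: edge_map_def split: if_splits)
  with finite show edges: "closed {t \<in> {0..1}. edge_map g t \<in> {p}}" if "g < n" for g
    by (metis finite_imp_closed finite.emptyI finite.insertI)
  show "{p} \<subseteq> standard_points (n, rs)" using assms unfolding standard_points_def by (auto intro!: exI[of _ "1/2 :: real"])
  fix i assume i: "i < length rs"
  have "{z \<in> cball 0 1. \<phi> i z \<in> {p}} = (if p = Face_Point i 0 then {0} else {}) \<union> {z. cmod z = 1 \<and> \<phi> i z \<in> {p}}"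
  proof (intro equalityI subsetI)
    fix z assume z: "z \<in> {z \<in> cball 0 1. \<phi> i z \<in> {p}}"
    show "z \<in> (if p = Face_Point i 0 then {0} else {}) \<union> {z. cmod z = 1 \<and> \<phi> i z \<in> {p}}"
    proof (cases "cmod z < 1")
      case True
      then have "p = Face_Point i z" using z by (auto simp: face_map_def)
      then show ?thesis using assms by auto
    qed (use z in auto)
  next
    fix z assume "z \<in> (if p = Face_Point i 0 then {0} else {}) \<union> {z. cmod z = 1 \<and> \<phi> i z \<in> {p}}"
    then show "z \<in> {z \<in> cball 0 1. \<phi> i z \<in> {p}}" by (auto simp: face_map_def split: if_splits)
  qed
  with closed_circle_preimage[OF edges i] show "closed {z \<in> cball 0 1. \<phi> i z \<in> {p}}"
    by (simp add: closed_Un)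
qed

lemma closure_0_cell: "v \<in> cx_cells K 0 \<Longrightarrow> cl v = \<Union>{v}"
  using closure_point unfolding cells_0 by (auto simp: mid_def apex_def)

lemma closure_half:
  assumes "g < n"
  shows "cl (half1 g) = \<Union>{half1 g, {Vertex}, mid g}"
    "cl (half2 g) = \<Union>{half2 g, {Vertex}, mid g}"
proof -
  have "half1 g = edge_map g ` {0<..<1/2}" "half2 g = edge_map g ` {1/2<..<1}"
    by (auto simp: half1_def half2_def edge_map_def image_iff)
  moreover have "edge_map g ` {0..1/2} = \<Union>{edge_map g ` {0<..<1/2}, {Vertex}, mid g}"
  proof -
    have "{0..1/2::real} = {0<..<1/2} \<union> {0} \<union> {1/2}" by auto
    then show ?thesis by (simp only: image_Un) (simp add: mid_def edge_map_def)
  qed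
  moreover have "edge_map g ` {1/2..1} = \<Union>{edge_map g ` {1/2<..<1}, {Vertex}, mid g}"
  proof -
    have "{1/2..1::real} = {1/2<..<1} \<union> {1} \<union> {1/2}" by auto
    then show ?thesis by (simp only: image_Un) (simp add: mid_def edge_map_def)
  qed
  ultimately show "cl (half1 g) = \<Union>{half1 g, {Vertex}, mid g}"
    "cl (half2 g) = \<Union>{half2 g, {Vertex}, mid g}"
    using closure_edge_piece[OF assms, of 0 "1/2"] closure_edge_piece[OF assms, of "1/2" 1] by simp_all
qed

text \<open>
  The j-th of the \<open>2 l\<close> arcs of the boundary circle of a face with a relator of length l is one
  half of the letter number \<open>j div 2\<close>; the value is the time on the loop of this letter that is reached
  after the fraction s of the arc.
\<close>

definition arc_time :: "nat \<Rightarrow> nat \<Rightarrow> real \<Rightarrow> real" where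
  "arc_time i j s = (if even j = snd (rs ! i ! (j div 2)) then
     (if even j then s / 2 else (1 - s) / 2) else (if even j then 1 - s / 2 else (1 + s) / 2))"

lemma face_map_arc':
  assumes "j < 2 * len i" "0 \<le> s" "s \<le> 1"
  shows "\<phi> i (cis (pi * (real j + s) / real (len i))) =
    edge_map (fst (rs ! i ! (j div 2))) (arc_time i j s)"
proof -
  have k: "j div 2 < len i" using assms by linarith
  have j: "real j = 2 * real (j div 2) + (if even j then 0 else 1)"
    by (cases "even j") (auto elim!: evenE oddE)
  show ?thesis
  proof -
    have "2 * pi * ((real j + s) / 2) = pi * (real j + s)" by simp
    moreover have "real (j div 2) \<le> (real j + s) / 2" "(real j + s) / 2 \<le> real (j div 2) + 1"
      using assms j by (auto split: if_splits)
    moreover have "(if snd (rs ! i ! (j div 2)) then (real j + s) / 2 - real (j div 2)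
        else 1 - ((real j + s) / 2 - real (j div 2))) = arc_time i j s"
      using j unfolding arc_time_def by (auto simp: field_simps split: if_splits)
    ultimately show ?thesis using face_map_arc[OF k, of "(real j + s) / 2"] by simp
  qed
qed

lemma face_map_corner:
  assumes "j < 2 * len i"
  shows "{\<phi> i (cis (angle i j))} = corner i j"
    "{\<phi> i (cis (angle i (Suc j)))} = corner i (Suc j)"
  using face_map_arc'[OF assms, of 0] face_map_arc'[OF assms, of 1]
  by (auto simp: corner_def arc_time_def mid_def edge_map_def add.commute elim!: oddE evenE)

lemma arc_time_image:
  "arc_time i j ` {0..1} = (if even j = snd (rs ! i ! (j div 2)) then {0..1/2} else {1/2..1})"
proof -
  have *: "arc_time i j ` {0..1} = S" if "\<And>s. 0 \<le> s \<Longrightarrow> s \<le> 1 \<Longrightarrow> arc_time i j s \<in> S"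
    "\<And>t. t \<in> S \<Longrightarrow> 0 \<le> f t \<and> f t \<le> 1 \<and> arc_time i j (f t) = t" for S f
  proof (intro equalityI subsetI)
    fix t assume "t \<in> S"
    with that(2)[of t] show "t \<in> arc_time i j ` {0..1}" by (intro image_eqI[of _ _ "f t"]) auto
  qed (use that(1) in auto)
  show ?thesis
  proof (cases "even j = snd (rs ! i ! (j div 2))")
    case True
    then show ?thesis
      by (intro *[of _ "\<lambda>t. if even j then 2 * t else 1 - 2 * t"]) (auto simp: arc_time_def field_simps)
  next
    case False
    then show ?thesis
      by (intro *[of _ "\<lambda>t. if even j then 2 - 2 * t else 2 * t - 1"]) (auto simp: arc_time_def field_simps)
  qed
qed

lemma interval_angle:
  assumes "0 < len i"
  shows "{angle i j..angle i (Suc j)} =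
    (\<lambda>s. pi * (real j + s) / real (len i)) ` {0..1}"
proof (intro equalityI subsetI)
  fix a assume a: "a \<in> {angle i j..angle i (Suc j)}"
  let ?s = "a * real (len i) / pi - real j"
  have "pi * (real j + ?s) / real (len i) = a" using assms by simp
  moreover have "0 \<le> ?s" "?s \<le> 1" using a assms by (auto simp: field_simps)
  ultimately show "a \<in> (\<lambda>s. pi * (real j + s) / real (len i)) ` {0..1}"
    by (intro image_eqI[of _ _ ?s]) auto
qed (use assms in \<open>auto intro!: divide_right_mono\<close>)

lemma face_map_side:
  assumes i: "i < length rs" and j: "j < 2 * len i"
  shows "\<phi> i ` cis ` {angle i j..angle i (Suc j)} =
    edge_map (fst (rs ! i ! (j div 2))) ` (if even j = snd (rs ! i ! (j div 2)) then {0..1/2} else {1/2..1})"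
    "\<phi> i ` cis ` {angle i j..angle i (Suc j)} =
      \<Union>{side i j, corner i j, corner i (Suc j)}"
proof -
  have "0 < len i" using j by auto
  then show *: "\<phi> i ` cis ` {angle i j..angle i (Suc j)} =
    edge_map (fst (rs ! i ! (j div 2))) ` (if even j = snd (rs ! i ! (j div 2)) then {0..1/2} else {1/2..1})"
    using face_map_arc'[OF j] unfolding arc_time_image[symmetric] interval_angle[OF \<open>0 < len i\<close>] image_image
    by (intro image_cong) auto
  obtain g b where gb: "rs ! i ! (j div 2) = (g, b)" by fastforce
  have "g < n" using relator_letter[OF i, of "j div 2"] j gb by auto
  have corners: "{corner i j, corner i (Suc j)} = {{Vertex}, mid g}"
    by (auto simp: corner_def gb elim!: evenE oddE)
  have "edge_map g ` {0..1/2} = \<Union>{half1 g, {Vertex}, mid g}" "edge_map g ` {1/2..1} = \<Union>{half2 g, {Vertex}, mid g}"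
    using closure_half[OF \<open>g < n\<close>] closure_edge_piece[OF \<open>g < n\<close>, of 0 "1/2"] closure_edge_piece[OF \<open>g < n\<close>, of "1/2" 1]
    by (auto simp: half1_def half2_def edge_map_def image_iff simp del: Union_insert) 
  then show "\<phi> i ` cis ` {angle i j..angle i (Suc j)} =
      \<Union>{side i j, corner i j, corner i (Suc j)}"
    unfolding * corners by (simp add: gb side_def)
qed

lemma polar_split:
  assumes "J \<noteq> {}"
  shows "\<phi> i ` polar ` ({0..1} \<times> J) = apex i \<union> \<phi> i ` polar ` ({0<..<1} \<times> J) \<union> \<phi> i ` cis ` J"
proof -
  have "{0..1::real} = {0} \<union> {0<..<1} \<union> {1}" by auto
  then have "{0..1::real} \<times> J = ({0} \<times> J) \<union> ({0<..<1} \<times> J) \<union> ({1} \<times> J)" by blast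
  moreover have "polar ` ({0} \<times> J) = {0}" using assms by (force simp: polar_def)
  moreover have "polar ` ({1} \<times> J) = cis ` J" by (force simp: polar_def)
  ultimately show ?thesis by (simp only: image_Un) (simp add: apex_def face_map_def)
qed

lemma polar_points:
  "\<phi> i ` polar ` ({0<..<1} \<times> J) = {Face_Point i (of_real t * cis \<gamma>) |t \<gamma>. 0 < t \<and> t < 1 \<and> \<gamma> \<in> J}"
proof -
  have "\<phi> i (polar (t, \<gamma>)) = Face_Point i (of_real t * cis \<gamma>)" if "0 < t" "t < 1" for t \<gamma>
    using that by (simp add: face_map_def polar_def norm_mult)
  then have "\<phi> i ` polar ` ({0<..<1} \<times> J) = (\<lambda>(t, \<gamma>). Face_Point i (of_real t * cis \<gamma>)) ` ({0<..<1} \<times> J)"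
    unfolding image_image by (intro image_cong) auto
  also have "\<dots> = {Face_Point i (of_real t * cis \<gamma>) |t \<gamma>. t \<in> {0<..<1} \<and> \<gamma> \<in> J}"
    (is "?F ` _ = ?S")
  proof (intro equalityI subsetI)
    fix p assume "p \<in> ?S"
    then obtain t \<gamma> where "p = ?F (t, \<gamma>)" "(t, \<gamma>) \<in> {0<..<1} \<times> J" by auto
    then show "p \<in> ?F ` ({0<..<1} \<times> J)" by blast
  next
    fix p assume "p \<in> ?F ` ({0<..<1} \<times> J)"
    then obtain t \<gamma> where "p = Face_Point i (of_real t * cis \<gamma>)" "t \<in> {0<..<1}" "\<gamma> \<in> J" by auto
    then show "p \<in> ?S" by blast
  qed
  finally show ?thesis by simp
qed

lemma closure_ray:
  assumes i: "i < length rs" and j: "j < 2 * len i"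
  shows "cl (ray i j) = \<Union>{ray i j, apex i, corner i j}"
proof -
  let ?a = "angle i j"
  have ray: "ray i j = \<phi> i ` polar ` ({0<..<1} \<times> {?a})"
    unfolding polar_points by (auto simp: ray_def spoke_def)
  have k: "j div 2 < len i" using j by linarith
  let ?g = "fst (rs ! i ! (j div 2))"
  have rim: "\<phi> i ` cis ` {?a..?a} = edge_map ?g ` {arc_time i j 0}"
    using face_map_arc'[OF j, of 0] by simp
  have "arc_time i j 0 \<in> {0..1}" by (auto simp: arc_time_def)
  with closure_face_piece[OF i _ relator_letter[OF i k] _ _ rim, of "{?a}"]
  have "cl (ray i j) = \<phi> i ` polar ` ({0..1} \<times> {?a})" by (simp add: ray)
  then show ?thesis
    unfolding polar_split[of "{?a}" i, simplified] using face_map_corner(1)[OF j] by (auto simp: ray)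
qed

lemma closure_sec:
  assumes i: "i < length rs" and j: "j < 2 * len i"
  shows "cl (sec i j) =
    \<Union>{sec i j, ray i j, ray i (Suc j), side i j, apex i, corner i j, corner i (Suc j)}"
proof -
  let ?a = "angle i j" and ?b = "angle i (Suc j)"
  have len: "0 < len i" using j by auto
  then have ab: "?a < ?b" by (simp only: angle_less_iff)
  have sec: "sec i j = \<phi> i ` polar ` ({0<..<1} \<times> {?a<..<?b})"
    unfolding polar_points by (auto simp: sec_def sector_def)
  have rays: "ray i j = \<phi> i ` polar ` ({0<..<1} \<times> {?a})" "ray i (Suc j) = \<phi> i ` polar ` ({0<..<1} \<times> {?b})"
    unfolding polar_points by (auto simp: ray_def spoke_def)
  have k: "j div 2 < len i" using j by linarith
  have I: "closure {?a<..<?b} = {?a..?b}" using ab by simp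
  have "cl (sec i j) = \<phi> i ` polar ` ({0..1} \<times> {?a..?b})"
    unfolding sec
    by (rule closure_face_piece[OF i I relator_letter[OF i k] _ _ face_map_side(1)[OF i j]]) auto
  also have "\<dots> = apex i \<union> \<phi> i ` polar ` ({0<..<1} \<times> {?a..?b}) \<union> \<Union>{side i j, corner i j, corner i (Suc j)}"
  proof -
    have J: "{?a..?b} \<noteq> {}" using ab unfolding atLeastatMost_empty_iff by linarith
    show ?thesis unfolding polar_split[OF J] face_map_side(2)[OF i j] by (rule HOL.refl)
  qed
  also have "{?a..?b} = {?a} \<union> {?a<..<?b} \<union> {?b}" using ab by auto
  then have "\<phi> i ` polar ` ({0<..<1} \<times> {?a..?b}) = ray i j \<union> sec i j \<union> ray i (Suc j)"
    unfolding sec rays by (simp only: Sigma_Un_distrib2 image_Un) 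
  finally show ?thesis by auto
qed

end


section \<open>Reading the boundary of a cell\<close>

lemma cis_eq_imp_eq:
  assumes "cis s = cis t" "\<bar>s - t\<bar> < 2 * pi" shows "s = t"
proof -
  have "sin s = sin t \<and> cos s = cos t" using assms(1) by (simp add: complex_eq_iff)
  then obtain k :: int where k: "s = t + 2 * pi * k" using sin_cos_eq_iff by blast
  then have "2 * pi * \<bar>real_of_int k\<bar> < 2 * pi * 1" using assms(2) by (simp add: abs_mult)
  then have "\<bar>real_of_int k\<bar> < 1" by (subst (asm) mult_less_cancel_left_pos) auto
  then have "k = 0" by linarith
  with k show ?thesis by simp
qed

lemma cis_surj:
  assumes "cmod z = 1" obtains t where "a \<le> t" "t < a + 2 * pi" "z = cis t"
proof -
  define k where "k = \<lfloor>(Arg z - a) / (2 * pi)\<rfloor>"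
  define t where "t = Arg z - 2 * pi * of_int k"
  have "z \<noteq> 0" using assms by auto
  then have "z = cis (Arg z)" using assms cis_Arg[of z] by (simp add: sgn_eq)
  then have "z = cis t" by (simp add: t_def flip: cis_divide)
  moreover have "of_int k \<le> (Arg z - a) / (2 * pi)" "(Arg z - a) / (2 * pi) < of_int k + 1"
    by (auto simp: k_def)
  then have "of_int k * (2 * pi) \<le> Arg z - a" "Arg z - a < (of_int k + 1) * (2 * pi)"
    by (simp_all add: pos_le_divide_eq pos_divide_less_eq)
  then have "a \<le> t" "t < a + 2 * pi" by (auto simp: t_def algebra_simps)
  ultimately show ?thesis using that by blast
qed

text \<open>
  The letters of w are the images of consecutive arcs that fill the circle up to their end points.
  As the characteristic map is injective, different arcs give different 1-cells; as 1-cells are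
  infinite, each one in the boundary meets the image of some arc and hence coincides with it.
\<close>

lemma attaching_word_boundary:
  fixes K :: "'a complex_of_cells"
  assumes "attaching_word K src tgt e w"
    and inf: "\<And>x. x \<in> cx_cells K 1 \<Longrightarrow> infinite x"
    and disj: "\<And>x y p. x \<in> cx_cells K 1 \<Longrightarrow> y \<in> cx_cells K 1 \<Longrightarrow> p \<in> x \<Longrightarrow> p \<in> y \<Longrightarrow> x = y"
    and e: "\<And>x. x \<in> cx_cells K 1 \<Longrightarrow> x \<inter> e = {}"
  shows "distinct (map fst w)" "letters w = {x \<in> cx_cells K 1. face_le K x e}"
    "\<exists>v. walk src tgt v w v"
proof -
  obtain \<Phi> :: "complex \<Rightarrow> 'a" and \<theta> :: "nat \<Rightarrow> real"
    where hom: "homeomorphic_map (top_of_set (cball 0 1))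
          (subtopology (cx_space K) (cx_space K closure_of e)) \<Phi>"
      and int: "\<Phi> ` ball 0 1 = e"
      and turn: "\<theta> (length w) = \<theta> 0 + 2 * pi"
      and arcs: "\<And>j. j < length w \<Longrightarrow> \<theta> j < \<theta> (Suc j) \<and> fst (w ! j) \<in> cx_cells K 1 \<and>
           \<Phi> ` cis ` {\<theta> j<..<\<theta> (Suc j)} = fst (w ! j) \<and>
           {\<Phi> (cis (\<theta> j))} = letter_start src tgt (w ! j) \<and>
           {\<Phi> (cis (\<theta> (Suc j)))} = letter_end src tgt (w ! j)"
    using assms(1) unfolding attaching_word_def by blast
  have onto: "\<Phi> ` cball 0 1 = cx_space K closure_of e"
    using homeomorphic_imp_surjective_map[OF hom] closure_of_subset_topspace[of "cx_space K" e]
    by (simp add: Int_absorb1)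
  have inj: "inj_on \<Phi> (cball 0 1)"
    using homeomorphic_imp_injective_map[OF hom] by simp
  have mono: "\<theta> j \<le> \<theta> k" if "j \<le> k" "k \<le> length w" for j k
    using that
  proof (induction k rule: dec_induct)
    case (step k)
    then show ?case using arcs[of k] by fastforce
  qed simp
  have cover: "\<exists>j<k. \<theta> j \<le> t \<and> t < \<theta> (Suc j)" if "\<theta> 0 \<le> t" "t < \<theta> k" for k t
    using that
  proof (induction k)
    case (Suc k)
    then show ?case by (cases "t < \<theta> k") (auto simp: less_Suc_eq)
  qed simp

  show "distinct (map fst w)"
    unfolding distinct_conv_nth
  proof (intro allI impI)
    have "fst (w ! j) \<noteq> fst (w ! k)" if jk: "j < k" "k < length w" for j k
    proof
      assume same: "fst (w ! j) = fst (w ! k)"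
      obtain s where s: "\<theta> j < s" "s < \<theta> (Suc j)" using arcs[of j] jk dense by force
      have "\<Phi> (cis s) \<in> fst (w ! k)" using arcs[of j] jk s same by auto
      then have "\<Phi> (cis s) \<in> \<Phi> ` cis ` {\<theta> k<..<\<theta> (Suc k)}" using arcs[OF jk(2)] by argo
      then obtain t where "t \<in> {\<theta> k<..<\<theta> (Suc k)}" "\<Phi> (cis s) = \<Phi> (cis t)" by blast
      then have t: "\<theta> k < t" "t < \<theta> (Suc k)" "\<Phi> (cis s) = \<Phi> (cis t)" by auto
      have "cis s = cis t" using inj t(3) by (auto dest: inj_onD)
      moreover have "\<theta> (Suc j) \<le> \<theta> k" "\<theta> 0 \<le> \<theta> j" "\<theta> (Suc k) \<le> \<theta> (length w)"
        using jk by (auto intro!: mono)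
      then have "s < t" "\<bar>s - t\<bar> < 2 * pi" using s t turn by auto
      ultimately show False using cis_eq_imp_eq[of s t] by simp
    qed
    then show "map fst w ! j \<noteq> map fst w ! k" if "j < length (map fst w)" "k < length (map fst w)" "j \<noteq> k" for j k
      using that by (metis length_map linorder_neqE_nat nth_map)
  qed

  show "letters w = {x \<in> cx_cells K 1. face_le K x e}"
  proof (intro equalityI subsetI)
    fix x assume "x \<in> letters w"
    then obtain j where j: "j < length w" "x = fst (w ! j)" by (auto simp: letters_def in_set_conv_nth)
    have "x = \<Phi> ` cis ` {\<theta> j<..<\<theta> (Suc j)}" using arcs[OF j(1)] j(2) by simp
    then have "x \<subseteq> \<Phi> ` cball 0 1" by auto
    then show "x \<in> {x \<in> cx_cells K 1. face_le K x e}"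
      using arcs[OF j(1)] j(2) by (simp add: onto face_le_def)
  next
    fix x assume "x \<in> {x \<in> cx_cells K 1. face_le K x e}"
    then have x: "x \<in> cx_cells K 1" "x \<subseteq> \<Phi> ` cball 0 1" by (auto simp: face_le_def onto)
    have "infinite (x - (\<lambda>j. \<Phi> (cis (\<theta> j))) ` {..length w})"
      using inf[OF x(1)] by (intro Diff_infinite_finite) auto
    then have "x - (\<lambda>j. \<Phi> (cis (\<theta> j))) ` {..length w} \<noteq> {}" by (intro notI) simp
    then obtain p where "p \<in> x" "p \<notin> (\<lambda>j. \<Phi> (cis (\<theta> j))) ` {..length w}" by blast
    then have p: "p \<in> x" "\<And>j. j \<le> length w \<Longrightarrow> p \<noteq> \<Phi> (cis (\<theta> j))" by auto
    obtain z where z: "z \<in> cball 0 1" "p = \<Phi> z" using x p(1) by blast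
    have "z \<notin> ball 0 1" using e[OF x(1)] p(1) z int by blast
    then have "cmod z = 1" using z by simp
    then obtain t where t: "\<theta> 0 \<le> t" "t < \<theta> 0 + 2 * pi" "z = cis t" using cis_surj by blast
    then obtain j where j: "j < length w" "\<theta> j \<le> t" "t < \<theta> (Suc j)" using cover[of t "length w"] turn by auto
    have "t \<noteq> \<theta> j" using p(2)[of j] j z t by auto
    then have "p \<in> fst (w ! j)" using arcs[OF j(1)] j z t by auto
    then have "x = fst (w ! j)" using disj[OF x(1)] arcs[OF j(1)] p(1) by blast
    then show "x \<in> letters w" using j(1) by (simp add: letters_def)
  qed

  have "walk src tgt {\<Phi> (cis (\<theta> k))} (drop k w) {\<Phi> (cis (\<theta> (length w)))}" if "k \<le> length w" for k
    using that
  proof (induction k rule: inc_induct)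
    case (step k)
    then show ?case using arcs[of k] by (simp add: Cons_nth_drop_Suc[symmetric])
  qed simp
  from this[of 0] have "walk src tgt {\<Phi> (cis (\<theta> 0))} w {\<Phi> (cis (\<theta> (length w)))}" by simp
  moreover have "cis (\<theta> (length w)) = cis (\<theta> 0)" by (simp add: turn complex_eq_iff)
  ultimately show "\<exists>v. walk src tgt v w v" by auto
qed


section \<open>Incidences in the barycentric subdivision\<close>

context standard
begin

abbreviation V :: "kpoint set set" where "V \<equiv> cx_cells K 0"
abbreviation E :: "kpoint set set" where "E \<equiv> cx_cells K 1"
abbreviation m :: nat where "m \<equiv> length rs"

lemma ray_wrap: "0 < len i \<Longrightarrow> ray i (2 * len i) = ray i 0"
proof -
  assume "0 < len i"
  then have "angle i (2 * len i) = 2 * pi" by simp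
  then have "cis (angle i (2 * len i)) = 1" by simp
  then show ?thesis by (simp only: ray_def spoke_def) simp
qed

lemma corner_wrap: "corner i (2 * len i) = corner i 0"
  by (simp add: corner_def)

lemma wrap_less: "j < 2 * len i \<Longrightarrow> Suc j mod (2 * len i) < 2 * len i"
  by (rule mod_less_divisor) linarith

lemma ray_Suc: assumes "j < 2 * len i" shows "ray i (Suc j) = ray i (Suc j mod (2 * len i))"
proof (cases "Suc j = 2 * len i")
  case True
  moreover have "0 < len i" using assms by linarith
  ultimately show ?thesis using ray_wrap[of i] by simp
qed (use assms in auto)

lemma corner_Suc: assumes "j < 2 * len i" shows "corner i (Suc j) = corner i (Suc j mod (2 * len i))"
  using assms corner_wrap[of i] by (cases "Suc j = 2 * len i") auto

lemma vertex_V: "{Vertex} \<in> V" and mid_V: "g < n \<Longrightarrow> mid g \<in> V" and apex_V: "i < m \<Longrightarrow> apex i \<in> V"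
  and half1_E: "g < n \<Longrightarrow> half1 g \<in> E" and half2_E: "g < n \<Longrightarrow> half2 g \<in> E"
  and ray_E: "i < m \<Longrightarrow> j < 2 * len i \<Longrightarrow> ray i j \<in> E"
  and sec_2: "i < m \<Longrightarrow> j < 2 * len i \<Longrightarrow> sec i j \<in> cx_cells K 2"
  unfolding cells_0 cells_1 cells_2 by auto

lemma ray_Suc_E: "i < m \<Longrightarrow> j < 2 * len i \<Longrightarrow> ray i (Suc j) \<in> E"
  unfolding ray_Suc by (intro ray_E wrap_less)

lemma letter_lt: "i < m \<Longrightarrow> j < 2 * len i \<Longrightarrow> fst (rs ! i ! (j div 2)) < n"
  by (intro relator_letter) auto

lemma side_E: "i < m \<Longrightarrow> j < 2 * len i \<Longrightarrow> side i j \<in> E"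
  using letter_lt[of i j] half1_E half2_E by (auto simp: side_def split: prod.splits)

lemma corner_V: "i < m \<Longrightarrow> j < 2 * len i \<Longrightarrow> corner i j \<in> V"
  using letter_lt[of i j] mid_V vertex_V by (auto simp: corner_def)

lemma corner_Suc_V: "i < m \<Longrightarrow> j < 2 * len i \<Longrightarrow> corner i (Suc j) \<in> V"
  unfolding corner_Suc by (intro corner_V wrap_less)

lemma all_cellsI: "c \<in> V \<Longrightarrow> c \<in> all_cells K" "c \<in> E \<Longrightarrow> c \<in> all_cells K"
  "c \<in> cx_cells K 2 \<Longrightarrow> c \<in> all_cells K"
  unfolding all_cells by auto

lemma V_finite: "v \<in> V \<Longrightarrow> finite v"
  unfolding cells_0 by (auto simp: mid_def apex_def)

lemma V_E_disjoint: "E \<inter> V = {}"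
  using V_finite infinite_1_cell by blast

lemma sec_point_shape: "p \<in> sec i j \<Longrightarrow> \<exists>z. z \<noteq> 0 \<and> p = Face_Point i z"
  by (auto simp: sec_points)

lemma cells_2_disjoint: assumes "c \<in> cx_cells K 2" shows "c \<notin> V" "c \<notin> E"
proof -
  obtain i j where c: "c = sec i j" "i < m" "j < 2 * len i" using assms unfolding cells_2 by auto
  then have ne: "c \<noteq> {}" using cell_nonempty all_cellsI assms by blast
  then obtain p where p: "p \<in> c" by blast
  show "c \<notin> V"
    using p sec_point_shape[of p i j] c unfolding cells_0 by (auto simp: mid_def apex_def)
  show "c \<notin> E"
  proof
    assume "c \<in> E"
    then consider g where "c = half1 g \<or> c = half2 g" | i' j' where "c = ray i' j'" "i' < m" "j' < 2 * len i'"
      unfolding cells_1 by auto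
    then show False
    proof cases
      case 1
      then show False using p sec_point_shape[of p i j] c by (auto simp: half1_def half2_def)
    next
      case 2
      then show False using p c ray_sec_disjoint[of p i' j' i j] by auto
    qed
  qed
qed

text \<open>
  Closures are unions of cells and cells are disjoint; so the face relation is membership in the
  list of cells of the closure.
\<close>

lemma face_iff:
  assumes "c \<in> all_cells K" "cl c' = \<Union>D" "D \<subseteq> all_cells K"
  shows "face_le K c c' \<longleftrightarrow> c \<in> D"
proof
  assume "face_le K c c'"
  then have sub: "c \<subseteq> \<Union>D" using assms(2) by (simp add: face_le_def space_K)
  obtain p where p: "p \<in> c" using cell_nonempty[OF assms(1)] by blast
  then obtain d where "d \<in> D" "p \<in> d" using sub by blast
  then show "c \<in> D" using cells_disjoint[OF assms(1) _ p] assms(3) by blast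
next
  assume "c \<in> D"
  then show "face_le K c c'" using assms(2) by (auto simp: face_le_def space_K)
qed

lemma face_of_vertex: "v \<in> V \<Longrightarrow> c \<in> all_cells K \<Longrightarrow> face_le K c v \<longleftrightarrow> c = v"
  using face_iff[of c v "{v}"] closure_0_cell[of v] all_cellsI by auto

lemma face_of_half:
  assumes "g < n" "c \<in> all_cells K"
  shows "face_le K c (half1 g) \<longleftrightarrow> c \<in> {half1 g, {Vertex}, mid g}"
    "face_le K c (half2 g) \<longleftrightarrow> c \<in> {half2 g, {Vertex}, mid g}"
  using assms by (intro face_iff closure_half; auto intro: all_cellsI half1_E half2_E vertex_V mid_V)+

lemma face_of_ray:
  assumes "i < m" "j < 2 * len i" "c \<in> all_cells K"
  shows "face_le K c (ray i j) \<longleftrightarrow> c \<in> {ray i j, apex i, corner i j}"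
  using assms by (intro face_iff closure_ray) (auto intro: all_cellsI ray_E apex_V corner_V)

lemma face_of_sec:
  assumes "i < m" "j < 2 * len i" "c \<in> all_cells K"
  shows "face_le K c (sec i j) \<longleftrightarrow>
    c \<in> {sec i j, ray i j, ray i (Suc j), side i j, apex i, corner i j, corner i (Suc j)}"
  using assms by (intro face_iff closure_sec)
    (auto intro: all_cellsI ray_E ray_Suc_E apex_V corner_V corner_Suc_V side_E sec_2)

lemma ends_of_half:
  assumes "g < n"
  shows "{v \<in> V. face_le K v (half1 g)} = {{Vertex}, mid g}" "{v \<in> V. face_le K v (half2 g)} = {{Vertex}, mid g}"
proof -
  have "half1 g \<notin> V" "half2 g \<notin> V" using V_E_disjoint half1_E[OF assms] half2_E[OF assms] by blast+
  then show "{v \<in> V. face_le K v (half1 g)} = {{Vertex}, mid g}" "{v \<in> V. face_le K v (half2 g)} = {{Vertex}, mid g}"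
    using face_of_half[OF assms] vertex_V mid_V[OF assms] all_cellsI(1) by blast+
qed

lemma ends_of_ray:
  assumes "i < m" "j < 2 * len i"
  shows "{v \<in> V. face_le K v (ray i j)} = {apex i, corner i j}"
proof -
  have "ray i j \<notin> V" using V_E_disjoint ray_E[OF assms] by blast
  then show ?thesis
    using face_of_ray[OF assms] apex_V[OF assms(1)] corner_V[OF assms] all_cellsI(1) by blast
qed

lemma sides_of_sec:
  assumes "i < m" "j < 2 * len i"
  shows "{x \<in> E. face_le K x (sec i j)} = {ray i j, ray i (Suc j), side i j}"
proof -
  have "apex i \<notin> E" "corner i j \<notin> E" "corner i (Suc j) \<notin> E" "sec i j \<notin> E"
    using V_E_disjoint apex_V[OF assms(1)] corner_V[OF assms] corner_Suc_V[OF assms]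
      cells_2_disjoint(2)[OF sec_2[OF assms]] by blast+
  then show ?thesis
    using face_of_sec[OF assms] ray_E[OF assms] ray_Suc_E[OF assms] side_E[OF assms] all_cellsI(2) by blast
qed

lemma E_cases:
  assumes "x \<in> E"
  obtains g where "g < n" "x = half1 g" | g where "g < n" "x = half2 g"
  | i j where "i < m" "j < 2 * len i" "x = ray i j"
  using assms unfolding cells_1 by auto

lemma face_of_E:
  assumes "x \<in> E" "c \<in> all_cells K" "face_le K c x" shows "c = x \<or> c \<in> V"
  using assms(1)
proof (cases rule: E_cases)
  case (1 g)
  then show ?thesis using face_of_half[OF _ assms(2), of g] assms(3) vertex_V mid_V by auto
next
  case (2 g)
  then show ?thesis using face_of_half[OF _ assms(2), of g] assms(3) vertex_V mid_V by auto
next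
  case (3 i j)
  then show ?thesis using face_of_ray[OF _ _ assms(2), of i j] assms(3) apex_V corner_V by auto
qed

lemma face_of_2:
  assumes "e \<in> cx_cells K 2" "c \<in> all_cells K" "face_le K c e" shows "c = e \<or> c \<in> V \<or> c \<in> E"
proof -
  obtain i j where ij: "i < m" "j < 2 * len i" "e = sec i j" using assms(1) unfolding cells_2 by auto
  then show ?thesis
    using face_of_sec[OF ij(1,2) assms(2)] assms(3) ray_E[OF ij(1,2)] ray_Suc_E[OF ij(1,2)] side_E[OF ij(1,2)]
      apex_V[OF ij(1)] corner_V[OF ij(1,2)] corner_Suc_V[OF ij(1,2)] by auto
qed

lemma hasse_V_E: assumes "v \<in> V" "x \<in> E" "face_le K v x" shows "(v, x) \<in> hasse K"
proof -
  have "c = v \<or> c = x" if "c \<in> all_cells K" "face_le K v c" "face_le K c x" for c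
    using face_of_E[OF assms(2) that(1,3)] face_of_vertex[of c v] that assms all_cellsI by auto
  then show ?thesis using assms V_E_disjoint all_cellsI by (auto simp: hasse_def)
qed

lemma hasse_E_2: assumes "x \<in> E" "e \<in> cx_cells K 2" "face_le K x e" shows "(x, e) \<in> hasse K"
proof -
  have "c = x \<or> c = e" if c: "c \<in> all_cells K" "face_le K x c" "face_le K c e" for c
    using face_of_2[OF assms(2) c(1,3)]
  proof (elim disjE)
    assume "c \<in> V"
    then show ?thesis using face_of_vertex[of c x] c assms all_cellsI by auto
  next
    assume "c \<in> E"
    then show ?thesis using face_of_E[of c x] c assms all_cellsI V_E_disjoint by auto
  qed auto
  then show ?thesis using assms cells_2_disjoint[OF assms(2)] all_cellsI by (auto simp: hasse_def)
qed

text \<open>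
  A vertex of a triangle is also a vertex of one of its sides, so no vertex is covered by a 2-cell.
\<close>

lemma hasse_V: assumes "v \<in> V" "(v, x) \<in> hasse K" shows "x \<in> E \<and> face_le K v x"
proof -
  have x: "x \<in> all_cells K" "v \<noteq> x" "face_le K v x"
    and cover: "\<And>c. c \<in> all_cells K \<Longrightarrow> face_le K v c \<Longrightarrow> face_le K c x \<Longrightarrow> c = v \<or> c = x"
    using assms by (auto simp: hasse_def)
  have "x \<notin> V" using face_of_vertex[of x v] x assms all_cellsI by auto
  moreover have "x \<notin> cx_cells K 2"
  proof
    assume x2: "x \<in> cx_cells K 2"
    then obtain i j where ij: "i < m" "j < 2 * len i" "x = sec i j" unfolding cells_2 by auto
    have j': "Suc j mod (2 * len i) < 2 * len i" using ij wrap_less by blast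
    have "v \<in> {apex i, corner i j, corner i (Suc j)}"
      using face_of_sec[OF ij(1,2), of v] x ij assms(1) all_cellsI V_E_disjoint
        ray_E[OF ij(1,2)] ray_Suc_E[OF ij(1,2)] side_E[OF ij(1,2)] by auto
    then have "face_le K v (ray i j) \<or> face_le K v (ray i (Suc j))"
      using face_of_ray[OF ij(1,2), of v] face_of_ray[OF ij(1) j', of v] assms(1) all_cellsI
      unfolding ray_Suc[OF ij(2)] corner_Suc[OF ij(2)] by auto
    moreover have "face_le K (ray i j) x" "face_le K (ray i (Suc j)) x"
      using face_of_sec[OF ij(1,2)] ij ray_E[OF ij(1,2)] ray_Suc_E[OF ij(1,2)] all_cellsI by auto
    ultimately obtain y where "y \<in> E" "face_le K v y" "face_le K y x"
      using ray_E[OF ij(1,2)] ray_Suc_E[OF ij(1,2)] by blast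
    then show False
      using cover[of y] all_cellsI assms(1) V_E_disjoint cells_2_disjoint(2)[OF x2] by blast
  qed
  ultimately show ?thesis using x unfolding all_cells by auto
qed

end


section \<open>The triangulated presentation\<close>

context standard
begin

text \<open>
  The index pairs of the spokes, or equally of the sectors, of the first k faces.
\<close>

definition spokes :: "nat \<Rightarrow> (nat \<times> nat) set" where
  "spokes k = (SIGMA i:{..<k}. {..<2 * len i})"

definition halves :: "kpoint set set" where
  "halves = half1 ` {..<n} \<union> half2 ` {..<n}"

text \<open>
  The 1-cells that remain when only the first k faces are still subdivided.
\<close>

definition coned :: "nat \<Rightarrow> kpoint set set" where
  "coned k = halves \<union> (\<lambda>(i, j). ray i j) ` spokes k"

lemma finite_spokes: "finite (spokes k)"
  by (auto simp: spokes_def)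

lemma spokes_Suc: "spokes (Suc k) = spokes k \<union> Pair k ` {..<2 * len k}"
  by (auto simp: spokes_def less_Suc_eq)

lemma mset_spokes_Suc: "mset_set (spokes (Suc k)) = mset_set (spokes k) + image_mset (Pair k) (mset_set {..<2 * len k})"
proof -
  have "spokes k \<inter> Pair k ` {..<2 * len k} = {}" by (auto simp: spokes_def)
  then show ?thesis
    unfolding spokes_Suc by (subst mset_set_Union) (auto simp: finite_spokes image_mset_mset_set inj_on_def)
qed

lemma coned_m: "coned m = E"
  unfolding coned_def halves_def cells_1 spokes_def by auto

lemma coned_Suc: "coned (Suc k) = coned k \<union> ray k ` {..<2 * len k}"
  unfolding coned_def spokes_Suc by (auto simp: image_Un)

lemma cells_2_spokes: "cx_cells K 2 = (\<lambda>(i, j). sec i j) ` spokes m"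
  unfolding cells_2 spokes_def by auto

lemma sec_inj: "inj_on (\<lambda>(i, j). sec i j) (spokes m)"
proof (rule inj_onI, clarify)
  fix i j i' j' assume ij: "(i, j) \<in> spokes m" "(i', j') \<in> spokes m" and eq: "sec i j = sec i' j'"
  then have "sec i j \<in> all_cells K" by (auto simp: spokes_def intro!: all_cellsI sec_2)
  then obtain p where "p \<in> sec i j" using cell_nonempty by blast
  then show "i = i' \<and> j = j'" using ij eq sec_disjoint[of p i j i' j'] by (auto simp: spokes_def)
qed

lemma ray_inj: assumes "ray i j = ray i' j'" "j < 2 * len i" "j' < 2 * len i'" shows "i = i' \<and> j = j'"
  using ray_disjoint[OF ray_point, of i j i' j'] ray_point[of i j] assms by metis

lemma ray_not_half: "ray i j \<noteq> half1 g" "ray i j \<noteq> half2 g"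
  using ray_point[of i j] by (auto simp: half1_def half2_def)

lemma half1_inj: "half1 g = half1 g' \<Longrightarrow> g = g'" and half2_inj: "half2 g = half2 g' \<Longrightarrow> g = g'"
  and half1_half2: "half1 g \<noteq> half2 g'"
proof -
  have points: "Edge_Point g t \<in> half1 g'' \<longleftrightarrow> g'' = g \<and> 0 < t \<and> t < 1/2"
    "Edge_Point g t \<in> half2 g'' \<longleftrightarrow> g'' = g \<and> 1/2 < t \<and> t < 1" for g g'' t
    by (auto simp: half1_def half2_def)
  have "Edge_Point g (1/4) \<in> half1 g'' \<longleftrightarrow> g'' = g" "Edge_Point g (3/4) \<in> half2 g'' \<longleftrightarrow> g'' = g"
    "Edge_Point g (1/4) \<notin> half2 g''" for g g''
    by (simp_all add: points)
  then show "half1 g = half1 g' \<Longrightarrow> g = g'" "half2 g = half2 g' \<Longrightarrow> g = g'" "half1 g \<noteq> half2 g'"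
    by metis+
qed

lemma side_halves: "i < m \<Longrightarrow> j < 2 * len i \<Longrightarrow> side i j \<in> halves"
  using letter_lt[of i j] by (auto simp: side_def halves_def split: prod.splits)

lemma finite_halves: "finite halves"
  by (auto simp: halves_def)

lemma corner_distinct: "corner i j \<noteq> corner i (Suc j)"
  by (auto simp: corner_def mid_def)

lemma apex_not_corner: "apex i \<noteq> corner i' j"
  by (auto simp: apex_def corner_def mid_def)

end

locale oriented = standard +
  fixes src tgt :: "kpoint set \<Rightarrow> kpoint set" and \<omega> :: "kpoint set \<Rightarrow> kpoint set word"
  assumes orient: "is_orientation K src tgt"
    and attach: "\<And>e. e \<in> cx_cells K 2 \<Longrightarrow> attaching_word K src tgt e (\<omega> e)"
begin

lemma ends: "x \<in> E \<Longrightarrow> {src x, tgt x} = {v \<in> V. face_le K v x}"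
  using orient by (simp add: is_orientation_def)

lemma ends_V: "x \<in> E \<Longrightarrow> src x \<in> V \<and> tgt x \<in> V"
  using ends by blast

lemma half_ends: "g < n \<Longrightarrow> {src (half1 g), tgt (half1 g)} = {{Vertex}, mid g}"
  "g < n \<Longrightarrow> {src (half2 g), tgt (half2 g)} = {{Vertex}, mid g}"
  using ends half1_E half2_E ends_of_half by simp_all

lemma ray_ends: "i < m \<Longrightarrow> j < 2 * len i \<Longrightarrow> {src (ray i j), tgt (ray i j)} = {apex i, corner i j}"
  using ends ray_E ends_of_ray by simp

lemma ray_Suc_ends:
  "i < m \<Longrightarrow> j < 2 * len i \<Longrightarrow> {src (ray i (Suc j)), tgt (ray i (Suc j))} = {apex i, corner i (Suc j)}"
  unfolding ray_Suc corner_Suc by (intro ray_ends wrap_less)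

lemma side_ends:
  assumes "i < m" "j < 2 * len i"
  shows "{src (side i j), tgt (side i j)} = {corner i j, corner i (Suc j)}"
proof -
  obtain g b where gb: "rs ! i ! (j div 2) = (g, b)" by fastforce
  then have "g < n" using letter_lt[OF assms] by simp
  then have "{src (side i j), tgt (side i j)} = {{Vertex}, mid g}"
    using half_ends by (auto simp: side_def gb)
  also have "\<dots> = {corner i j, corner i (Suc j)}"
    by (auto simp: corner_def gb elim!: evenE oddE)
  finally show ?thesis .
qed

text \<open>
  The general result on attaching maps applies as the 1-cells are infinite, disjoint from each other and
  from the open 2-cells.
\<close>

lemma boundary_word:
  assumes "e \<in> cx_cells K 2"
  shows "distinct (map fst (\<omega> e))" "letters (\<omega> e) = {x \<in> E. face_le K x e}" "\<exists>v\<in>V. walk src tgt v (\<omega> e) v"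
proof -
  have apart: "x = y" if "x \<in> E" "y \<in> E" "p \<in> x" "p \<in> y" for x y p
    using that cells_disjoint all_cellsI by blast
  have open_cell: "x \<inter> e = {}" if "x \<in> E" for x
    using that cells_disjoint[of x e] assms all_cellsI cells_2_disjoint(2)[OF assms] by blast
  have boundary: "distinct (map fst (\<omega> e))" "letters (\<omega> e) = {x \<in> E. face_le K x e}"
    "\<exists>v. walk src tgt v (\<omega> e) v"
    by (rule attaching_word_boundary[OF attach[OF assms]]; use infinite_1_cell apart open_cell in blast)+
  show "distinct (map fst (\<omega> e))" by (rule boundary(1))
  show lets: "letters (\<omega> e) = {x \<in> E. face_le K x e}" by (rule boundary(2))
  obtain v where v: "walk src tgt v (\<omega> e) v" using boundary(3) by blast
  obtain i j where ij: "i < m" "j < 2 * len i" "e = sec i j" using assms unfolding cells_2 by auto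
  then have "\<omega> e \<noteq> []" using sides_of_sec[OF ij(1,2)] lets by auto
  then obtain l w where lw: "\<omega> e = l # w" by (cases "\<omega> e") auto
  then have "fst l \<in> E" using lets by auto
  then have "v \<in> V" using v lw ends_V by (auto simp: letter_start_def)
  with v show "\<exists>v\<in>V. walk src tgt v (\<omega> e) v" by blast
qed

end

locale oriented_nonempty = oriented +
  assumes nonempty: "\<And>i. i < m \<Longrightarrow> 0 < len i"
begin

definition out :: "nat \<Rightarrow> nat \<Rightarrow> kpoint set \<times> bool" where "out i j = leaving src (ray i j) (apex i)"
definition rim :: "nat \<Rightarrow> nat \<Rightarrow> kpoint set \<times> bool" where "rim i j = leaving src (side i j) (corner i j)"

lemma fst_out [simp]: "fst (out i j) = ray i j" and fst_rim [simp]: "fst (rim i j) = side i j"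
  by (simp_all add: out_def rim_def)

definition sector_word :: "nat \<times> nat \<Rightarrow> kpoint set word" where
  "sector_word = (\<lambda>(i, j). [out i j, rim i j, apsnd Not (out i (Suc j))])"
definition rim_word :: "nat \<Rightarrow> kpoint set word" where "rim_word i = map (rim i) [0..<2 * len i]"

lemma out_ends:
  assumes "i < m" "j < 2 * len i"
  shows "letter_start src tgt (out i j) = apex i" "letter_end src tgt (out i j) = corner i j"
    "letter_start src tgt (out i (Suc j)) = apex i" "letter_end src tgt (out i (Suc j)) = corner i (Suc j)"
    "letter_start src tgt (rim i j) = corner i j" "letter_end src tgt (rim i j) = corner i (Suc j)"
  unfolding out_def rim_def
  using leaving_ends[where src = src and tgt = tgt and x = "ray i j", OF ray_ends[OF assms] apex_not_corner]
    leaving_ends[where src = src and tgt = tgt and x = "ray i (Suc j)", OF ray_Suc_ends[OF assms] apex_not_corner]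
    leaving_ends[where src = src and tgt = tgt and x = "side i j", OF side_ends[OF assms] corner_distinct]
  by simp_all

lemma akin_triangle:
  assumes "i < m" "j < 2 * len i"
  shows "akin E (\<omega> (sec i j)) (sector_word (i, j))"
proof -
  have side: "side i j \<noteq> ray i j'" for j'
  proof -
    have "\<exists>g. side i j = half1 g \<or> side i j = half2 g" by (simp add: side_def split: prod.split) blast
    then show ?thesis using ray_not_half by metis
  qed
  have "Suc j mod (2 * len i) \<noteq> j"
  proof (cases "Suc j = 2 * len i")
    case True
    then have "j \<noteq> 0" by presburger
    with True show ?thesis by simp
  qed (use assms(2) in simp)
  then have rays: "ray i j \<noteq> ray i (Suc j)"
    unfolding ray_Suc[OF assms(2)] using ray_inj[of i j i "Suc j mod (2 * len i)"] wrap_less[OF assms(2)] assms(2) by metis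
  obtain v where v: "walk src tgt v (\<omega> (sec i j)) v" using boundary_word(3)[OF sec_2[OF assms]] by blast
  show ?thesis
    unfolding sector_word_def prod.case
  proof (rule triangle_walk[OF v boundary_word(1)[OF sec_2[OF assms]]])
    show "letters (\<omega> (sec i j)) = {fst (out i j), fst (rim i j), fst (apsnd Not (out i (Suc j)))}"
      unfolding boundary_word(2)[OF sec_2[OF assms]] sides_of_sec[OF assms] by (simp add: insert_commute)
    show "letters [out i j, rim i j, apsnd Not (out i (Suc j))] \<subseteq> E"
      using ray_E[OF assms] ray_Suc_E[OF assms] side_E[OF assms] by simp
    show "fst (out i j) \<noteq> fst (rim i j)" "fst (rim i j) \<noteq> fst (apsnd Not (out i (Suc j)))"
      "fst (out i j) \<noteq> fst (apsnd Not (out i (Suc j)))"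
      using rays side[of j] side[of "Suc j"] by auto
    show "letter_end src tgt (out i j) = letter_start src tgt (rim i j)"
      "letter_end src tgt (rim i j) = letter_start src tgt (apsnd Not (out i (Suc j)))"
      "letter_end src tgt (apsnd Not (out i (Suc j))) = letter_start src tgt (out i j)"
      by (simp_all add: out_ends[OF assms])
    show "letter_start src tgt (out i j) \<noteq> letter_start src tgt (rim i j)"
      "letter_start src tgt (rim i j) \<noteq> letter_start src tgt (apsnd Not (out i (Suc j)))"
      "letter_start src tgt (out i j) \<noteq> letter_start src tgt (apsnd Not (out i (Suc j)))"
      by (simp_all add: out_ends[OF assms] apex_not_corner corner_distinct)
  qed
qed

lemma out_wrap: "i < m \<Longrightarrow> out i (2 * len i) = out i 0"
  using nonempty ray_wrap by (simp add: out_def)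

lemma sector_word_letters:
  assumes "(i, j) \<in> spokes k" "k \<le> m" shows "letters (sector_word (i, j)) \<subseteq> coned k"
proof -
  have ij: "i < k" "i < m" "j < 2 * len i" using assms by (auto simp: spokes_def)
  have ray: "ray i j' \<in> coned k" if "j' < 2 * len i" for j' using ij that by (force simp: coned_def spokes_def)
  have "ray i (Suc j) \<in> coned k" unfolding ray_Suc[OF ij(3)] by (intro ray wrap_less ij)
  moreover have "side i j \<in> coned k" using side_halves[OF ij(2,3)] by (simp add: coned_def)
  ultimately show ?thesis using ray[OF ij(3)] by (simp add: sector_word_def)
qed

text \<open>
  A spoke occurs only in the triangles of its own face, so the faces can be collapsed one by one.
\<close>

lemma collapse_cones:
  assumes "k \<le> m" "over (halves, R)"
  shows "(coned k, image_mset sector_word (mset_set (spokes k)) +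
      (image_mset (\<lambda>i. [(ray i 0, True)]) (mset_set {..<k}) + R)) \<sim>\<^sub>Q
    (halves, image_mset rim_word (mset_set {..<k}) + R)"
  using assms
proof (induction k arbitrary: R)
  case 0
  then show ?case by (auto simp: coned_def spokes_def intro: pres_equiv.refl)
next
  case (Suc k)
  then have k: "k < m" by simp
  let ?L = "2 * len k"
  let ?R = "image_mset sector_word (mset_set (spokes k)) + (image_mset (\<lambda>i. [(ray i 0, True)]) (mset_set {..<k}) + R)"
  have coned: "finite (coned k)" "halves \<subseteq> coned k"
    using finite_halves finite_spokes by (auto simp: coned_def)
  have over: "over (coned k, ?R)"
  proof -
    have "\<forall>p\<in>spokes k. letters (sector_word p) \<subseteq> coned k" using sector_word_letters[of _ _ k] k by auto
    moreover have "\<forall>i<k. ray i 0 \<in> coned k"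
      using nonempty k by (force simp: coned_def spokes_def)
    moreover have "\<forall>r\<in>#R. letters r \<subseteq> coned k" using Suc.prems(2) coned(2) by auto
    ultimately show ?thesis using coned(1) by (simp add: ball_Un finite_spokes)
  qed
  have fresh: "ray k j \<notin> coned k" if "j < ?L" for j
    using ray_inj[of k j] ray_not_half that by (fastforce simp: coned_def halves_def spokes_def)
  have "(coned k \<union> (\<lambda>j. fst (out k j)) ` {..<?L},
      image_mset (\<lambda>j. [out k j, rim k j, apsnd Not (out k (Suc j))]) (mset_set {..<?L}) +
      add_mset [(fst (out k 0), True)] ?R) \<sim>\<^sub>Q (coned k, add_mset (map (rim k) [0..<?L]) ?R)"
  proof (rule collapse_cone[OF over])
    show "0 < ?L" "out k ?L = out k 0" using nonempty[OF k] out_wrap[OF k] by auto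
    show "inj_on (\<lambda>j. fst (out k j)) {..<?L}"
      using ray_inj[of k _ k] by (auto simp: inj_on_def fst_out)
    show "fst (rim k j) \<in> coned k" if "j < ?L" for j
      using side_halves[OF k that] coned(2) by (auto simp: rim_def)
  qed (use fresh in \<open>simp add: fst_out\<close>)
  also have "add_mset (map (rim k) [0..<?L]) ?R = image_mset sector_word (mset_set (spokes k)) +
      (image_mset (\<lambda>i. [(ray i 0, True)]) (mset_set {..<k}) + add_mset (rim_word k) R)"
    by (simp add: rim_word_def)
  also have "(coned k, \<dots>) \<sim>\<^sub>Q (halves, image_mset rim_word (mset_set {..<k}) + add_mset (rim_word k) R)"
  proof (rule Suc.IH)
    have "letters (rim_word k) \<subseteq> halves"
      using side_halves[OF k] by (auto simp: rim_word_def letters_def rim_def)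
    then show "over (halves, add_mset (rim_word k) R)" using Suc.prems(2) by simp
  qed (use k in simp)
  also have "coned k \<union> (\<lambda>j. fst (out k j)) ` {..<?L} = coned (Suc k)"
    unfolding coned_Suc fst_out ..
  also have "image_mset (\<lambda>j. [out k j, rim k j, apsnd Not (out k (Suc j))]) (mset_set {..<?L}) +
      add_mset [(fst (out k 0), True)] ?R = image_mset sector_word (mset_set (spokes (Suc k))) +
      (image_mset (\<lambda>i. [(ray i 0, True)]) (mset_set {..<Suc k}) + R)"
    by (simp add: mset_spokes_Suc multiset.map_comp o_def sector_word_def fst_out lessThan_Suc)
  finally show ?case by (simp add: lessThan_Suc)
qed

definition standard_tree :: "kpoint set set" where
  "standard_tree = half1 ` {..<n} \<union> (\<lambda>i. ray i 0) ` {..<m}"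

definition boundary :: "kpoint set word multiset" where
  "boundary = image_mset \<omega> (mset_set (cx_cells K 2))"

lemma boundary_letters: "r \<in># boundary \<Longrightarrow> letters r \<subseteq> E \<and> (\<exists>u\<in>V. walk src tgt u r u)"
  using boundary_word finite_cells(3) by (auto simp: boundary_def)

text \<open>
  The letter of the second half of the loop g that is read when (g, b) is read.  The second half starts
  at the midpoint if and only if its orientation agrees with that of g.
\<close>

definition kept :: "nat \<times> bool \<Rightarrow> kpoint set \<times> bool" where
  "kept = (\<lambda>(g, b). (half2 g, (src (half2 g) \<noteq> {Vertex}) = b))"

text \<open>
  Each letter of the relator contributes its two halves to the rim, and the first half of the
  loop belongs to the tree.
\<close>

lemma filter_rim_word:
  assumes i: "i < m"
  shows "filter (\<lambda>l. fst l \<notin> half1 ` {..<n}) (rim_word i) = map kept (rs ! i)"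
proof -
  let ?f = "filter (\<lambda>l. fst l \<notin> half1 ` {..<n})"
  have pairs: "?f (map (rim i) [0..<2 * k]) = map (\<lambda>k. kept (rs ! i ! k)) [0..<k]" if "k \<le> len i" for k
    using that
  proof (induction k)
    case (Suc k)
    obtain g b where gb: "rs ! i ! k = (g, b)" by fastforce
    have g: "g < n" using relator_letter[OF i, of k] Suc.prems gb by simp
    have "mid g \<noteq> {Vertex}" by (simp add: mid_def)
    moreover have "src (half2 g) \<in> {{Vertex}, mid g}" using half_ends(2)[OF g] by blast
    ultimately have src: "(src (half2 g) = mid g) = (src (half2 g) \<noteq> {Vertex})" by blast
    have in1: "half1 g \<in> half1 ` {..<n}" using g by simp
    have in2: "half2 g \<notin> half1 ` {..<n}" using half1_half2[THEN not_sym] by blast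
    have rims: "rim i (2 * k) = (if b then leaving src (half1 g) {Vertex} else leaving src (half2 g) {Vertex})"
      "rim i (Suc (2 * k)) = (if b then leaving src (half2 g) (mid g) else leaving src (half1 g) (mid g))"
      by (simp_all add: rim_def side_def gb corner_def)
    have "?f [rim i (2 * k), rim i (Suc (2 * k))] = [kept (rs ! i ! k)]"
      using in1 in2 by (cases b) (simp_all add: rims gb kept_def leaving_def src)
    moreover have "?f (map (rim i) [0..<2 * Suc k]) =
        ?f (map (rim i) [0..<2 * k]) @ ?f [rim i (2 * k), rim i (Suc (2 * k))]"
    proof -
      have "[0..<2 * Suc k] = [0..<2 * k] @ [2 * k, Suc (2 * k)]" by (simp add: numeral_2_eq_2)
      then show ?thesis by (simp only: map_append filter_append list.map)
    qed
    ultimately show ?case using Suc.IH Suc.prems by (simp only: Suc_leD upt_Suc_append map_append list.map)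
  qed simp
  moreover have "map kept (rs ! i) = map (\<lambda>k. kept (rs ! i ! k)) [0..<len i]"
    by (rule nth_equalityI) simp_all
  ultimately show ?thesis unfolding rim_word_def by (metis order_refl)
qed

text \<open>
  The second halves of the loops serve as names of the generators, as the first halves belong to the
  standard tree and are eliminated.
\<close>

definition P_pres :: "kpoint set pres" where
  "P_pres = (half2 ` {..<n}, image_mset (map (apfst half2)) (mset rs))"

lemma relator_letters: "r \<in> set rs \<Longrightarrow> letters r \<subseteq> {..<n}"
  using pres by (auto simp: is_presentation_def letters_def)

lemma P_realized: "realizes P_pres (n, map free_reduce rs)"
  unfolding realizes_def
proof (intro exI conjI)
  let ?\<nu> = "inv_into {..<n} half2"
  have inj: "inj_on half2 {..<n}" using half2_inj by (auto simp: inj_on_def)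
  show "bij_betw ?\<nu> (fst P_pres) {..<fst (n, map free_reduce rs)}"
    using inj by (simp add: P_pres_def bij_betw_inv_into inj_on_imp_bij_betw)
  show "mset (map (map (apfst half2)) rs) = snd P_pres" by (simp add: P_pres_def)
  have "map (apfst ?\<nu>) (map (apfst half2) r) = r" if "r \<in> set rs" for r
    using relator_letters[OF that] inj by (auto simp: letters_def image_subset_iff intro!: map_idI)
  then have "renumber ?\<nu> (map (apfst half2) r) = free_reduce r" if "r \<in> set rs" for r
    using that by (simp add: renumber_def del: map_map)
  then show "snd (n, map free_reduce rs) = map (renumber ?\<nu>) (map (map (apfst half2)) rs)"
    by simp
qed

lemma over_P: "over P_pres"
  using relator_letters by (fastforce simp: P_pres_def letters_rename)

text \<open>
  After the cones are collapsed and the first halves of the loops eliminated, the relators are the given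
  ones, up to the orientations of the second halves.  These are corrected by an automorphism.
\<close>

lemma triangulation_equiv:
  "(E, letter_relators standard_tree + boundary) \<sim>\<^sub>Q P_pres"
proof -
  have spokes_m: "i < m" "j < 2 * len i" if "(i, j) \<in> spokes m" for i j using that by (auto simp: spokes_def)
  let ?rays = "image_mset (\<lambda>i. [(ray i 0, True)]) (mset_set {..<m})"
  let ?H = "letter_relators (half1 ` {..<n})"
  have tree: "letter_relators standard_tree = ?rays + ?H"
  proof -
    have "inj_on (\<lambda>i. ray i 0) {..<m}"
      using ray_inj[of _ 0 _ 0] nonempty by (auto simp: inj_on_def)
    moreover have "half1 ` {..<n} \<inter> (\<lambda>i. ray i 0) ` {..<m} = {}"
      using ray_not_half(1)[THEN not_sym] by blast
    ultimately show ?thesis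
      unfolding standard_tree_def
      by (simp add: mset_set_Union image_mset_mset_set[symmetric, of "\<lambda>i. ray i 0"] multiset.map_comp o_def)
  qed
  have boundary: "boundary = image_mset (\<lambda>(i, j). \<omega> (sec i j)) (mset_set (spokes m))"
    unfolding boundary_def cells_2_spokes image_mset_mset_set[OF sec_inj, symmetric] multiset.map_comp
    by (rule image_mset_cong) auto
  have tree_E: "standard_tree \<subseteq> E" "finite standard_tree"
    using half1_E ray_E[of _ 0] nonempty by (auto simp: standard_tree_def)
  have eq: "(E, letter_relators standard_tree + boundary) =
      (E, image_mset (\<lambda>(i, j). \<omega> (sec i j)) (mset_set (spokes m)) + (?rays + ?H))"
    by (simp add: tree boundary)
  note eq
  also have "\<dots> \<sim>\<^sub>Q (E, image_mset sector_word (mset_set (spokes m)) + (?rays + ?H))"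
  proof (rule replace_all_akin)
    have "over (E, letter_relators standard_tree + boundary)"
      using tree_E boundary_letters finite_cells(2) by (simp add: ball_Un subset_iff[of standard_tree])
    then show "over (E, image_mset (\<lambda>(i, j). \<omega> (sec i j)) (mset_set (spokes m)) + (?rays + ?H))"
      unfolding eq .
    fix p assume "p \<in># mset_set (spokes m)"
    then show "akin E (case p of (i, j) \<Rightarrow> \<omega> (sec i j)) (sector_word p)"
      using akin_triangle spokes_m finite_spokes by (cases p) auto
  qed
  also have "\<dots> \<sim>\<^sub>Q (halves, image_mset rim_word (mset_set {..<m}) + ?H)"
    unfolding coned_m[symmetric]
    by (intro collapse_cones) (auto simp: halves_def)
  also have "\<dots> = (halves, ?H + image_mset rim_word (mset_set {..<m}))"
    by (simp add: ac_simps)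
  also have "\<dots> \<sim>\<^sub>Q (halves - half1 ` {..<n},
      image_mset (filter (\<lambda>l. fst l \<notin> half1 ` {..<n})) (image_mset rim_word (mset_set {..<m})))"
    using pres_equiv_over[OF calculation] by (intro eliminate_letters) (auto simp: ac_simps)
  also have "halves - half1 ` {..<n} = half2 ` {..<n}"
    unfolding halves_def using half1_half2[THEN not_sym] by blast
  also have "image_mset (filter (\<lambda>l. fst l \<notin> half1 ` {..<n})) (image_mset rim_word (mset_set {..<m})) =
      image_mset (map kept) (mset rs)"
  proof -
    have "image_mset (filter (\<lambda>l. fst l \<notin> half1 ` {..<n})) (image_mset rim_word (mset_set {..<m})) =
        image_mset (\<lambda>i. map kept (rs ! i)) (mset_set {..<m})"
      by (auto simp: multiset.map_comp filter_rim_word intro!: image_mset_cong)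
    also have "\<dots> = image_mset (map kept) (mset (map ((!) rs) [0..<m]))"
      by (simp add: multiset.map_comp o_def lessThan_atLeast0)
    finally show ?thesis by (simp add: map_nth)
  qed
  also have "(half2 ` {..<n}, \<dots>) \<sim>\<^sub>Q P_pres"
  proof -
    define \<sigma> where "\<sigma> x = [(x, src x \<noteq> {Vertex})]" for x
    have "P_pres \<sim>\<^sub>Q (half2 ` {..<n}, image_mset (subst \<sigma>) (image_mset (map (apfst half2)) (mset rs)))"
      unfolding P_pres_def
      by (rule pres_equiv.substitute[where \<tau> = \<sigma>])
        (use over_P in \<open>auto simp: \<sigma>_def P_pres_def subst_letter word_inv_letter\<close>)
    moreover have "subst \<sigma> (map (apfst half2) r) = map kept r" for r
      by (induction r) (auto simp: \<sigma>_def kept_def subst_Cons word_inv_letter)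
    ultimately show ?thesis by (simp add: multiset.map_comp o_def pres_equiv.sym)
  qed
  finally show ?thesis .
qed

lemma standard_tree_star:
  assumes "v0 \<in> V"
  obtains l where "rooted_tree src tgt E V v0 l" "rooted_tree.edges V v0 l = standard_tree"
proof -
  define f where "f v = (if v \<in> range mid then half1 (inv_into UNIV mid v) else ray (inv_into UNIV apex v) 0)" for v
  have inj: "inj mid" "inj apex" by (auto simp: inj_def mid_def apex_def)
  have "apex i \<notin> range mid" for i by (auto simp: apex_def mid_def)
  then have f: "f (mid g) = half1 g" "f (apex i) = ray i 0" for g i
    using inj by (auto simp: f_def)
  have not_vertex: "mid g \<noteq> {Vertex}" "apex i \<noteq> {Vertex}" for g i by (auto simp: mid_def apex_def)
  have V': "V - {{Vertex}} = mid ` {..<n} \<union> apex ` {..<m}"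
    unfolding cells_0 using not_vertex by auto
  have image: "f ` (V - {{Vertex}}) = standard_tree"
    unfolding V' image_Un image_image f standard_tree_def ..
  show ?thesis
  proof (rule star_tree[of V "{Vertex}" v0 f E src tgt])
    fix v assume "v \<in> V - {{Vertex}}"
    then consider g where "g < n" "v = mid g" | i where "i < m" "v = apex i" unfolding V' by auto
    then show "f v \<in> E \<and> {src (f v), tgt (f v)} = {{Vertex}, v}"
    proof cases
      case 1
      then show ?thesis using f half1_E half_ends(1) by simp
    next
      case 2
      then show ?thesis using f ray_E[of i 0] ray_ends[of i 0] nonempty[of i]
        by (simp add: corner_def insert_commute)
    qed
  next
    show "inj_on f (V - {{Vertex}})"
    proof (rule inj_onI)
      fix u v assume "u \<in> V - {{Vertex}}" "v \<in> V - {{Vertex}}" and eq: "f u = f v"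
      then consider g g' where "u = mid g" "v = mid g'" | g i where "u = mid g" "v = apex i"
        | i g where "u = apex i" "v = mid g" | i i' where "i < m" "i' < m" "u = apex i" "v = apex i'"
        unfolding V' by blast
      then show "u = v"
      proof cases
        case 1
        then show ?thesis using eq half1_inj[of g g'] by (simp add: f)
      next
        case 2
        then show ?thesis using eq ray_not_half(1)[of i 0 g] by (simp add: f)
      next
        case 3
        then show ?thesis using eq ray_not_half(1)[of i 0 g] by (simp add: f)
      next
        case 4
        then show ?thesis using eq ray_inj[of i 0 i' 0] nonempty[of i] nonempty[of i'] by (simp add: f)
      qed
    qed
  qed (use assms vertex_V finite_cells image that in auto)
qed

end


section \<open>The tree and the order given by an acyclic matching\<close>

locale morse = oriented +
  fixes M :: "(kpoint set \<times> kpoint set) set" and v0 :: "kpoint set"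
  assumes matching: "is_acyclic_matching K M"
    and critical: "critical_cells K M 0 = {v0}"
begin

lemma M_hasse: "M \<subseteq> hasse K"
  and M_unique: "p \<in> M \<Longrightarrow> q \<in> M \<Longrightarrow> {fst p, snd p} \<inter> {fst q, snd q} \<noteq> {} \<Longrightarrow> p = q"
  and M_acyclic: "acyclic ((hasse K - M) \<union> M\<inverse>)"
  using matching by (auto simp: is_acyclic_matching_def is_matching_def)

lemma M_fst: "(x, y) \<in> M \<Longrightarrow> (x, y') \<in> M \<Longrightarrow> y = y'"
  and M_snd: "(x, y) \<in> M \<Longrightarrow> (x', y) \<in> M \<Longrightarrow> x = x'"
  and M_chain: "(x, y) \<in> M \<Longrightarrow> (y, z) \<in> M \<Longrightarrow> x = y"
  using M_unique[of "(x, y)" "(x, y')"] M_unique[of "(x, y)" "(x', y)"] M_unique[of "(x, y)" "(y, z)"]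
  by simp_all

lemma v0_V: "v0 \<in> V"
  using critical by (auto simp: critical_cells_def)

definition mate :: "kpoint set \<Rightarrow> kpoint set" where "mate v = (THE x. (v, x) \<in> M)"

text \<open>
  A vertex has no proper faces, so a vertex that is not critical is the smaller cell of its pair.
\<close>

lemma mate:
  assumes "v \<in> V - {v0}"
  shows "(v, mate v) \<in> M" "mate v \<in> E" "face_le K v (mate v)"
proof -
  have "v \<notin> critical_cells K M 0" using assms critical by auto
  then obtain p where p: "p \<in> M" "v = fst p \<or> v = snd p" using assms by (auto simp: critical_cells_def)
  have "v \<noteq> snd p"
  proof
    assume v: "v = snd p"
    then have "(fst p, v) \<in> hasse K" using p M_hasse by auto
    then show False using face_of_vertex[of v "fst p"] assms by (auto simp: hasse_def)
  qed
  then have "(v, snd p) \<in> M" using p by auto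
  then show M: "(v, mate v) \<in> M"
    unfolding mate_def by (rule theI) (use M_fst \<open>(v, snd p) \<in> M\<close> in blast)
  then show "mate v \<in> E" "face_le K v (mate v)"
    using hasse_V[of v "mate v"] M_hasse assms by auto
qed

lemma matched_edges: "snd ` matched_01 K M = mate ` (V - {v0})"
proof (intro equalityI subsetI)
  fix x assume "x \<in> snd ` matched_01 K M"
  then obtain v where v: "(v, x) \<in> M" "v \<in> V" by (auto simp: matched_01_def)
  have "v \<noteq> v0"
  proof
    assume "v = v0"
    moreover have "v0 \<in> critical_cells K M 0" using critical by simp
    ultimately show False using v(1) unfolding critical_cells_def by force
  qed
  moreover from this have "mate v = x" using mate(1)[of v] v M_fst by blast
  ultimately show "x \<in> mate ` (V - {v0})" using v by blast
next
  fix x assume "x \<in> mate ` (V - {v0})"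
  then obtain v where "v \<in> V - {v0}" "x = mate v" by blast
  then show "x \<in> snd ` matched_01 K M" using mate[of v] by (force simp: matched_01_def)
qed

lemma ends_differ: assumes "x \<in> E" shows "src x \<noteq> tgt x"
proof -
  obtain u v where "u \<noteq> v" "{w \<in> V. face_le K w x} = {u, v}"
    using assms
  proof (cases rule: E_cases)
    case (1 g)
    then show ?thesis using that[of "{Vertex}" "mid g"] ends_of_half(1)[of g] by (auto simp: mid_def)
  next
    case (2 g)
    then show ?thesis using that[of "{Vertex}" "mid g"] ends_of_half(2)[of g] by (auto simp: mid_def)
  next
    case (3 i j)
    then show ?thesis using that[of "apex i" "corner i j"] ends_of_ray[of i j] apex_not_corner by auto
  qed
  then show ?thesis using ends[OF assms] by (auto simp: doubleton_eq_iff)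
qed

definition tree_letter :: "kpoint set \<Rightarrow> kpoint set \<times> bool" where
  "tree_letter v = arriving tgt (mate v) v"

lemma tree_letter:
  assumes "v \<in> V - {v0}"
  shows "letter_end src tgt (tree_letter v) = v" "letter_start src tgt (tree_letter v) \<in> V"
    "letter_start src tgt (tree_letter v) \<noteq> v" "face_le K (letter_start src tgt (tree_letter v)) (mate v)"
proof -
  note m = mate[OF assms]
  have "v \<in> {src (mate v), tgt (mate v)}" unfolding ends[OF m(2)] using m(3) assms by simp
  then consider "tgt (mate v) = v" | "src (mate v) = v" by blast
  then obtain u where u: "{src (mate v), tgt (mate v)} = {u, v}" and "u \<noteq> v"
  proof cases
    case 1
    then show ?thesis using that[of "src (mate v)"] ends_differ[OF m(2)] by simp
  next
    case 2
    then show ?thesis using that[of "tgt (mate v)"] ends_differ[OF m(2)] by (simp add: insert_commute)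
  qed
  from arriving_ends[where src = src and tgt = tgt and x = "mate v", OF u \<open>u \<noteq> v\<close>] have "letter_start src tgt (tree_letter v) = u" "letter_end src tgt (tree_letter v) = v"
    by (simp_all add: tree_letter_def)
  moreover have "u \<in> {w \<in> V. face_le K w (mate v)}" unfolding ends[OF m(2), symmetric] u by simp
  ultimately show "letter_end src tgt (tree_letter v) = v" "letter_start src tgt (tree_letter v) \<in> V"
    "letter_start src tgt (tree_letter v) \<noteq> v" "face_le K (letter_start src tgt (tree_letter v)) (mate v)"
    using \<open>u \<noteq> v\<close> by auto
qed

text \<open>A cycle of parents would be a cycle of the Hasse diagram modified along M.\<close>

lemma tree: "rooted_tree src tgt E V v0 tree_letter"
proof
  let ?D = "(hasse K - M) \<union> M\<inverse>"
  have "{(letter_start src tgt (tree_letter v), v) |v. v \<in> V - {v0}} \<subseteq> ?D\<^sup>+"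
  proof (intro subsetI)
    fix p assume "p \<in> {(letter_start src tgt (tree_letter v), v) |v. v \<in> V - {v0}}"
    then obtain v u where v: "v \<in> V - {v0}" and u: "u = letter_start src tgt (tree_letter v)" "p = (u, v)" by blast
    have "(u, mate v) \<in> hasse K" unfolding u using tree_letter[OF v] mate[OF v] by (intro hasse_V_E)
    moreover have "(u, mate v) \<notin> M" using M_snd mate(1)[OF v] tree_letter(3)[OF v] u by blast
    moreover have "(mate v, v) \<in> M\<inverse>" using mate(1)[OF v] by simp
    ultimately show "p \<in> ?D\<^sup>+" unfolding u(2) by (meson DiffI UnI1 UnI2 r_into_trancl trancl_into_trancl)
  qed
  moreover have "acyclic (?D\<^sup>+)" using M_acyclic by (simp add: acyclic_def)
  ultimately show "acyclic {(letter_start src tgt (tree_letter v), v) |v. v \<in> V - {v0}}"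
    by (rule acyclic_subset[rotated])
  show "inj_on (\<lambda>v. fst (tree_letter v)) (V - {v0})"
    using mate(1) M_snd by (auto simp: inj_on_def tree_letter_def) (metis Diff_iff singletonD)+
  fix v assume v: "v \<in> V - {v0}"
  show "fst (tree_letter v) \<in> E" using mate(2)[OF v] by (simp add: tree_letter_def)
qed (use finite_cells v0_V tree_letter in auto)

lemma tree_edges: "rooted_tree.edges V v0 tree_letter = snd ` matched_01 K M"
  by (simp add: rooted_tree.edges_def[OF tree] matched_edges tree_letter_def)

text \<open>
  The apex of a face with an empty relator is isolated, whereas the tree reaches every vertex.
\<close>

lemma nonempty_relators: assumes i: "i < m" shows "0 < len i"
proof (rule ccontr)
  assume "\<not> 0 < len i"
  then have len: "len i = 0" by simp
  have isolated: "apex i \<notin> {src x, tgt x}" if "x \<in> E" for x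
  proof
    assume "apex i \<in> {src x, tgt x}"
    then have face: "face_le K (apex i) x" using ends[OF that] by blast
    have a: "apex i \<in> all_cells K" using apex_V[OF i] all_cellsI by blast
    from that show False
    proof (cases rule: E_cases)
      case (1 g)
      then have "apex i \<in> {half1 g, {Vertex}, mid g}" using face_of_half(1)[OF _ a] face by blast
      then show False by (auto simp: apex_def half1_def mid_def)
    next
      case (2 g)
      then have "apex i \<in> {half2 g, {Vertex}, mid g}" using face_of_half(2)[OF _ a] face by blast
      then show False by (auto simp: apex_def half2_def mid_def)
    next
      case (3 i' j)
      then have "apex i \<in> {ray i' j, apex i', corner i' j}" using face_of_ray[OF _ _ a] face by blast
      moreover have "apex i \<noteq> ray i' j" using apex_V[OF i] ray_E[OF 3(1,2)] V_E_disjoint 3 by auto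
      ultimately have "apex i = apex i'" using apex_not_corner by auto
      then have "i = i'" by (simp add: apex_def)
      then show False using 3 len by simp
    qed
  qed
  interpret T: rooted_tree src tgt E V v0 tree_letter by (rule tree)
  show False
  proof (cases "v0 = apex i")
    case True
    have "{Vertex} \<noteq> v0" using True by (simp add: apex_def)
    moreover have walk: "letters (T.path {Vertex}) \<subseteq> E" "walk src tgt v0 (T.path {Vertex}) {Vertex}"
      using T.path_walk[OF vertex_V] by auto
    ultimately obtain l w where "T.path {Vertex} = l # w" by (cases "T.path {Vertex}") auto
    then have "fst l \<in> E" "v0 = letter_start src tgt l" using walk by auto
    then show False using isolated[of "fst l"] True by (auto simp: letter_start_def split: if_splits)
  next
    case False
    then have v: "apex i \<in> V - {v0}" using apex_V[OF i] by auto
    have "fst (tree_letter (apex i)) \<in> E" "letter_end src tgt (tree_letter (apex i)) = apex i"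
      using mate(2)[OF v] tree_letter(1)[OF v] by (auto simp: tree_letter_def)
    then show False using isolated by (auto simp: letter_end_def split: if_splits)
  qed
qed

sublocale oriented_nonempty
  by unfold_locales (rule nonempty_relators)

lemma standard_to_matched_tree:
  "P_pres \<sim>\<^sub>Q (E, letter_relators (snd ` matched_01 K M) + boundary)"
proof -
  obtain l where l: "rooted_tree src tgt E V v0 l" "rooted_tree.edges V v0 l = standard_tree"
    using standard_tree_star[OF v0_V] .
  have "P_pres \<sim>\<^sub>Q (E, letter_relators standard_tree + boundary)"
    by (rule pres_equiv.sym[OF triangulation_equiv])
  also have "\<dots> \<sim>\<^sub>Q (E, letter_relators (snd ` matched_01 K M) + boundary)"
    unfolding l(2)[symmetric] tree_edges[symmetric]
    by (rule change_of_tree[OF l(1) tree finite_cells(2) V_E_disjoint]) (use boundary_letters ends_V in auto)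
  finally show ?thesis .
qed

lemma initial_equiv: "P_pres \<sim>\<^sub>Q of_labelled (initial_presentation K M \<omega>)"
proof -
  let ?T = "snd ` matched_01 K M"
  have T: "finite ?T" using finite_cells(1) by (simp add: matched_edges)
  note standard_to_matched_tree
  also have "(E, letter_relators ?T + boundary) \<sim>\<^sub>Q (E - ?T, image_mset (filter (\<lambda>l. fst l \<notin> ?T)) boundary)"
    using pres_equiv_over[OF standard_to_matched_tree] T by (intro eliminate_letters) auto
  also have "(E - ?T, image_mset (filter (\<lambda>l. fst l \<notin> ?T)) boundary) = of_labelled (initial_presentation K M \<omega>)"
  proof -
    let ?R = "\<lambda>e. if e \<in> cx_cells K 2 then Some (filter (\<lambda>l. fst l \<notin> ?T) (\<omega> e)) else None"
    have "dom ?R = cx_cells K 2" by (auto split: if_splits)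
    moreover have "image_mset (filter (\<lambda>l. fst l \<notin> ?T)) boundary = image_mset (\<lambda>e. the (?R e)) (mset_set (cx_cells K 2))"
      unfolding boundary_def multiset.map_comp using finite_cells(3) by (intro image_mset_cong) simp
    ultimately show ?thesis by (simp add: of_labelled_def initial_presentation_def Let_def)
  qed
  finally show ?thesis .
qed

text \<open>
  A 2-cell is smaller than those 2-cells whose partners are sides of it.
\<close>

definition cell_order :: "(kpoint set \<times> kpoint set) set" where
  "cell_order = {(e, e'). \<exists>x'. (x', e') \<in> M \<and> (x', e) \<in> hasse K \<and> e \<noteq> e'}\<^sup>+"

text \<open>
  Each step from e to e' is a path from e' to e in the modified Hasse diagram: down from e' to its partner
  and up to e.
\<close>

lemma cell_order_irrefl: "(e, e) \<notin> cell_order"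
proof
  let ?D = "(hasse K - M) \<union> M\<inverse>"
  let ?B = "{(e, e'). \<exists>x'. (x', e') \<in> M \<and> (x', e) \<in> hasse K \<and> e \<noteq> e'}"
  have B: "(e', e) \<in> ?D\<^sup>+" if below: "(e, e') \<in> ?B" for e e'
  proof -
    obtain x' where x': "(x', e') \<in> M" "(x', e) \<in> hasse K" "e \<noteq> e'" using below by blast
    then have "(x', e) \<notin> M" using M_fst by blast
    with x' show ?thesis by (meson DiffI UnI1 UnI2 converseI r_into_trancl trancl_into_trancl)
  qed
  assume "(e, e) \<in> cell_order"
  moreover have "(e', e) \<in> ?D\<^sup>+" if "(e, e') \<in> ?B\<^sup>+" for e e'
    using that
  proof (induction rule: trancl_induct)
    case (base y)
    then show ?case by (rule B)
  next
    case (step y z)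
    then show ?case using B[of y z] by (meson trancl_trans)
  qed
  ultimately show False using M_acyclic by (auto simp: cell_order_def acyclic_def)
qed

lemma occ_distinct:
  assumes "distinct (map fst w)" "x \<in> letters w" shows "occ x w = 1"
  using assms by (induction w) (auto simp: occ_0_iff letters_def)

text \<open>
  The partner of a 2-cell is not an edge of the tree, for a cell has only one partner; so its letter
  survives the deletion of the tree letters.
\<close>

lemma eliminable_matched:
  "eliminable cell_order (matched_12 K M) (snd (initial_presentation K M \<omega>))"
proof -
  let ?T = "snd ` matched_01 K M"
  have new: "e \<in> dom (snd (initial_presentation K M \<omega>))"
    "the (snd (initial_presentation K M \<omega>) e) = filter (\<lambda>l. fst l \<notin> ?T) (\<omega> e)" if "e \<in> cx_cells K 2" for e
    using that by (auto simp: initial_presentation_def Let_def)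
  have once: "occ x (filter (\<lambda>l. fst l \<notin> ?T) (\<omega> e)) = 1"
    if "(x, e) \<in> M" "x \<in> E" "e \<in> cx_cells K 2" for x e
  proof (rule occ_distinct)
    show "distinct (map fst (filter (\<lambda>l. fst l \<notin> ?T) (\<omega> e)))"
      using boundary_word(1)[OF that(3)] by (simp add: distinct_map_filter)
    have "x \<notin> ?T"
    proof
      assume "x \<in> ?T"
      then obtain v where "(v, x) \<in> M" "v \<in> V" by (auto simp: matched_01_def)
      then show False using M_chain[OF _ that(1)] that(2) V_E_disjoint by blast
    qed
    moreover have "face_le K x e" using that(1) M_hasse by (auto simp: hasse_def)
    ultimately show "x \<in> letters (filter (\<lambda>l. fst l \<notin> ?T) (\<omega> e))"
      using boundary_word(2)[OF that(3)] that(2) by simp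
  qed
  have below: "(e, e') \<in> cell_order"
    if "e \<in> cx_cells K 2" "(x', e') \<in> M" "e' \<noteq> e" "x' \<in> letters (\<omega> e)" for e e' x'
  proof -
    have "x' \<in> E" "face_le K x' e" using boundary_word(2)[OF that(1)] that(4) by auto
    then have "(x', e) \<in> hasse K" using that(1) by (intro hasse_E_2)
    then show ?thesis unfolding cell_order_def using that(2,3) by (intro r_into_trancl) auto
  qed
  show ?thesis
    unfolding eliminable_def matched_12_def
    using new once below by fastforce
qed

theorem Morse_equiv:
  assumes "distinct ps" "set ps = matched_12 K M"
  shows "P_pres \<sim>\<^sub>Q of_labelled (fold eliminate ps (initial_presentation K M \<omega>))"
proof -
  note initial_equiv
  also have "of_labelled (initial_presentation K M \<omega>) \<sim>\<^sub>Q of_labelled (fold eliminate ps (initial_presentation K M \<omega>))"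
  proof (rule fold_eliminate_equiv[where D = cell_order])
    show "over (of_labelled (initial_presentation K M \<omega>))"
      using pres_equiv_over[OF initial_equiv] by blast
    have "dom (snd (initial_presentation K M \<omega>)) \<subseteq> cx_cells K 2"
      by (auto simp: initial_presentation_def Let_def split: if_splits)
    then show "finite (dom (snd (initial_presentation K M \<omega>)))"
      using finite_cells(3) finite_subset by blast
    show "eliminable cell_order (set ps) (snd (initial_presentation K M \<omega>))"
      unfolding assms(2) by (rule eliminable_matched)
    show "trans cell_order" by (simp add: cell_order_def)
    have "set ps \<subseteq> M" unfolding assms(2) by (auto simp: matched_12_def)
    then have M: "(fst p, snd p) \<in> M" if "p \<in> set ps" for p using that by auto
    have "inj_on fst (set ps)"
      by (rule inj_onI) (metis M M_fst prod.collapse)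
    moreover have "inj_on snd (set ps)"
      by (rule inj_onI) (metis M M_snd prod.collapse)
    ultimately show "distinct (map fst ps)" "distinct (map snd ps)"
      using assms(1) by (simp_all add: distinct_map)
  qed (rule cell_order_irrefl)
  finally show ?thesis .
qed

end

lemma numbering_realizes:
  assumes "is_numbering L Q" shows "realizes (of_labelled L) (apsnd (map free_reduce) Q)"
proof -
  obtain \<nu> es where \<nu>: "bij_betw \<nu> (fst L) {..<fst Q}" and es: "distinct es" "set es = dom (snd L)"
    and Q: "snd Q = map (\<lambda>e. map (apfst \<nu>) (the (snd L e))) es"
    using assms by (auto simp: is_numbering_def)
  have "mset es = mset_set (dom (snd L))" using es mset_set_set by metis
  then show ?thesis
    unfolding realizes_def of_labelled_def
    by (intro exI[of _ \<nu>] exI[of _ "map (\<lambda>e. the (snd L e)) es"])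
      (simp add: \<nu> Q renumber_def o_def)
qed

theorem theorem2p9:
  fixes P Q :: presentation
    and M :: "(kpoint set \<times> kpoint set) set"
  assumes "is_presentation P"
    and "is_acyclic_matching (barycentric_subdivision P) M"
    and "\<exists>!v. v \<in> critical_cells (barycentric_subdivision P) M 0"
    and "is_Morse_presentation (barycentric_subdivision P) M Q"
  shows "Qss_equivalent P Q"
proof -
  obtain n rs where P: "P = (n, rs)" by fastforce
  obtain v0 where v0: "critical_cells (barycentric_subdivision P) M 0 = {v0}" using assms(3) by blast
  obtain src tgt \<omega> ps where
    "is_orientation (barycentric_subdivision P) src tgt"
    "\<forall>e\<in>cx_cells (barycentric_subdivision P) 2. attaching_word (barycentric_subdivision P) src tgt e (\<omega> e)"
    and ps: "distinct ps" "set ps = matched_12 (barycentric_subdivision P) M"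
    and numbering: "is_numbering (fold eliminate ps (initial_presentation (barycentric_subdivision P) M \<omega>)) Q"
    using assms(4) unfolding is_Morse_presentation_def by blast
  then interpret morse n rs src tgt \<omega> M v0
    using assms(1,2) v0 unfolding P by unfold_locales auto
  have "linked P_pres (of_labelled (fold eliminate ps (initial_presentation K M \<omega>)))"
    using ps unfolding P by (intro pres_equiv_linked Morse_equiv)
  then have "reach (n, map free_reduce rs) (apsnd (map free_reduce) Q)"
    using P_realized numbering_realizes[OF numbering] unfolding linked_def P by blast
  then show ?thesis by (simp add: Qss_equivalent_def P)
qed


end
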